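(* Let $(X_i,Y_i)_{i\ge1}$ be i.i.d. random vectors in $\mathbb{R}^2$ with joint c.d.f. $H$ and equal marginal c.d.f.s $F=G$. Assume that $F$ has support $[0,1]$ and is twice differentiable with positive derivative $f$ on $(0,1)$, and that $h_X=f\circ F^{-1}$ satisfies $$\sup_{0<u<1}\min(u,1-u)|(\log h_X)'(u)|<\infty,\qquad\sup_{0<u<1}\frac{\min(u,1-u)}{(|F^{-1}(u)|+1)h_X(u)}<\infty.$$ Let $c(x,y)=\rho_c(x-y)$ be a locally admissible cost as defined in the context, with exponents $b_-<b'$ and $b_+<b'$ at $0$, where $b'>1$ is such that $$\int_0^1\left(\frac{\sqrt{u(1-u)}}{h_X(u)}\right)^{b'}du<+\infty.$$ Let $v_n=1/\rho(1/\sqrt n)$. Then, as $n\to\infty$, $$v_nW_c(\mathbb{F}_n,\mathbb{G}_n)\longrightarrow_{weak}\ \pi_-\int_0^11_{\{\mathbb{B}(u)<0\}}|\mathbb{B}(u)|^{b_-}du+\pi_+\int_0^11_{\{\mathbb{B}(u)>0\}}|\mathbb{B}(u)|^{b_+}du,$$ and the limiting random variable is almost surely finite and, if $\mathbb{P}(X_1=Y_1)<1$, positive.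
   Context: $\mathbb{F}_n,\mathbb{G}_n$ are the empirical c.d.f.s of $X_1,\dots,X_n$ and $Y_1,\dots,Y_n$, $F^{-1}$ is the generalized inverse, and $W_c(\mathbb{F}_n,\mathbb{G}_n)=\int_0^1c(\mathbb{F}_n^{-1}(u),\mathbb{G}_n^{-1}(u))du=\frac1n\sum_{i=1}^nc(X_{(i)},Y_{(i)})$. Locally admissible cost: $\rho_c:\mathbb{R}\to[0,\infty)$ is convex, $\rho_c(0)=0$, $\rho_c(x)=\rho_+(x)$ for $x\ge0$, $\rho_c(x)=\rho_-(-x)$ for $x\le0$, with $\rho_\pm\in C^2((0,\infty))$; for some $x_0>0$ and all $0<x\le x_0$, $\rho_\pm(x)=x^{b_\pm}L_\pm(x)>0$ with $b_\pm\ge1$, $L_\pm\in C^2((0,x_0))$ positive and slowly varying at $0$, and, if $b_\pm=1$, moreover $L_\pm(x)\to L_\pm(0)\in[0,\infty)$ as $x\searrow0$; and, with $\rho=\max(\rho_+,\rho_-)$, the limits $\pi_\pm=\lim_{x\searrow0}\rho_\pm(x)/\rho(x)\in[0,1]$ exist. Limit process: $(B^X,B^Y)$ is a jointly centered Gaussian process on $(0,1)$ such that $B^X,B^Y$ are standard Brownian bridges and $\mathrm{cov}(B^X(u),B^Y(v))=H(F^{-1}(u),G^{-1}(v))-uv$; $h_Y=G'\circ G^{-1}$ ($=h_X$ here); $\mathbb{B}(u)=B^X(u)/h_X(u)-B^Y(u)/h_Y(u)$. $\to_{weak}$ is convergence in distribution. *)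

theory Defs
  imports "HOL-Probability.Probability"
begin

definition quantile :: "(real \<Rightarrow> real) \<Rightarrow> real \<Rightarrow> real" where
  "quantile F u = Inf {x. u \<le> F x}"

definition ecdf :: "(nat \<Rightarrow> 'a \<Rightarrow> real) \<Rightarrow> nat \<Rightarrow> 'a \<Rightarrow> real \<Rightarrow> real" where
  "ecdf X n \<omega> x = real (card {i \<in> {1..n}. X i \<omega> \<le> x}) / real n"

text \<open>The arguments \<open>F\<close> and \<open>G\<close> are cumulative distribution functions.\<close>

definition Wc :: "(real \<Rightarrow> real \<Rightarrow> real) \<Rightarrow> (real \<Rightarrow> real) \<Rightarrow> (real \<Rightarrow> real) \<Rightarrow> real" where
  "Wc c F G = (LBINT u:{0<..<1}. c (quantile F u) (quantile G u))"

definition law_support :: "real measure \<Rightarrow> real set" where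
  "law_support \<mu> = {x. \<forall>U. open U \<longrightarrow> x \<in> U \<longrightarrow> 0 < measure \<mu> U}"


definition C2_on :: "(real \<Rightarrow> real) \<Rightarrow> real set \<Rightarrow> bool" where
  "C2_on g S \<longleftrightarrow> (\<exists>g' g''. (\<forall>x\<in>S. (g has_real_derivative g' x) (at x)
     \<and> (g' has_real_derivative g'' x) (at x)) \<and> continuous_on S g'')"

definition slowly_varying_at_0 :: "(real \<Rightarrow> real) \<Rightarrow> bool" where
  "slowly_varying_at_0 L \<longleftrightarrow> (\<forall>t>0. ((\<lambda>x. L (t * x) / L x) \<longlongrightarrow> 1) (at_right 0))"

text \<open>The two branches of a cost are considered as functions on the nonnegative half-line only.\<close>

definition branch_pos :: "(real \<Rightarrow> real) \<Rightarrow> real \<Rightarrow> real" where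
  "branch_pos \<rho>c x = \<rho>c x"

definition branch_neg :: "(real \<Rightarrow> real) \<Rightarrow> real \<Rightarrow> real" where
  "branch_neg \<rho>c x = \<rho>c (- x)"

definition branch_max :: "(real \<Rightarrow> real) \<Rightarrow> real \<Rightarrow> real" where
  "branch_max \<rho>c x = max (branch_pos \<rho>c x) (branch_neg \<rho>c x)"

definition regular_branch :: "(real \<Rightarrow> real) \<Rightarrow> real \<Rightarrow> real \<Rightarrow> bool" where
  "regular_branch r b x0 \<longleftrightarrow> C2_on r {0<..} \<and> 1 \<le> b \<and>
     (\<exists>L. (\<forall>x. 0 < x \<and> x \<le> x0 \<longrightarrow> r x = x powr b * L x \<and> 0 < r x \<and> 0 < L x)
        \<and> C2_on L {0<..<x0} \<and> slowly_varying_at_0 L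
        \<and> (b = 1 \<longrightarrow> (\<exists>l\<ge>0. (L \<longlongrightarrow> l) (at_right 0))))"

definition locally_admissible ::
  "(real \<Rightarrow> real) \<Rightarrow> real \<Rightarrow> real \<Rightarrow> real \<Rightarrow> real \<Rightarrow> bool" where
  "locally_admissible \<rho>c bneg bpos \<pi>neg \<pi>pos \<longleftrightarrow>
     convex_on UNIV \<rho>c \<and> (\<forall>x. 0 \<le> \<rho>c x) \<and> \<rho>c 0 = 0
     \<and> (\<exists>x0>0. regular_branch (branch_pos \<rho>c) bpos x0 \<and> regular_branch (branch_neg \<rho>c) bneg x0)
     \<and> \<pi>neg \<in> {0..1} \<and> ((\<lambda>x. branch_neg \<rho>c x / branch_max \<rho>c x) \<longlongrightarrow> \<pi>neg) (at_right 0)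
     \<and> \<pi>pos \<in> {0..1} \<and> ((\<lambda>x. branch_pos \<rho>c x / branch_max \<rho>c x) \<longlongrightarrow> \<pi>pos) (at_right 0)"


definition cov :: "'a measure \<Rightarrow> ('a \<Rightarrow> real) \<Rightarrow> ('a \<Rightarrow> real) \<Rightarrow> real" where
  "cov N U V = (\<integral>\<omega>. (U \<omega> - (\<integral>\<xi>. U \<xi> \<partial>N)) * (V \<omega> - (\<integral>\<xi>. V \<xi> \<partial>N)) \<partial>N)"

text \<open>Degenerate Gaussian variables (\<open>\<sigma> = 0\<close>) are allowed.\<close>

definition centered_gaussian :: "'a measure \<Rightarrow> ('a \<Rightarrow> real) \<Rightarrow> bool" where
  "centered_gaussian N Z \<longleftrightarrow> Z \<in> borel_measurable N \<and>
     (\<exists>\<sigma>\<ge>0. distr N borel Z =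
       (if \<sigma> = 0 then return borel 0 else density lborel (\<lambda>x. ennreal (normal_density 0 \<sigma> x))))"

definition centered_gaussian_process ::
  "'a measure \<Rightarrow> 'i set \<Rightarrow> ('i \<Rightarrow> 'a \<Rightarrow> real) \<Rightarrow> bool" where
  "centered_gaussian_process N I Z \<longleftrightarrow>
     (\<forall>J a. finite J \<longrightarrow> J \<subseteq> I \<longrightarrow> centered_gaussian N (\<lambda>\<omega>. \<Sum>j\<in>J. a j * Z j \<omega>))"

definition brownian_bridge :: "'a measure \<Rightarrow> (real \<Rightarrow> 'a \<Rightarrow> real) \<Rightarrow> bool" where
  "brownian_bridge N B \<longleftrightarrow> centered_gaussian_process N {0<..<1} B
     \<and> (\<forall>u\<in>{0<..<1}. \<forall>v\<in>{0<..<1}. cov N (B u) (B v) = min u v - u * v)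
     \<and> (\<forall>\<omega>\<in>space N. continuous_on {0<..<1} (\<lambda>u. B u \<omega>))"

text \<open>The disjoint sum of the two index sets expresses joint Gaussianity of the pair.\<close>

definition limit_process :: "'a measure \<Rightarrow> (real \<Rightarrow> real \<Rightarrow> real) \<Rightarrow> (real \<Rightarrow> real) \<Rightarrow>
    (real \<Rightarrow> real) \<Rightarrow> (real \<Rightarrow> 'a \<Rightarrow> real) \<Rightarrow> (real \<Rightarrow> 'a \<Rightarrow> real) \<Rightarrow> bool" where
  "limit_process N H F G BX BY \<longleftrightarrow>
     centered_gaussian_process N ({0<..<1} <+> {0<..<1}) (case_sum BX BY)
     \<and> brownian_bridge N BX \<and> brownian_bridge N BY
     \<and> (\<forall>u\<in>{0<..<1}. \<forall>v\<in>{0<..<1}.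
          cov N (BX u) (BY v) = H (quantile F u) (quantile G v) - u * v)"

text \<open>Extended-valued, so that finiteness of the limit is a genuine assertion.\<close>

definition limit_functional ::
  "real \<Rightarrow> real \<Rightarrow> real \<Rightarrow> real \<Rightarrow> (real \<Rightarrow> real) \<Rightarrow> ennreal" where
  "limit_functional bneg bpos \<pi>neg \<pi>pos b =
     ennreal \<pi>neg * (\<integral>\<^sup>+u\<in>{0<..<1}. indicator {u. b u < 0} u * ennreal (\<bar>b u\<bar> powr bneg) \<partial>lborel)
   + ennreal \<pi>pos * (\<integral>\<^sup>+u\<in>{0<..<1}. indicator {u. b u > 0} u * ennreal (\<bar>b u\<bar> powr bpos) \<partial>lborel)"

end

theory Submission
  imports Defs
begin

text \<open>
  Write \<open>D\<^sub>n u\<close> for \<open>sqrt n\<close> times the difference of the two empirical quantile functions and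
  \<open>\<phi>\<^sub>n x = v n * \<rho>c (x / sqrt n)\<close>, so that the statistic is the integral of \<open>\<phi>\<^sub>n (D\<^sub>n u)\<close> over \<open>(0,1)\<close>.
  No strong approximation of the quantile processes is needed, because three facts suffice.
  First, by a weighted Hardy inequality for the beta distributions of the uniform order statistics
  (Bobkov--Ledoux), the \<open>b'\<close>-th moments of \<open>D\<^sub>n\<close>, integrated over \<open>u\<close>, are bounded uniformly in \<open>n\<close>
  by the integral assumed to be finite.
  Second, by monotonicity of the branches and a Potter bound, \<open>\<phi>\<^sub>n\<close> and its limit \<open>\<phi>\<close> are both within
  \<open>\<epsilon> (1 + |x|\<^sup>b\<^sup>')\<close> of one function \<open>g x = P (sin (\<kappa> x))\<close> with a polynomial \<open>P\<close>.
  Third, the \<open>k\<close>-th moment of the integral of \<open>g (D\<^sub>n u)\<close> is an integral over \<open>(0,1)\<^sup>k\<close> of expectations of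
  products \<open>g (D\<^sub>n u\<^sub>1) \<cdots> g (D\<^sub>n u\<^sub>k)\<close>, which are finite sums of values of characteristic functions;
  they converge by the Bahadur representation and the one-dimensional central limit theorem.
  For the positivity of the limit, the difference of the two bridges takes both signs almost surely
  since it decorrelates towards the left end of the support of its variance.
\<close>

text \<open>The difficulty sits at the ends of \<open>(0,1)\<close>: \<open>1 / h_X\<close> may
  explode there, so neither \<open>D\<^sub>n\<close> nor its limit need be bounded in
  \<open>u\<close>, and only moments integrated over \<open>u\<close> are under control. Any
  dependence within a pair is allowed. The moment bound ignores it by centring both samples at the
  same quantile, which equality of the marginals permits; the dependence enters only through the
  covariance of the finite-dimensional limit. As the samples lie in the unit interval,
  \<open>D\<^sub>n\<close> is at most \<open>sqrt n\<close> in absolute value, so the cost is only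
  evaluated on \<open>[-1,1]\<close>, where its behaviour at 0 and the monotonicity of its branches
  give a Potter bound. The strict gap between the exponents of the branches and \<open>b'\<close>
  leaves room for an exponent \<open>q\<close> in between: large enough for the Potter bound, small
  enough for \<open>|x|^q\<close> to be negligible against \<open>|x|^b'\<close> at infinity. One of
  the weights of the two branches may vanish, and then the limit sees only one sign of the Gaussian
  process; this is why the bridges must be shown to differ in both directions.\<close>

section \<open>The distribution of uniform order statistics\<close>

text \<open>Density (beta with parameters \<open>i\<close> and \<open>n + 1 - i\<close>) and distribution function of the \<open>i\<close>-th order
  statistic of \<open>n\<close> independent uniform variables.\<close>

definition os_density :: "nat \<Rightarrow> nat \<Rightarrow> real \<Rightarrow> real" where
  "os_density n i s = real (i * (n choose i)) * s ^ (i - 1) * (1 - s) ^ (n - i)"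

definition os_cdf :: "nat \<Rightarrow> nat \<Rightarrow> real \<Rightarrow> real" where
  "os_cdf n i s = (\<Sum>k=i..n. real (n choose k) * s ^ k * (1 - s) ^ (n - k))"

text \<open>The derivative of the \<open>k\<close>-th binomial term is the density of index
  \<open>k\<close> minus the density of index \<open>k + 1\<close>, so the sum telescopes. The
  downward induction starts at \<open>Suc n\<close>, where the sum is empty and the binomial
  coefficient in the density vanishes.\<close>

lemma os_cdf_deriv:
  assumes "1 \<le> i" "i \<le> Suc n"
  shows "(os_cdf n i has_real_derivative os_density n i s) (at s)"
  using assms(2,1)
proof (induction i rule: inc_induct)
  case base
  have "os_cdf n (Suc n) = (\<lambda>_. 0)" by (auto simp: os_cdf_def)
  then show ?case by (simp add: os_density_def binomial_eq_0)
next
  case (step i)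
  have i: "i \<le> n" "1 \<le> i" using step by auto
  have eq: "os_cdf n i = (\<lambda>s. real (n choose i) * s ^ i * (1 - s) ^ (n - i) + os_cdf n (Suc i) s)"
    using i by (auto simp: os_cdf_def sum.atLeast_Suc_atMost)
  have c: "real (Suc i * (n choose Suc i)) = real (n - i) * real (n choose i)"
    by (metis binomial_absorb_comp binomial_absorption of_nat_mult)
  have d: "((\<lambda>s. real (n choose i) * s ^ i * (1 - s) ^ (n - i)) has_real_derivative
      os_density n i s - os_density n (Suc i) s) (at s)"
    unfolding os_density_def c using i
    by (auto intro!: derivative_eq_intros simp: algebra_simps)
  have "((\<lambda>s. real (n choose i) * s ^ i * (1 - s) ^ (n - i) + os_cdf n (Suc i) s) has_real_derivative
      (os_density n i s - os_density n (Suc i) s) + os_density n (Suc i) s) (at s)"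
    by (rule DERIV_add[OF d]) (use step i in auto)
  then show ?case unfolding eq by simp
qed

lemma os_cdf_0: "1 \<le> i \<Longrightarrow> os_cdf n i 0 = 0"
  by (auto simp: os_cdf_def intro!: sum.neutral)

lemma os_cdf_1: assumes "i \<le> n" shows "os_cdf n i 1 = 1"
proof -
  have "os_cdf n i 1 = (\<Sum>k=i..n. if k = n then 1 else 0)"
    unfolding os_cdf_def by (intro sum.cong) auto
  then show ?thesis using assms by simp
qed

lemma os_density_nonneg: "0 \<le> s \<Longrightarrow> s \<le> 1 \<Longrightarrow> 0 \<le> os_density n i s"
  by (simp add: os_density_def)

lemma continuous_on_os_density [continuous_intros]: "continuous_on A (os_density n i)"
  unfolding os_density_def by (intro continuous_intros)

text \<open>Pearson's equation of the beta law: \<open>s * (1 - s) / (n + 1)\<close> is its Stein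
  kernel, so the weighted density increases up to the mean \<open>i / (n + 1)\<close> and decreases
  beyond it.\<close>

lemma os_weight_deriv:
  assumes "1 \<le> i" "i \<le> n"
  shows "((\<lambda>s. s * (1 - s) * os_density n i s) has_real_derivative
    (real i - real (Suc n) * s) * os_density n i s) (at s)"
proof -
  have e: "(\<lambda>s. s * (1 - s) * os_density n i s) =
    (\<lambda>s. real (i * (n choose i)) * (s ^ i * (1 - s) ^ Suc (n - i)))"
    using assms by (auto simp: os_density_def fun_eq_iff power_eq_if[of _ i] algebra_simps)
  have p: "s ^ i = s * s ^ (i - 1)" using assms by (simp add: power_eq_if)
  have "((\<lambda>s. real (i * (n choose i)) * (s ^ i * (1 - s) ^ Suc (n - i))) has_real_derivative
    (real (i * (n choose i)) * (real i * s ^ (i - 1) * (1 - s) ^ Suc (n - i)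
      - s ^ i * (real (Suc (n - i)) * (1 - s) ^ (n - i))))) (at s)"
    by (rule derivative_eq_intros refl | simp)+
  also have "real (i * (n choose i)) * (real i * s ^ (i - 1) * (1 - s) ^ Suc (n - i)
      - s ^ i * (real (Suc (n - i)) * (1 - s) ^ (n - i)))
     = (real i * (1 - s) - real (Suc (n - i)) * s) * os_density n i s"
    unfolding os_density_def p by (simp add: algebra_simps)
  also have "real i * (1 - s) - real (Suc (n - i)) * s = real i - real (Suc n) * s"
    using assms by (simp add: algebra_simps of_nat_diff)
  finally show ?thesis unfolding e .
qed

lemma os_weight_antimono:
  assumes "1 \<le> i" "i \<le> n" "real i / real (Suc n) \<le> s" "s \<le> t" "t \<le> 1"
  shows "t * (1 - t) * os_density n i t \<le> s * (1 - s) * os_density n i s"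
proof (rule DERIV_nonpos_imp_nonincreasing[OF \<open>s \<le> t\<close>])
  fix x assume x: "s \<le> x" "x \<le> t"
  have "real i / real (Suc n) \<le> x" using x assms by linarith
  then have "real i - real (Suc n) * x \<le> 0" by (simp add: field_simps)
  moreover have "0 \<le> x"
    using \<open>real i / real (Suc n) \<le> x\<close> by (rule order_trans[rotated]) simp
  ultimately show "\<exists>y. ((\<lambda>s. s * (1 - s) * os_density n i s) has_real_derivative y) (at x) \<and> y \<le> 0"
    using os_weight_deriv[OF assms(1,2)] os_density_nonneg[of x n i] x assms
    by (intro exI conjI) (auto intro!: mult_nonpos_nonneg)
qed

text \<open>A Markov-type bound. By Pearson's equation the weighted density at \<open>s\<close> is
  the integral of \<open>(n + 1) * (x - mean)\<close> times the density over \<open>x > s\<close>,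
  and this factor is at least its value at \<open>s\<close>. The bound degenerates as
  \<open>s\<close> approaches the mean.\<close>

lemma os_tail_far:
  assumes "1 \<le> i" "i \<le> n" "real i / real (Suc n) < s" "s \<le> 1"
  shows "1 - os_cdf n i s \<le> s * (1 - s) * os_density n i s / (real (Suc n) * (s - real i / real (Suc n)))"
proof -
  let ?c = "real (Suc n) * (s - real i / real (Suc n))"
  have c: "?c > 0" using assms by simp
  have cs: "?c = real (Suc n) * s - real i" by (simp add: right_diff_distrib)
  have s0: "0 \<le> s" using assms(3) by (rule order_trans[OF _ less_imp_le, rotated]) simp
  have "1 * (1 - 1) * os_density n i 1 - ?c * (1 - os_cdf n i 1) \<le>
     s * (1 - s) * os_density n i s - ?c * (1 - os_cdf n i s)"
  proof (rule DERIV_nonpos_imp_nonincreasing[OF \<open>s \<le> 1\<close>])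
    fix x assume x: "s \<le> x" "x \<le> 1"
    have "((\<lambda>s. s * (1 - s) * os_density n i s - ?c * (1 - os_cdf n i s)) has_real_derivative
       (real i - real (Suc n) * x) * os_density n i x + ?c * os_density n i x) (at x)"
    proof -
      have "((\<lambda>s. s * (1 - s) * os_density n i s - ?c * (1 - os_cdf n i s)) has_real_derivative
       (real i - real (Suc n) * x) * os_density n i x - ?c * (0 - os_density n i x)) (at x)"
        using assms by (intro DERIV_diff DERIV_cmult DERIV_const os_weight_deriv os_cdf_deriv) auto
      then show ?thesis by simp
    qed
    moreover have "(real i - real (Suc n) * x) * os_density n i x + ?c * os_density n i x
       = - (real (Suc n) * (x - s) * os_density n i x)"
      unfolding cs by (simp add: algebra_simps)
    moreover have "\<dots> \<le> 0" using x s0 os_density_nonneg[of x n i] by simp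
    ultimately show "\<exists>y. ((\<lambda>s. s * (1 - s) * os_density n i s - ?c * (1 - os_cdf n i s))
       has_real_derivative y) (at x) \<and> y \<le> 0" by (intro exI[of _ "(real i - real (Suc n) * x) * os_density n i x + ?c * os_density n i x"] conjI) simp_all
  qed
  then have "?c * (1 - os_cdf n i s) \<le> s * (1 - s) * os_density n i s"
    using os_cdf_1[OF assms(2)] by simp
  then show ?thesis using c by (simp add: field_simps)
qed

text \<open>An isoperimetric inequality of Cheeger type; only the upper tail is needed, by reflection.\<close>

lemma os_tail_bound:
  assumes i: "1 \<le> i" "i \<le> n" and s: "real i / real (Suc n) \<le> s" "s < 1"
  shows "1 - os_cdf n i s \<le> 3 * sqrt (s * (1 - s) / real (Suc n)) * os_density n i s"
proof -
  let ?N = "real (Suc n)"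
  have "0 < real i / ?N" using i by simp
  then have s0: "0 < s" using s by linarith
  have mvt: "\<exists>z. s < z \<and> z < t \<and> os_cdf n i t - os_cdf n i s = (t - s) * os_density n i z" if "s < t" for t
    using that os_cdf_deriv[of i n] i by (intro MVT2) auto
  show ?thesis
  proof (cases "s \<le> ?N * (1 - s)")
    case True
    \<comment> \<open>The case condition says that \<open>r\<close>, of the order of a standard
      deviation, is at most \<open>1 - s\<close>, so half a step to the right stays inside. On that
      half step the density at most doubles, which contributes \<open>r\<close> times the density at
      \<open>s\<close>; beyond it \<open>os_tail_far\<close> applies with a gap of at least
      \<open>r / 2\<close> and contributes \<open>2 * r\<close> times that density. This is the
      origin of the constant 3.\<close>
    define r where "r = sqrt (s * (1 - s) / ?N)"
    have rpos: "r > 0" unfolding r_def using s0 s by simp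
    have r2: "r\<^sup>2 = s * (1 - s) / ?N" unfolding r_def using s0 s by simp
    have "r \<le> 1 - s"
    proof (rule power2_le_imp_le)
      have "s * (1 - s) \<le> (?N * (1 - s)) * (1 - s)" using True s by (intro mult_right_mono) auto
      then show "r\<^sup>2 \<le> (1 - s)\<^sup>2" unfolding r2 by (simp add: field_simps power2_eq_square)
    qed (use s in auto)
    define t where "t = s + r / 2"
    have t: "s < t" "t < 1" using rpos \<open>r \<le> 1 - s\<close> s unfolding t_def by auto
    obtain z where z: "s < z" "z < t" "os_cdf n i t - os_cdf n i s = (t - s) * os_density n i z"
      using mvt[OF t(1)] by auto
    have zz: "s * (1 - s) / 2 \<le> z * (1 - z)"
    proof -
      have "s * ((1 - s) / 2) \<le> z * (1 - z)"
        using z t s0 s \<open>r \<le> 1 - s\<close> unfolding t_def by (intro mult_mono) auto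
      then show ?thesis by simp
    qed
    have bz: "0 \<le> os_density n i z" using z t s0 by (intro os_density_nonneg) auto
    have bs: "0 \<le> os_density n i s" using s s0 by (intro os_density_nonneg) auto
    have "(s * (1 - s) / 2) * os_density n i z \<le> z * (1 - z) * os_density n i z"
      using zz bz by (rule mult_right_mono)
    also have "\<dots> \<le> s * (1 - s) * os_density n i s"
      using z t by (intro os_weight_antimono i s) auto
    finally have "os_density n i z \<le> 2 * os_density n i s"
    proof -
      assume "s * (1 - s) / 2 * os_density n i z \<le> s * (1 - s) * os_density n i s"
      then have "s * (1 - s) * os_density n i z \<le> s * (1 - s) * (2 * os_density n i s)" by simp
      then show ?thesis using s s0 by (subst (asm) mult_le_cancel_left_pos) auto
    qed
    then have near: "os_cdf n i t - os_cdf n i s \<le> r * os_density n i s"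
      unfolding z(3) using rpos t_def by auto
    have "1 - os_cdf n i t \<le> t * (1 - t) * os_density n i t / (?N * (t - real i / ?N))"
      using t s by (intro os_tail_far i) auto
    also have "\<dots> \<le> s * (1 - s) * os_density n i s / (?N * (r / 2))"
    proof (rule frac_le)
      have "r / 2 \<le> t - real i / ?N" using s unfolding t_def by linarith
      then show "?N * (r / 2) \<le> ?N * (t - real i / ?N)" by (rule mult_left_mono) simp
      show "t * (1 - t) * os_density n i t \<le> s * (1 - s) * os_density n i s"
        using t s by (intro os_weight_antimono i) auto
    qed (use rpos s s0 bs in auto)
    also have "s * (1 - s) * os_density n i s / (?N * (r / 2)) = 2 * (s * (1 - s) / ?N) * os_density n i s / r"
      using rpos by (simp add: field_simps)
    also have "\<dots> = 2 * r * os_density n i s"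
      unfolding r2[symmetric] using rpos by (simp add: power2_eq_square)
    finally show ?thesis using near unfolding r_def[symmetric] by simp
  next
    case False
    then have sN: "?N * (1 - s) < s" by simp
    obtain z where z: "s < z" "z < 1" "os_cdf n i 1 - os_cdf n i s = (1 - s) * os_density n i z"
      using mvt[OF s(2)] by auto
    \<comment> \<open>Now \<open>1 - s < 1 / (n + 2)\<close>, so \<open>s ^ (i - 1)\<close> is
      bounded below by \<open>1 / 3\<close> through \<open>(1 + 1 / N) ^ N \<le> exp 1\<close>.
      Hence on the short remaining interval the density is at most three times its value at
      \<open>s\<close>.\<close>
    have inv: "1 \<le> 3 * s ^ (i - 1)"
    proof -
      have "1 / s \<le> 1 + 1 / ?N"
      proof -
        have "?N < s * (1 + ?N)" using sN by (simp add: algebra_simps)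
        then show ?thesis using s0 by (simp add: field_simps)
      qed
      then have "(1 / s) ^ Suc n \<le> (1 + 1 / ?N) ^ Suc n"
        using s0 by (intro power_mono) auto
      also have "\<dots> \<le> exp 1" by (rule exp_ge_one_plus_x_over_n_power_n) auto
      also have "\<dots> \<le> 3" by (rule exp_le)
      finally have "1 \<le> 3 * s ^ Suc n" using s0 by (simp add: power_divide divide_simps split: if_splits)
      also have "s ^ Suc n \<le> s ^ (i - 1)" using s s0 i by (intro power_decreasing) auto
      finally show ?thesis by simp
    qed
    have "os_density n i z \<le> real (i * (n choose i)) * 1 * (1 - s) ^ (n - i)"
      unfolding os_density_def using z s0 s
      by (intro mult_mono power_mono power_le_one) auto
    also have "\<dots> \<le> real (i * (n choose i)) * (3 * s ^ (i - 1)) * (1 - s) ^ (n - i)"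
      using inv s by (intro mult_right_mono mult_left_mono) auto
    also have "\<dots> = 3 * os_density n i s" by (simp add: os_density_def)
    finally have "(1 - s) * os_density n i z \<le> (1 - s) * (3 * os_density n i s)"
      using s by (intro mult_left_mono) auto
    also have "\<dots> \<le> sqrt (s * (1 - s) / ?N) * (3 * os_density n i s)"
    proof (intro mult_right_mono real_le_rsqrt)
      have "(1 - s) * (1 - s) \<le> (s / ?N) * (1 - s)"
        using sN s by (intro mult_right_mono) (auto simp: field_simps)
      then show "(1 - s)\<^sup>2 \<le> s * (1 - s) / ?N" by (simp add: power2_eq_square field_simps)
      show "0 \<le> 3 * os_density n i s" using s s0 by (simp add: os_density_nonneg)
    qed
    finally show ?thesis using z(3) os_cdf_1[OF i(2)] by simp
  qed
qed

section \<open>A weighted Hardy inequality for beta laws\<close>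

text \<open>Splitting at \<open>y = 2 * p * z\<close> makes one of the two terms on the right
  dominate alone; the factor one half on \<open>y powr p\<close> is what allows it to be absorbed
  later.\<close>

lemma young_absorb:
  fixes p y z :: real
  assumes p: "1 < p" and "0 \<le> y" "0 \<le> z"
  shows "p * y powr (p - 1) * z \<le> y powr p / 2 + p * (2 * p) powr (p - 1) * z powr p"
proof (cases "2 * p * z \<le> y")
  case True
  have "p * y powr (p - 1) * z = y powr (p - 1) * (p * z)" by simp
  also have "\<dots> \<le> y powr (p - 1) * (y / 2)" using True by (intro mult_left_mono) auto
  also have "\<dots> = y powr p / 2" using assms
    by (cases "y = 0") (auto simp: powr_diff)
  finally have "p * y powr (p - 1) * z \<le> y powr p / 2" .
  moreover have "0 \<le> p * (2 * p) powr (p - 1) * z powr p" using p by simp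
  ultimately show ?thesis by linarith
next
  case False
  then have z: "z > 0" using assms by (cases "z = 0") auto
  have "p * y powr (p - 1) * z \<le> p * (2 * p * z) powr (p - 1) * z"
    using False assms by (intro mult_right_mono mult_left_mono powr_mono2) auto
  also have "\<dots> = p * (2 * p) powr (p - 1) * z powr p"
    using z assms by (simp add: powr_mult powr_diff)
  finally have "p * y powr (p - 1) * z \<le> p * (2 * p) powr (p - 1) * z powr p" .
  moreover have "0 \<le> y powr p" by simp
  ultimately show ?thesis by linarith
qed


text \<open>The factor \<open>p (2 p)\<^sup>p\<^sup>-\<^sup>1\<close> comes from absorbing with Young's inequality and \<open>3 / sqrt (n + 1)\<close> from the tail bound.\<close>

definition hardy_const :: "nat \<Rightarrow> real \<Rightarrow> real" where
  "hardy_const n p = 2 * p * (2 * p) powr (p - 1) * (3 / sqrt (real (Suc n))) powr p"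

lemma hardy_const_nonneg: "1 < p \<Longrightarrow> 0 \<le> hardy_const n p"
  by (simp add: hardy_const_def)

text \<open>Integration by parts against the tail \<open>1 - os_cdf n i\<close>, written as
  monotonicity of an auxiliary function that vanishes at \<open>m\<close>. The boundary term at
  \<open>r\<close> is nonnegative and is dropped.\<close>

lemma hardy_upper_Icc:
  fixes g g' :: "real \<Rightarrow> real"
  assumes i: "1 \<le> i" "i \<le> n" and p: "1 < p"
    and g: "\<And>s. s \<in> {0<..<1} \<Longrightarrow> (g has_real_derivative g' s) (at s)"
    and g': "continuous_on {0<..<1} g'" "\<And>s. s \<in> {0<..<1} \<Longrightarrow> 0 < g' s"
    and m: "m = real i / real (Suc n)" and r: "m \<le> r" "r < 1"
  shows "integral {m..r} (\<lambda>s. (g s - g m) powr p * os_density n i s) \<le>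
    hardy_const n p * integral {m..r} (\<lambda>s. (sqrt (s * (1 - s)) * g' s) powr p * os_density n i s)"
    (is "integral _ ?A \<le> _ * integral _ ?B")
proof -
  have m0: "0 < m" unfolding m using i by simp
  have sub: "{m..r} \<subseteq> {0<..<1}" using m0 r by auto
  have gc: "continuous_on {0<..<1} g"
    by (rule DERIV_continuous_on[OF has_field_derivative_at_within[OF g]])
  have gmono: "g m < g s" if "m < s" "s < 1" for s
  proof (rule DERIV_pos_imp_increasing[OF \<open>m < s\<close>])
    fix x assume "m \<le> x" "x \<le> s"
    then have "x \<in> {0<..<1}" using that m0 by auto
    then show "\<exists>y. (g has_real_derivative y) (at x) \<and> 0 < y" using g g'(2) by blast
  qed
  have gm0: "g m \<le> g s" if "s \<in> {m..r}" for s
    using that gmono[of s] r by (cases "s = m") auto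
  have contA: "continuous_on {m..r} ?A"
    by (intro continuous_intros continuous_on_powr' continuous_on_subset[OF gc sub])
       (use gm0 p in auto)
  have contB: "continuous_on {m..r} ?B"
    using g' sub by (intro continuous_intros continuous_on_powr' continuous_on_subset[OF g'(1) sub])
       (use p in \<open>auto simp: less_imp_le\<close>)
  \<comment> \<open>The factor 2 matters: differentiating the tail contributes
    \<open>-2 * ?A\<close>, which turns \<open>?A\<close> into \<open>-?A\<close> and thereby pays
    for twice the half \<open>y powr p\<close> left over by \<open>young_absorb\<close>.\<close>
  let ?h = "\<lambda>s. (integral {m..s} ?A - hardy_const n p * integral {m..s} ?B)
     + 2 * ((g s - g m) powr p * (1 - os_cdf n i s))"
  have "?h r \<le> ?h m"
  proof (rule DERIV_nonpos_imp_decreasing_open[OF \<open>m \<le> r\<close>])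
    fix x assume x: "m < x" "x < r"
    have x01: "x \<in> {0<..<1}" using x m0 r by auto
    have gx: "g m < g x" using gmono x r by auto
    have dA: "((\<lambda>s. integral {m..s} ?A) has_real_derivative ?A x) (at x)"
      using integral_has_real_derivative[OF contA, of x] x by (simp add: at_within_Icc_at)
    have dB: "((\<lambda>s. integral {m..s} ?B) has_real_derivative ?B x) (at x)"
      using integral_has_real_derivative[OF contB, of x] x by (simp add: at_within_Icc_at)
    have dG: "((\<lambda>s. (g s - g m) powr p) has_real_derivative p * (g x - g m) powr (p - 1) * g' x) (at x)"
      using gx g[OF x01] by (auto intro!: derivative_eq_intros DERIV_powr simp: field_simps powr_diff)
    have dT: "((\<lambda>s. 1 - os_cdf n i s) has_real_derivative - os_density n i x) (at x)"
      using i by (auto intro!: derivative_eq_intros os_cdf_deriv)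
    have d: "(?h has_real_derivative (?A x - hardy_const n p * ?B x) + 2 *
       (p * (g x - g m) powr (p - 1) * g' x * (1 - os_cdf n i x) + - os_density n i x * (g x - g m) powr p)) (at x)"
      by (intro DERIV_add DERIV_diff DERIV_cmult DERIV_mult dA dB dG dT)
    have b0: "0 \<le> os_density n i x" using x01 by (intro os_density_nonneg) auto
    \<comment> \<open>By the tail bound, \<open>z\<close> times the density dominates
      \<open>g' x\<close> times the tail, so the powers of \<open>3 / sqrt (n + 1)\<close> and of
      \<open>sqrt (x * (1 - x)) * g' x\<close> come out of \<open>z powr p\<close>.\<close>
    define z where "z = g' x * (3 * sqrt (x * (1 - x) / real (Suc n)))"
    have z0: "0 \<le> z" using g'(2)[OF x01] x01 by (simp add: z_def)
    have "g' x * (1 - os_cdf n i x) \<le> g' x * (3 * sqrt (x * (1 - x) / real (Suc n)) * os_density n i x)"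
      using os_tail_bound[OF i, of x] x r g'(2)[OF x01] m by (intro mult_left_mono) auto
    then have "p * (g x - g m) powr (p - 1) * (g' x * (1 - os_cdf n i x))
      \<le> p * (g x - g m) powr (p - 1) * (z * os_density n i x)"
      using p unfolding z_def by (intro mult_left_mono) auto
    also have "\<dots> = (p * (g x - g m) powr (p - 1) * z) * os_density n i x" by simp
    also have "\<dots> \<le> ((g x - g m) powr p / 2 + p * (2 * p) powr (p - 1) * z powr p) * os_density n i x"
      using gx z0 by (intro mult_right_mono young_absorb p b0) auto
    also have "z powr p = (3 / sqrt (real (Suc n))) powr p * (sqrt (x * (1 - x)) * g' x) powr p"
      using g'(2)[OF x01] x01 unfolding z_def
      by (subst powr_mult[symmetric]) (auto simp: real_sqrt_divide mult_ac)
    finally have "2 * (p * (g x - g m) powr (p - 1) * (g' x * (1 - os_cdf n i x)))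
       \<le> ?A x + hardy_const n p * ?B x"
      unfolding hardy_const_def by (simp add: algebra_simps)
    then have "(?A x - hardy_const n p * ?B x) + 2 *
       (p * (g x - g m) powr (p - 1) * g' x * (1 - os_cdf n i x) + - os_density n i x * (g x - g m) powr p) \<le> 0"
      by (simp add: algebra_simps)
    with d show "\<exists>y. (?h has_real_derivative y) (at x) \<and> y \<le> 0" by blast
  next
    show "continuous_on {m..r} ?h"
    proof (intro continuous_on_add continuous_on_diff continuous_on_mult continuous_on_const)
      show "continuous_on {m..r} (\<lambda>s. (g s - g m) powr p)"
        by (intro continuous_intros continuous_on_powr' continuous_on_subset[OF gc sub]) (use gm0 p in auto)
      show "continuous_on {m..r} (os_cdf n i)"
        by (rule DERIV_continuous_on[OF has_field_derivative_at_within[OF os_cdf_deriv]]) (use i in auto)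
      show "continuous_on {m..r} (\<lambda>s. integral {m..s} ?A)"
        by (rule indefinite_integral_continuous_1[OF integrable_continuous_interval[OF contA]])
      show "continuous_on {m..r} (\<lambda>s. integral {m..s} ?B)"
        by (rule indefinite_integral_continuous_1[OF integrable_continuous_interval[OF contB]])
    qed
  qed
  moreover have "os_cdf n i r \<le> 1"
  proof -
    have "os_cdf n i r \<le> os_cdf n i 1"
    proof (rule DERIV_nonneg_imp_nondecreasing[OF less_imp_le[OF r(2)], where f = "os_cdf n i"])
      fix x assume "r \<le> x" "x \<le> 1"
      then show "\<exists>y. (os_cdf n i has_real_derivative y) (at x) \<and> 0 \<le> y"
        using m0 r i by (intro exI[of _ "os_density n i x"] conjI os_cdf_deriv os_density_nonneg) auto
    qed
    then show ?thesis using os_cdf_1[OF i(2)] by simp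
  qed
  then have "0 \<le> 2 * ((g r - g m) powr p * (1 - os_cdf n i r))" by simp
  moreover have "?h m = 0" using p by simp
  ultimately show ?thesis by linarith
qed

lemma nn_integral_eq_integral_Icc:
  fixes f :: "real \<Rightarrow> real"
  assumes "continuous_on {a..b} f" "\<And>x. x \<in> {a..b} \<Longrightarrow> 0 \<le> f x"
  shows "(\<integral>\<^sup>+x\<in>{a..b}. ennreal (f x) \<partial>lborel) = ennreal (integral {a..b} f)"
proof -
  have si: "set_integrable lborel {a..b} f" by (rule borel_integrable_atLeastAtMost') fact
  have "(\<integral>\<^sup>+x\<in>{a..b}. ennreal (f x) \<partial>lborel) = (\<integral>\<^sup>+x. ennreal (indicator {a..b} x *\<^sub>R f x) \<partial>lborel)"
    by (intro nn_integral_cong) (auto split: split_indicator)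
  also have "\<dots> = ennreal (LINT x:{a..b}|lborel. f x)"
    unfolding set_lebesgue_integral_def using si assms(2)
    by (intro nn_integral_eq_integral) (auto simp: set_integrable_def split: split_indicator)
  also have "(LINT x:{a..b}|lborel. f x) = integral {a..b} f"
    by (rule set_borel_integral_eq_integral(2)[OF si])
  finally show ?thesis .
qed

text \<open>Since \<open>g\<close> may blow up at 1, the inequality is first proved on compact
  intervals and then passed to the limit. Both sides are extended-valued, so no integrability has to
  be assumed.\<close>

lemma hardy_upper:
  fixes g g' :: "real \<Rightarrow> real"
  assumes i: "1 \<le> i" "i \<le> n" and p: "1 < p"
    and g: "\<And>s. s \<in> {0<..<1} \<Longrightarrow> (g has_real_derivative g' s) (at s)"
    and g': "continuous_on {0<..<1} g'" "\<And>s. s \<in> {0<..<1} \<Longrightarrow> 0 < g' s"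
    and m: "m = real i / real (Suc n)"
  shows "(\<integral>\<^sup>+s\<in>{m..<1}. ennreal (\<bar>g s - g m\<bar> powr p * os_density n i s) \<partial>lborel) \<le>
    ennreal (hardy_const n p) *
    (\<integral>\<^sup>+s\<in>{m..<1}. ennreal ((sqrt (s * (1 - s)) * g' s) powr p * os_density n i s) \<partial>lborel)"
    (is "?L \<le> _ * ?R")
proof -
  have m0: "0 < m" "m < 1" unfolding m using i by (auto simp: field_simps)
  have gc: "continuous_on {0<..<1} g"
    by (rule DERIV_continuous_on[OF has_field_derivative_at_within[OF g]])
  have [measurable]: "(\<lambda>x. g x * indicator {m..<1} x) \<in> borel_measurable borel"
  proof -
    have "set_borel_measurable borel {m..<1} g"
      by (rule set_measurable_continuous_on[OF _ continuous_on_subset[OF gc]]) (use m0 in auto)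
    then show ?thesis by (simp add: set_borel_measurable_def mult.commute)
  qed
  define f where "f s = ennreal (\<bar>g s * indicator {m..<1} s - g m\<bar> powr p * os_density n i s)" for s
  have [measurable]: "os_density n i \<in> borel_measurable borel"
    by (intro borel_measurable_continuous_onI continuous_intros)
  have f[measurable]: "f \<in> borel_measurable lborel" unfolding f_def by measurable
  define R where "R k = 1 - (1 - m) / real (Suc k)" for k
  have Rm: "m \<le> R k" "R k < 1" for k
  proof -
    have "(1 - m) / real (Suc k) \<le> (1 - m) / 1" using m0 by (intro divide_left_mono) auto
    then show "m \<le> R k" "R k < 1" using m0 by (auto simp: R_def)
  qed
  \<comment> \<open>Monotone convergence in the form of continuity from below of the measure with
    density \<open>f\<close>; the indicator inside \<open>f\<close> gives measurability on the whole
    line.\<close>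
  have "?L = emeasure (density lborel f) {m..<1}"
    by (subst emeasure_density) (auto simp: f_def intro!: nn_integral_cong split: split_indicator)
  also have U: "{m..<1} = (\<Union>k. {m..R k})"
  proof (intro equalityI subsetI)
    fix x assume x: "x \<in> {m..<1}"
    have "(\<lambda>k. 1 - (1 - m) * inverse (real (Suc k))) \<longlonglongrightarrow> 1 - (1 - m) * 0"
      by (intro tendsto_intros LIMSEQ_inverse_real_of_nat)
    then have "R \<longlonglongrightarrow> 1" unfolding R_def by (simp add: divide_inverse)
    then have "eventually (\<lambda>k. x < R k) sequentially" using x by (intro order_tendstoD) auto
    then obtain k where "x < R k" by (auto simp: eventually_sequentially)
    then show "x \<in> (\<Union>k. {m..R k})" using x by (auto intro!: exI[of _ k])
  qed (use Rm in \<open>auto intro: order.strict_trans1\<close>)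
  also have "emeasure (density lborel f) (\<Union>k. {m..R k}) = (SUP k. emeasure (density lborel f) {m..R k})"
  proof (rule SUP_emeasure_incseq[symmetric])
    show "incseq (\<lambda>k. {m..R k})"
      using m0 by (intro incseq_SucI) (auto simp: R_def divide_inverse intro!: mult_left_mono elim!: order_trans)
  qed auto
  also have "\<dots> \<le> ennreal (hardy_const n p) * ?R"
  proof (rule SUP_least)
    fix k
    have sub: "{m..R k} \<subseteq> {0<..<1}" using m0 Rm[of k] by auto
    have gmono: "g m \<le> g s" if "s \<in> {m..R k}" for s
    proof -
      have s: "m \<le> s" using that by simp
      show ?thesis
      proof (rule DERIV_nonneg_imp_nondecreasing[OF s])
        fix x assume "m \<le> x" "x \<le> s"
        then have "x \<in> {m..R k}" using that by auto
        then have "x \<in> {0<..<1}" using sub by blast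
        then show "\<exists>y. (g has_real_derivative y) (at x) \<and> 0 \<le> y" using g g'(2) less_imp_le by blast
      qed
    qed
    have "emeasure (density lborel f) {m..R k} =
       (\<integral>\<^sup>+s\<in>{m..R k}. ennreal ((g s - g m) powr p * os_density n i s) \<partial>lborel)"
      using gmono Rm[of k]
      by (subst emeasure_density) (auto simp: f_def intro!: nn_integral_cong split: split_indicator)
    also have "\<dots> = ennreal (integral {m..R k} (\<lambda>s. (g s - g m) powr p * os_density n i s))"
      using sub by (intro nn_integral_eq_integral_Icc continuous_intros continuous_on_powr'
         continuous_on_subset[OF gc sub] mult_nonneg_nonneg os_density_nonneg)
        (use gmono p in auto)
    also have "\<dots> \<le> ennreal (hardy_const n p * integral {m..R k} (\<lambda>s. (sqrt (s * (1 - s)) * g' s) powr p * os_density n i s))"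
      by (intro ennreal_leI hardy_upper_Icc i p g g' m Rm)
    also have "\<dots> = ennreal (hardy_const n p) * ennreal (integral {m..R k} (\<lambda>s. (sqrt (s * (1 - s)) * g' s) powr p * os_density n i s))"
      by (simp add: ennreal_mult' hardy_const_nonneg p)
    also have "ennreal (integral {m..R k} (\<lambda>s. (sqrt (s * (1 - s)) * g' s) powr p * os_density n i s))
       = (\<integral>\<^sup>+s\<in>{m..R k}. ennreal ((sqrt (s * (1 - s)) * g' s) powr p * os_density n i s) \<partial>lborel)"
      using sub g'(2) by (intro nn_integral_eq_integral_Icc[symmetric] continuous_intros continuous_on_powr'
         continuous_on_subset[OF g'(1) sub] mult_nonneg_nonneg os_density_nonneg)
        (use p in \<open>auto simp: less_imp_le\<close>)
    also have "\<dots> \<le> ?R"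
      using Rm[of k] by (intro nn_integral_mono) (auto split: split_indicator)
    finally show "emeasure (density lborel f) {m..R k} \<le> ennreal (hardy_const n p) * ?R"
      by (simp add: mult_left_mono)
  qed
  finally show ?thesis unfolding U[symmetric] .
qed

text \<open>If \<open>U\<close> is the \<open>i\<close>-th order statistic of uniform variables,
  then \<open>1 - U\<close> has the law of the one of rank \<open>n + 1 - i\<close>.\<close>

lemma os_density_reflect:
  assumes "1 \<le> i" "i \<le> n"
  shows "os_density n (Suc n - i) (1 - s) = os_density n i s"
proof -
  have "(n - i) + 1 = Suc n - i" "n - (Suc n - i) = i - 1" "Suc n - i - 1 = n - i" using assms by auto
  moreover have "(Suc n - i) * (n choose (Suc n - i)) = i * (n choose i)"
  proof -
    obtain j where j: "i = Suc j" using assms by (cases i) auto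
    have "(Suc n - i) * (n choose (Suc n - i)) = (n - j) * (n choose (n - j))" using j by simp
    also have "n choose (n - j) = n choose j" using j assms by (intro binomial_symmetric[symmetric]) auto
    also have "(n - j) * (n choose j) = i * (n choose i)"
      unfolding j by (metis binomial_absorb_comp binomial_absorption)
    finally show ?thesis .
  qed
  ultimately show ?thesis by (simp add: os_density_def)
qed

text \<open>The part below the mean becomes an upper part under \<open>s \<mapsto> 1 - s\<close>,
  for the rank \<open>n + 1 - i\<close> and the increasing function \<open>- g (1 - s)\<close>,
  whose centre is \<open>1 - m\<close>. Each part is bounded by the full right-hand integral, hence
  the factor 2.\<close>

lemma hardy_os:
  fixes g g' :: "real \<Rightarrow> real"
  assumes i: "1 \<le> i" "i \<le> n" and p: "1 < p"
    and g: "\<And>s. s \<in> {0<..<1} \<Longrightarrow> (g has_real_derivative g' s) (at s)"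
    and g': "continuous_on {0<..<1} g'" "\<And>s. s \<in> {0<..<1} \<Longrightarrow> 0 < g' s"
    and m: "m = real i / real (Suc n)"
  shows "(\<integral>\<^sup>+s\<in>{0<..<1}. ennreal (\<bar>g s - g m\<bar> powr p * os_density n i s) \<partial>lborel) \<le>
    2 * ennreal (hardy_const n p) *
    (\<integral>\<^sup>+s\<in>{0<..<1}. ennreal ((sqrt (s * (1 - s)) * g' s) powr p * os_density n i s) \<partial>lborel)"
    (is "?L \<le> 2 * ?C * ?R")
proof -
  let ?f = "\<lambda>s. ennreal (\<bar>g s - g m\<bar> powr p * os_density n i s)"
  let ?q = "\<lambda>s. ennreal ((sqrt (s * (1 - s)) * g' s) powr p * os_density n i s)"
  have m0: "0 < m" "m < 1" unfolding m using i by (auto simp: field_simps)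
  have gc: "continuous_on {0<..<1} g"
    by (rule DERIV_continuous_on[OF has_field_derivative_at_within[OF g]])
  have gm': "(\<lambda>x. indicator {0<..<1} x * g x) \<in> borel_measurable borel"
    and g'm': "(\<lambda>x. indicator {0<..<1} x * g' x) \<in> borel_measurable borel"
    using set_measurable_continuous_on[OF _ gc] set_measurable_continuous_on[OF _ g'(1)]
    by (auto simp: set_borel_measurable_def)
  have [measurable]: "os_density n i \<in> borel_measurable borel"
    by (intro borel_measurable_continuous_onI continuous_intros)
  have fm[measurable]: "(\<lambda>s. ?f s * indicator {0<..<1} s) \<in> borel_measurable borel"
  proof -
    have "(\<lambda>s. ?f s * indicator {0<..<1} s) =
      (\<lambda>s. ennreal (\<bar>indicator {0<..<1} s * g s - g m\<bar> powr p * os_density n i s) * indicator {0<..<1} s)"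
      by (auto simp: fun_eq_iff split: split_indicator)
    also have "\<dots> \<in> borel_measurable borel" using gm' by measurable
    finally show ?thesis .
  qed
  have qm[measurable]: "(\<lambda>s. ?q s * indicator {0<..<1} s) \<in> borel_measurable borel"
  proof -
    have "(\<lambda>s. ?q s * indicator {0<..<1} s) =
      (\<lambda>s. ennreal ((sqrt (s * (1 - s)) * (indicator {0<..<1} s * g' s)) powr p * os_density n i s) * indicator {0<..<1} s)"
      by (auto simp: fun_eq_iff split: split_indicator)
    also have "\<dots> \<in> borel_measurable borel" using g'm' by measurable
    finally show ?thesis .
  qed
  have up: "(\<integral>\<^sup>+s\<in>{m..<1}. ?f s \<partial>lborel) \<le> ?C * ?R"
  proof -
    have "(\<integral>\<^sup>+s\<in>{m..<1}. ?f s \<partial>lborel) \<le> ?C * (\<integral>\<^sup>+s\<in>{m..<1}. ?q s \<partial>lborel)"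
      by (rule hardy_upper) fact+
    also have "\<dots> \<le> ?C * ?R"
      using m0 by (intro mult_left_mono nn_integral_mono) (auto split: split_indicator)
    finally show ?thesis .
  qed
  have low: "(\<integral>\<^sup>+s\<in>{0<..m}. ?f s \<partial>lborel) \<le> ?C * ?R"
  proof -
    define j where "j = Suc n - i"
    have j: "1 \<le> j" "j \<le> n" using i by (auto simp: j_def)
    have mj: "1 - m = real j / real (Suc n)" using i by (simp add: m j_def field_simps of_nat_diff)
    have bj: "os_density n j s = os_density n i (1 - s)" for s
      using os_density_reflect[OF i, of "1 - s"] by (simp add: j_def)
    have "(\<integral>\<^sup>+s\<in>{0<..m}. ?f s \<partial>lborel) = (\<integral>\<^sup>+s. ?f (1 - s) * indicator {0<..m} (1 - s) \<partial>lborel)"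
    proof -
      have "(\<lambda>s. ?f s * indicator {0<..m} s) = (\<lambda>s. (?f s * indicator {0<..<1} s) * indicator {0<..m} s)"
        using m0 by (auto simp: fun_eq_iff split: split_indicator)
      also have "\<dots> \<in> borel_measurable borel" by measurable
      finally show ?thesis by (subst nn_integral_real_affine[where c="-1" and t=1]) auto
    qed
    also have "\<dots> = (\<integral>\<^sup>+s\<in>{1 - m..<1}. ennreal (\<bar>- g (1 - s) - - g (1 - (1 - m))\<bar> powr p * os_density n j s) \<partial>lborel)"
      unfolding bj by (intro nn_integral_cong) (auto split: split_indicator simp: abs_minus_commute)
    also have "\<dots> \<le> ?C * (\<integral>\<^sup>+s\<in>{1 - m..<1}. ennreal ((sqrt (s * (1 - s)) * g' (1 - s)) powr p * os_density n j s) \<partial>lborel)"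
    proof (rule hardy_upper[OF j p _ _ _ mj])
      fix s :: real assume s: "s \<in> {0<..<1}"
      have "((\<lambda>s. g (1 - s)) has_real_derivative g' (1 - s) * (- 1)) (at s)"
        using g[of "1 - s"] s by (intro DERIV_chain2[where f = g and g = "\<lambda>s. 1 - s"])
          (auto intro!: derivative_eq_intros)
      then show "((\<lambda>s. - g (1 - s)) has_real_derivative g' (1 - s)) (at s)"
        by (auto intro!: derivative_eq_intros)
      show "0 < g' (1 - s)" using g'(2)[of "1 - s"] s by simp
    next
      show "continuous_on {0<..<1} (\<lambda>s. g' (1 - s))"
        by (intro continuous_on_compose2[OF g'(1)] continuous_intros) auto
    qed
    also have "(\<integral>\<^sup>+s\<in>{1 - m..<1}. ennreal ((sqrt (s * (1 - s)) * g' (1 - s)) powr p * os_density n j s) \<partial>lborel)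
       \<le> (\<integral>\<^sup>+s. ?q (1 - s) * indicator {0<..<1} (1 - s) \<partial>lborel)"
      unfolding bj using m0 by (intro nn_integral_mono) (auto split: split_indicator simp: mult.commute)
    also have "\<dots> = ?R"
      by (subst nn_integral_real_affine[where c="-1" and t=1, OF qm]) auto
    finally show ?thesis by (simp add: mult_left_mono)
  qed
  have "?L \<le> (\<integral>\<^sup>+s. ?f s * indicator {0<..m} s + ?f s * indicator {m..<1} s \<partial>lborel)"
    by (intro nn_integral_mono) (auto split: split_indicator)
  also have "\<dots> = (\<integral>\<^sup>+s\<in>{0<..m}. ?f s \<partial>lborel) + (\<integral>\<^sup>+s\<in>{m..<1}. ?f s \<partial>lborel)"
  proof (rule nn_integral_add)
    have "(\<lambda>s. ?f s * indicator {0<..m} s) = (\<lambda>s. (?f s * indicator {0<..<1} s) * indicator {0<..m} s)"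
      "(\<lambda>s. ?f s * indicator {m..<1} s) = (\<lambda>s. (?f s * indicator {0<..<1} s) * indicator {m..<1} s)"
      using m0 by (auto simp: fun_eq_iff split: split_indicator)
    then show "(\<lambda>s. ?f s * indicator {0<..m} s) \<in> borel_measurable lborel"
      "(\<lambda>s. ?f s * indicator {m..<1} s) \<in> borel_measurable lborel" by simp_all
  qed
  also have "\<dots> \<le> ?C * ?R + ?C * ?R" by (intro add_mono up low)
  also have "\<dots> = 2 * ?C * ?R" by (simp add: mult_2 ring_distribs)
  finally show ?thesis .
qed

section \<open>Sample quantiles\<close>

locale iid_sample = prob_space M for M :: "'a measure" +
  fixes X :: "nat \<Rightarrow> 'a \<Rightarrow> real" and F :: "real \<Rightarrow> real"
  assumes indep: "indep_vars (\<lambda>_. borel) X {1..}"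
    and ident: "\<And>i. i \<ge> 1 \<Longrightarrow> distr M borel (X i) = distr M borel (X 1)"
    and F: "F = cdf (distr M borel (X 1))"
begin

lemma X_measurable [measurable]: "i \<ge> 1 \<Longrightarrow> X i \<in> borel_measurable M"
  using indep by (auto simp: indep_vars_def)

sublocale D: real_distribution "distr M borel (X 1)"
  by simp

lemma prob_X_le: "i \<ge> 1 \<Longrightarrow> prob {\<omega> \<in> space M. X i \<omega> \<le> x} = F x"
proof -
  assume i: "i \<ge> 1"
  have "F x = measure (distr M borel (X i)) {..x}" unfolding F cdf_def ident[OF i] ..
  also have "\<dots> = prob (X i -` {..x} \<inter> space M)" using i by (intro measure_distr) auto
  also have "X i -` {..x} \<inter> space M = {\<omega> \<in> space M. X i \<omega> \<le> x}" by auto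
  finally show ?thesis by simp
qed

lemma F_bounds: "0 \<le> F x" "F x \<le> 1"
  unfolding F using D.cdf_nonneg D.cdf_bounded_prob by auto

definition count :: "nat \<Rightarrow> real \<Rightarrow> 'a \<Rightarrow> nat" where
  "count n x \<omega> = card {i \<in> {1..n}. X i \<omega> \<le> x}"

lemma count_eq_sum: "count n x \<omega> = (\<Sum>i\<in>{1..n}. if X i \<omega> \<le> x then 1 else 0)"
  unfolding count_def by (simp add: sum.If_cases Int_def)

lemma count_measurable [measurable]: "count n x \<in> measurable M (count_space UNIV)"
  unfolding count_eq_sum[abs_def] by measurable

lemma count_le: "count n x \<omega> \<le> n"
  unfolding count_def by (rule order_trans[OF card_mono[of "{1..n}"]]) auto

text \<open>Both sides are compared through their generating functions: by independence the
  expectation of \<open>z ^ count\<close> is the \<open>n\<close>-th power of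
  \<open>1 + (z - 1) * F x\<close> for every real \<open>z\<close>, and equal polynomials have equal
  coefficients.\<close>

lemma prob_count_eq:
  assumes k: "k \<le> n"
  shows "prob {\<omega> \<in> space M. count n x \<omega> = k} = real (n choose k) * F x ^ k * (1 - F x) ^ (n - k)"
proof -
  have gen: "(\<Sum>k\<le>n. prob {\<omega> \<in> space M. count n x \<omega> = k} * z ^ k) =
     (\<Sum>k\<le>n. (real (n choose k) * F x ^ k * (1 - F x) ^ (n - k)) * z ^ k)" for z :: real
  proof -
    have "expectation (\<lambda>\<omega>. z ^ count n x \<omega>) = expectation (\<lambda>\<omega>. \<Prod>i\<in>{1..n}. if X i \<omega> \<le> x then z else 1)"
      unfolding count_eq_sum power_sum by (intro Bochner_Integration.integral_cong prod.cong) auto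
    also have "\<dots> = (\<Prod>i\<in>{1..n}. expectation (\<lambda>\<omega>. if X i \<omega> \<le> x then z else 1))"
    proof (rule indep_vars_lebesgue_integral)
      have "indep_vars (\<lambda>_. borel) (\<lambda>i. (\<lambda>y. if y \<le> x then z else 1) \<circ> X i) {1..n}"
        by (intro indep_vars_compose[where M' = "\<lambda>_. borel"] indep_vars_subset[OF indep]) auto
      then show "indep_vars (\<lambda>_. borel) (\<lambda>i \<omega>. if X i \<omega> \<le> x then z else 1) {1..n}"
        by (simp add: comp_def)
      show "integrable M (\<lambda>\<omega>. if X i \<omega> \<le> x then z else 1)" if "i \<in> {1..n}" for i
        using that by (intro integrable_const_bound[where B = "max \<bar>z\<bar> 1"]) auto
    qed auto
    also have "\<dots> = (\<Prod>i\<in>{1..n}. 1 + (z - 1) * F x)"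
    proof (intro prod.cong refl)
      fix i assume i: "i \<in> {1..n}"
      have "expectation (\<lambda>\<omega>. if X i \<omega> \<le> x then z else 1) =
        expectation (\<lambda>\<omega>. 1 + (z - 1) * indicator {\<omega> \<in> space M. X i \<omega> \<le> x} \<omega>)"
        by (intro Bochner_Integration.integral_cong) auto
      also have "\<dots> = 1 + (z - 1) * F x" using i
        by (subst Bochner_Integration.integral_add)
          (auto simp: prob_space prob_X_le intro!: integrable_mult_right integrable_real_indicator simp: less_top[symmetric])
      finally show "expectation (\<lambda>\<omega>. if X i \<omega> \<le> x then z else 1) = 1 + (z - 1) * F x" .
    qed
    also have "\<dots> = (F x * z + (1 - F x)) ^ n" by (simp add: algebra_simps)
    also have "\<dots> = (\<Sum>k\<le>n. (real (n choose k) * F x ^ k * (1 - F x) ^ (n - k)) * z ^ k)"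
      unfolding binomial_ring by (simp add: power_mult_distrib mult_ac)
    also have "expectation (\<lambda>\<omega>. z ^ count n x \<omega>) =
      expectation (\<lambda>\<omega>. \<Sum>k\<le>n. z ^ k * indicator {\<omega> \<in> space M. count n x \<omega> = k} \<omega>)"
    proof (intro Bochner_Integration.integral_cong refl)
      fix \<omega> assume "\<omega> \<in> space M"
      then have "(\<Sum>k\<le>n. z ^ k * indicator {\<omega> \<in> space M. count n x \<omega> = k} \<omega>) =
        (\<Sum>k\<le>n. if k = count n x \<omega> then z ^ k else 0)" by (intro sum.cong) auto
      then show "z ^ count n x \<omega> = (\<Sum>k\<le>n. z ^ k * indicator {\<omega> \<in> space M. count n x \<omega> = k} \<omega>)"
        using count_le[of n x \<omega>] by simp
    qed
    also have "\<dots> = (\<Sum>k\<le>n. prob {\<omega> \<in> space M. count n x \<omega> = k} * z ^ k)"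
      by (subst Bochner_Integration.integral_sum)
        (auto simp: mult.commute intro!: integrable_mult_right integrable_mult_left integrable_real_indicator simp: less_top[symmetric])
    finally show ?thesis .
  qed
  then show ?thesis
    using k polyfun_eq_coeffs[of "\<lambda>k. prob {\<omega> \<in> space M. count n x \<omega> = k}" n
      "\<lambda>k. real (n choose k) * F x ^ k * (1 - F x) ^ (n - k)"] by blast
qed

lemma prob_count_ge:
  assumes "i \<le> n"
  shows "prob {\<omega> \<in> space M. i \<le> count n x \<omega>} = os_cdf n i (F x)"
proof -
  have "{\<omega> \<in> space M. i \<le> count n x \<omega>} = (\<Union>k\<in>{i..n}. {\<omega> \<in> space M. count n x \<omega> = k})"
    using count_le by auto
  then have "prob {\<omega> \<in> space M. i \<le> count n x \<omega>} = (\<Sum>k\<in>{i..n}. prob {\<omega> \<in> space M. count n x \<omega> = k})"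
    by (subst finite_measure_finite_Union[symmetric]) (auto simp: disjoint_family_on_def)
  also have "\<dots> = os_cdf n i (F x)"
    unfolding os_cdf_def by (intro sum.cong refl prob_count_eq) auto
  finally show ?thesis .
qed

end

section \<open>Sample quantiles as transformed beta variables\<close>

text \<open>The Galois connection between a distribution function and its generalized inverse,
  through which events about quantiles become events about distribution functions. Outside
  \<open>0 < u < 1\<close> the set under the infimum may be empty or unbounded below.\<close>

lemma (in real_distribution) quantile_le_iff:
  assumes "0 < u" "u < 1"
  shows "quantile (cdf M) u \<le> x \<longleftrightarrow> u \<le> cdf M x"
proof -
  interpret right_continuous_mono "cdf M" 0 1
    by standard (auto intro: cdf_nondecreasing cdf_is_right_cont cdf_lim_at_bot cdf_lim_at_top_prob monoI)
  show ?thesis using pseudoinverse[OF assms] unfolding quantile_def by (rule sym)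
qed

text \<open>As the distribution function of the uniform law on the sample points, the empirical one
  inherits the Galois connection. A law needs a nonempty sample, hence
  \<open>1 \<le> n\<close>.\<close>

lemma ecdf_eq_cdf:
  assumes "1 \<le> n"
  shows "ecdf X n \<omega> = cdf (distr (measure_pmf (pmf_of_set {1..n})) borel (\<lambda>i. X i \<omega>))"
proof
  fix x
  have "cdf (distr (measure_pmf (pmf_of_set {1..n})) borel (\<lambda>i. X i \<omega>)) x =
    measure (measure_pmf (pmf_of_set {1..n})) {i. X i \<omega> \<le> x}"
    unfolding cdf_def by (subst measure_distr) (auto simp: vimage_def)
  also have "\<dots> = ecdf X n \<omega> x"
    using assms by (subst measure_pmf_of_set) (auto simp: ecdf_def Int_def)
  finally show "ecdf X n \<omega> x = cdf (distr (measure_pmf (pmf_of_set {1..n})) borel (\<lambda>i. X i \<omega>)) x" ..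
qed

lemma sample_quantile_le_iff:
  assumes "1 \<le> n" "0 < u" "u < 1"
  shows "quantile (ecdf X n \<omega>) u \<le> x \<longleftrightarrow> u \<le> ecdf X n \<omega> x"
proof -
  interpret R: real_distribution "distr (measure_pmf (pmf_of_set {1..n})) borel (\<lambda>i. X i \<omega>)"
    by (rule prob_space.real_distribution_distr[OF prob_space_measure_pmf]) simp
  show ?thesis unfolding ecdf_eq_cdf[OF assms(1)] by (rule R.quantile_le_iff[OF assms(2,3)])
qed

text \<open>Restricting the measure instead of the integrand gives a probability space, as required
  for the finite products over which moments are computed.\<close>

abbreviation unif01 :: "real measure" where
  "unif01 \<equiv> restrict_space lborel {0<..<1}"

lemma prob_space_unif01: "prob_space unif01"
  by (intro prob_spaceI) (simp add: emeasure_restrict_space space_restrict_space)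

lemma nn_integral_unif01:
  "(\<integral>\<^sup>+u. f u \<partial>unif01) = (\<integral>\<^sup>+u\<in>{0<..<1}. f u \<partial>lborel)"
  by (subst nn_integral_restrict_space) auto

text \<open>Joint measurability is read off from the sublevel sets, which the Galois connection
  turns into \<open>u \<le> ecdf X n \<omega> x\<close>; each of these involves a single fixed
  \<open>x\<close>.\<close>

lemma sample_quantile_measurable:
  assumes X: "\<And>i. i \<ge> 1 \<Longrightarrow> X i \<in> borel_measurable M" and n: "1 \<le> n"
  shows "(\<lambda>(\<omega>, u). quantile (ecdf X n \<omega>) u) \<in> borel_measurable (M \<Otimes>\<^sub>M unif01)"
proof (rule borel_measurableI_le)
  fix x :: real
  have [measurable]: "(\<lambda>\<omega>. ecdf X n \<omega> x) \<in> borel_measurable M"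
  proof -
    have "ecdf X n \<omega> x = (\<Sum>i\<in>{1..n}. if X i \<omega> \<le> x then 1 else 0) / real n" for \<omega>
      by (simp add: ecdf_def sum.If_cases Int_def)
    moreover have "(\<lambda>\<omega>. (\<Sum>i\<in>{1..n}. if X i \<omega> \<le> x then 1 else 0) / real n) \<in> borel_measurable M"
      using X by measurable
    ultimately show ?thesis by simp
  qed
  have [measurable]: "(\<lambda>u. u) \<in> borel_measurable unif01"
    by (intro measurable_restrict_space1) simp
  have "{z \<in> space (M \<Otimes>\<^sub>M unif01). (case z of (\<omega>, u) \<Rightarrow> quantile (ecdf X n \<omega>) u) \<le> x}
     = {z \<in> space (M \<Otimes>\<^sub>M unif01). snd z \<le> ecdf X n (fst z) x}"
    using n by (auto simp: space_pair_measure space_restrict_space sample_quantile_le_iff)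
  also have "\<dots> \<in> sets (M \<Otimes>\<^sub>M unif01)"
    by measurable
  finally show "{z \<in> space (M \<Otimes>\<^sub>M unif01). (case z of (\<omega>, u) \<Rightarrow> quantile (ecdf X n \<omega>) u) \<le> x} \<in> sets (M \<Otimes>\<^sub>M unif01)" .
qed


context iid_sample begin

lemma sample_quantile_measurable1 [measurable]:
  assumes "1 \<le> n" "u \<in> {0<..<1}"
  shows "(\<lambda>\<omega>. quantile (ecdf X n \<omega>) u) \<in> borel_measurable M"
proof -
  have "(\<lambda>\<omega>. (\<lambda>(\<omega>, u). quantile (ecdf X n \<omega>) u) (\<omega>, u)) \<in> borel_measurable M"
    by (rule measurable_compose[OF measurable_Pair2' sample_quantile_measurable])
      (use assms X_measurable in \<open>auto simp: space_restrict_space\<close>)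
  then show ?thesis by simp
qed

lemma prob_sample_quantile_le:
  assumes n: "1 \<le> n" and u: "0 < u" "u < 1"
  shows "prob {\<omega> \<in> space M. quantile (ecdf X n \<omega>) u \<le> x} = os_cdf n (nat \<lceil>real n * u\<rceil>) (F x)"
proof -
  \<comment> \<open>Counts are integers, so the sample quantile at \<open>u\<close> is the order
    statistic whose rank is \<open>n * u\<close> rounded up.\<close>
  have "quantile (ecdf X n \<omega>) u \<le> x \<longleftrightarrow> nat \<lceil>real n * u\<rceil> \<le> count n x \<omega>" for \<omega>
  proof -
    have "quantile (ecdf X n \<omega>) u \<le> x \<longleftrightarrow> u \<le> real (count n x \<omega>) / real n"
      using sample_quantile_le_iff[OF n u] by (simp add: ecdf_def count_def)
    also have "\<dots> \<longleftrightarrow> real n * u \<le> real (count n x \<omega>)" using n by (simp add: field_simps)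
    also have "\<dots> \<longleftrightarrow> nat \<lceil>real n * u\<rceil> \<le> count n x \<omega>" by (simp add: nat_le_iff ceiling_le_iff)
    finally show ?thesis .
  qed
  moreover have "nat \<lceil>real n * u\<rceil> \<le> n"
  proof -
    have "real n * u \<le> real n" using u n by simp
    then show ?thesis by (simp add: nat_le_iff ceiling_le_iff)
  qed
  ultimately show ?thesis using prob_count_ge by (simp only:)
qed

lemma quantile_F_le_iff: "0 < u \<Longrightarrow> u < 1 \<Longrightarrow> quantile F u \<le> x \<longleftrightarrow> u \<le> F x"
  unfolding F by (rule D.quantile_le_iff)

lemma quantile_measurable [measurable]: "quantile F \<in> borel_measurable unif01"
proof (rule borel_measurableI_le)
  fix x
  have [measurable]: "(\<lambda>u. u) \<in> borel_measurable unif01"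
    by (intro measurable_restrict_space1) simp
  have "{u \<in> space unif01. quantile F u \<le> x} = {u \<in> space unif01. u \<le> F x}"
    by (auto simp: space_restrict_space quantile_F_le_iff)
  also have "\<dots> \<in> sets unif01" by measurable
  finally show "{u \<in> space unif01. quantile F u \<le> x} \<in> sets unif01" .
qed

lemma nn_integral_os_density:
  assumes "1 \<le> i" "i \<le> n" "0 \<le> t" "t \<le> 1"
  shows "(\<integral>\<^sup>+s\<in>{0<..<1} \<inter> {..t}. ennreal (os_density n i s) \<partial>lborel) = ennreal (os_cdf n i t)"
proof -
  have "AE s in lborel. s \<noteq> (0::real)" "AE s in lborel. s \<noteq> (1::real)"
    by (auto intro: AE_lborel_singleton)
  then have "(\<integral>\<^sup>+s\<in>{0<..<1} \<inter> {..t}. ennreal (os_density n i s) \<partial>lborel) =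
     (\<integral>\<^sup>+s\<in>{0..t}. ennreal (os_density n i s) \<partial>lborel)"
    using assms by (intro nn_integral_cong_AE) (auto split: split_indicator)
  also have "\<dots> = ennreal (os_cdf n i t - os_cdf n i 0)"
    using assms by (intro nn_integral_FTC_Icc os_cdf_deriv os_density_nonneg
      borel_measurable_continuous_onI continuous_intros) auto
  finally show ?thesis using os_cdf_0[OF assms(1)] by simp
qed

text \<open>The quantile transform: an order statistic is distributed as \<open>quantile F\<close>
  of the corresponding uniform order statistic. Both distribution functions at \<open>x\<close>
  equal the beta distribution function at \<open>F x\<close>, because
  \<open>quantile F s \<le> x\<close> means \<open>s \<le> F x\<close>. This brings the Hardy
  inequality into play with \<open>g = quantile F\<close>.\<close>

lemma distr_sample_quantile:
  assumes n: "1 \<le> n" and u: "0 < u" "u < 1" and i: "i = nat \<lceil>real n * u\<rceil>"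
  shows "distr M borel (\<lambda>\<omega>. quantile (ecdf X n \<omega>) u) =
    distr (density unif01 (\<lambda>s. ennreal (os_density n i s))) borel (quantile F)"
    (is "?A = distr ?\<mu> _ _")
proof (rule cdf_unique)
  have u': "u \<in> {0<..<1}" using u by simp
  have i1: "1 \<le> i" "i \<le> n"
  proof -
    have "0 < real n * u" using n u by simp
    then show "1 \<le> i" unfolding i by linarith
    have "real n * u \<le> real n" using u n by simp
    then show "i \<le> n" unfolding i by (simp add: nat_le_iff ceiling_le_iff)
  qed
  have bm [measurable]: "(\<lambda>s. ennreal (os_density n i s)) \<in> borel_measurable borel"
    by (intro measurable_compose[OF _ measurable_ennreal] borel_measurable_continuous_onI continuous_intros)
  have bm': "(\<lambda>s. ennreal (os_density n i s)) \<in> borel_measurable unif01"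
    by (intro measurable_restrict_space1) simp
  interpret P: prob_space ?\<mu>
  proof
    have "emeasure ?\<mu> (space ?\<mu>) = (\<integral>\<^sup>+s\<in>{0<..<1} \<inter> {..1}. ennreal (os_density n i s) \<partial>lborel)"
      using bm' by (subst emeasure_density) (auto simp: nn_integral_unif01 space_restrict_space sets_restrict_space_iff
          intro!: nn_integral_cong split: split_indicator)
    also have "\<dots> = 1" using i1 by (subst nn_integral_os_density) (auto simp: os_cdf_1)
    finally show "emeasure ?\<mu> (space ?\<mu>) = 1" .
  qed
  show "real_distribution ?A" using sample_quantile_measurable1[OF n u'] by simp
  have qm: "quantile F \<in> borel_measurable ?\<mu>" by simp
  then show "real_distribution (distr ?\<mu> borel (quantile F))" by (rule P.real_distribution_distr)
  show "cdf ?A = cdf (distr ?\<mu> borel (quantile F))"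
  proof
    fix x
    have "cdf ?A x = prob ((\<lambda>\<omega>. quantile (ecdf X n \<omega>) u) -` {..x} \<inter> space M)"
      unfolding cdf_def using sample_quantile_measurable1[OF n u'] by (intro measure_distr) auto
    also have "(\<lambda>\<omega>. quantile (ecdf X n \<omega>) u) -` {..x} \<inter> space M = {\<omega> \<in> space M. quantile (ecdf X n \<omega>) u \<le> x}"
      by auto
    finally have 1: "cdf ?A x = os_cdf n i (F x)" using prob_sample_quantile_le[OF n u] i by simp
    have "emeasure (distr ?\<mu> borel (quantile F)) {..x} = emeasure ?\<mu> {s \<in> {0<..<1}. s \<le> F x}"
      using qm by (subst emeasure_distr)
        (auto simp: space_restrict_space vimage_def quantile_F_le_iff intro!: arg_cong[where f = "emeasure _"])
    also have "\<dots> = (\<integral>\<^sup>+s\<in>{0<..<1} \<inter> {..F x}. ennreal (os_density n i s) \<partial>lborel)"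
    proof -
      have [simp]: "{s \<in> {0<..<1}. s \<le> F x} \<in> sets unif01"
        by (auto simp: sets_restrict_space_iff)
      show ?thesis
        using bm' by (subst emeasure_density)
          (auto simp: nn_integral_unif01 sets_restrict_space_iff intro!: nn_integral_cong split: split_indicator)
    qed
    also have "\<dots> = ennreal (os_cdf n i (F x))" using i1 F_bounds by (intro nn_integral_os_density)
    finally have "ennreal (cdf (distr ?\<mu> borel (quantile F)) x) = ennreal (os_cdf n i (F x))"
      unfolding cdf_def by (simp add: P.emeasure_eq_measure[symmetric] measure_def emeasure_eq_ennreal_measure)
    moreover have "0 \<le> os_cdf n i (F x)"
      using 1 by (metis cdf_def measure_nonneg)
    ultimately show "cdf ?A x = cdf (distr ?\<mu> borel (quantile F)) x"
      using 1 by (simp add: cdf_def)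
  qed
qed

lemma nn_integral_sample_quantile:
  assumes n: "1 \<le> n" and u: "0 < u" "u < 1" and i: "i = nat \<lceil>real n * u\<rceil>"
    and \<psi> [measurable]: "\<psi> \<in> borel_measurable borel"
  shows "(\<integral>\<^sup>+\<omega>. \<psi> (quantile (ecdf X n \<omega>) u) \<partial>M) =
    (\<integral>\<^sup>+s\<in>{0<..<1}. ennreal (os_density n i s) * \<psi> (quantile F s) \<partial>lborel)"
proof -
  have bm': "(\<lambda>s. ennreal (os_density n i s)) \<in> borel_measurable unif01"
    by (intro measurable_restrict_space1 measurable_compose[OF _ measurable_ennreal])
      (auto intro!: borel_measurable_continuous_onI continuous_intros)
  have "(\<integral>\<^sup>+\<omega>. \<psi> (quantile (ecdf X n \<omega>) u) \<partial>M) =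
     (\<integral>\<^sup>+x. \<psi> x \<partial>distr M borel (\<lambda>\<omega>. quantile (ecdf X n \<omega>) u))"
    using n u by (subst nn_integral_distr) auto
  also have "\<dots> = (\<integral>\<^sup>+s. \<psi> (quantile F s) \<partial>density unif01 (\<lambda>s. ennreal (os_density n i s)))"
    unfolding distr_sample_quantile[OF n u i] by (subst nn_integral_distr) auto
  also have "\<dots> = (\<integral>\<^sup>+s. ennreal (os_density n i s) * \<psi> (quantile F s) \<partial>unif01)"
    using bm' by (subst nn_integral_density) auto
  finally show ?thesis by (simp add: nn_integral_unif01)
qed

end

text \<open>By absorption, \<open>i * (n choose i)\<close> is \<open>n\<close> times
  \<open>(n - 1) choose (i - 1)\<close>, and the remaining sum is the binomial expansion of
  \<open>(s + (1 - s)) ^ (n - 1)\<close>.\<close>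

lemma sum_os_density:
  assumes "1 \<le> n"
  shows "(\<Sum>i\<in>{1..n}. os_density n i s) = real n"
proof -
  obtain k where k: "n = Suc k" using assms by (cases n) auto
  have "(\<Sum>i\<in>{1..n}. os_density n i s) = (\<Sum>i\<le>k. os_density (Suc k) (Suc i) s)"
    unfolding k by (subst sum.reindex_bij_witness[where i = Suc and j = "\<lambda>i. i - 1" and T = "{..k}"]) auto
  also have "\<dots> = (\<Sum>i\<le>k. real (Suc k) * (real (k choose i) * s ^ i * (1 - s) ^ (k - i)))"
  proof (intro sum.cong refl)
    fix i
    have "Suc i * (Suc k choose Suc i) = Suc k * (k choose i)"
      using binomial_absorption[of i "Suc k"] by simp
    then show "os_density (Suc k) (Suc i) s = real (Suc k) * (real (k choose i) * s ^ i * (1 - s) ^ (k - i))"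
      unfolding os_density_def by (simp only: of_nat_mult diff_Suc_1 diff_Suc_Suc mult.assoc)
  qed
  also have "\<dots> = real (Suc k) * (s + (1 - s)) ^ k"
    unfolding binomial_ring sum_distrib_left ..
  finally show ?thesis by (simp add: k)
qed

lemma nn_integral_ceiling_le:
  fixes \<phi> :: "nat \<Rightarrow> ennreal"
  assumes n: "1 \<le> n"
  shows "(\<integral>\<^sup>+u\<in>{0<..<1}. \<phi> (nat \<lceil>real n * u\<rceil>) \<partial>lborel) \<le> (\<Sum>i\<in>{1..n}. \<phi> i) * ennreal (1 / real n)"
proof -
  have "(\<integral>\<^sup>+u\<in>{0<..<1}. \<phi> (nat \<lceil>real n * u\<rceil>) \<partial>lborel) \<le>
    (\<integral>\<^sup>+u. (\<Sum>i\<in>{1..n}. \<phi> i * indicator {real (i - 1) / real n<..real i / real n} u) \<partial>lborel)"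
  proof (intro nn_integral_mono)
    fix u :: real
    show "\<phi> (nat \<lceil>real n * u\<rceil>) * indicator {0<..<1} u \<le>
      (\<Sum>i\<in>{1..n}. \<phi> i * indicator {real (i - 1) / real n<..real i / real n} u)"
    proof (cases "u \<in> {0<..<1}")
      case True
      define i where "i = nat \<lceil>real n * u\<rceil>"
      have pos: "0 < real n * u" "real n * u \<le> real n" using True n by auto
      have i: "i \<in> {1..n}" using pos unfolding i_def by (auto simp: nat_le_iff ceiling_le_iff) linarith
      have "real (i - 1) < real n * u" "real n * u \<le> real i"
        using pos i unfolding i_def by (auto simp: of_nat_diff) linarith+
      then have "u \<in> {real (i - 1) / real n<..real i / real n}" using n by (auto simp: field_simps)
      then have "\<phi> i * indicator {0<..<1} u = \<phi> i * indicator {real (i - 1) / real n<..real i / real n} u"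
        using True by simp
      also have "\<dots> \<le> (\<Sum>i\<in>{1..n}. \<phi> i * indicator {real (i - 1) / real n<..real i / real n} u)"
        using i by (intro member_le_sum) auto
      finally show ?thesis unfolding i_def .
    qed simp
  qed
  also have "\<dots> = (\<Sum>i\<in>{1..n}. \<phi> i * emeasure lborel {real (i - 1) / real n<..real i / real n})"
    by (subst nn_integral_sum) (auto simp: nn_integral_cmult_indicator)
  also have "\<dots> = (\<Sum>i\<in>{1..n}. \<phi> i * ennreal (1 / real n))"
    by (intro sum.cong refl arg_cong2[where f = "(*)"])
      (auto simp: divide_right_mono of_nat_diff diff_divide_distrib[symmetric])
  finally show ?thesis by (simp add: sum_distrib_right)
qed

text \<open>Averaging the beta densities of all order statistics gives the uniform density, so the
  bounds for the single order statistics add up to the Bobkov--Ledoux functional.\<close>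

lemma (in iid_sample) sample_quantile_moment:
  assumes n: "1 \<le> n" and p: "1 < p"
    and Q: "\<And>s. s \<in> {0<..<1} \<Longrightarrow> (quantile F has_real_derivative Q' s) (at s)"
    and Q': "continuous_on {0<..<1} Q'" "\<And>s. s \<in> {0<..<1} \<Longrightarrow> 0 < Q' s"
  shows "(\<integral>\<^sup>+u\<in>{0<..<1}. (\<integral>\<^sup>+\<omega>. ennreal (\<bar>quantile (ecdf X n \<omega>) u -
        quantile F (real (nat \<lceil>real n * u\<rceil>) / real (Suc n))\<bar> powr p) \<partial>M) \<partial>lborel)
    \<le> 2 * ennreal (hardy_const n p) * (\<integral>\<^sup>+s\<in>{0<..<1}. ennreal ((sqrt (s * (1 - s)) * Q' s) powr p) \<partial>lborel)"
proof -
  define J where "J i = (\<integral>\<^sup>+s\<in>{0<..<1}. ennreal ((sqrt (s * (1 - s)) * Q' s) powr p * os_density n i s) \<partial>lborel)" for i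
  let ?C = "2 * ennreal (hardy_const n p)"
  have Qm: "(\<lambda>x. indicator {0<..<1} x * Q' x) \<in> borel_measurable borel"
    using set_measurable_continuous_on[OF _ Q'(1)] by (auto simp: set_borel_measurable_def)
  have "(\<integral>\<^sup>+u\<in>{0<..<1}. (\<integral>\<^sup>+\<omega>. ennreal (\<bar>quantile (ecdf X n \<omega>) u -
        quantile F (real (nat \<lceil>real n * u\<rceil>) / real (Suc n))\<bar> powr p) \<partial>M) \<partial>lborel)
     \<le> (\<integral>\<^sup>+u\<in>{0<..<1}. ?C * J (nat \<lceil>real n * u\<rceil>) \<partial>lborel)"
  proof (intro nn_integral_mono)
    fix u :: real
    show "(\<integral>\<^sup>+\<omega>. ennreal (\<bar>quantile (ecdf X n \<omega>) u - quantile F (real (nat \<lceil>real n * u\<rceil>) / real (Suc n))\<bar> powr p) \<partial>M) *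
       indicator {0<..<1} u \<le> ?C * J (nat \<lceil>real n * u\<rceil>) * indicator {0<..<1} u"
    proof (cases "u \<in> {0<..<1}")
      case True
      \<comment> \<open>The centre \<open>i / (n + 1)\<close> is the mean of the beta law of rank
        \<open>i\<close>, as the Hardy inequality requires. It depends on \<open>u\<close> and
        \<open>n\<close> only, so it is common to all samples with the same marginal.\<close>
      define i where "i = nat \<lceil>real n * u\<rceil>"
      have pos: "0 < real n * u" "real n * u \<le> real n" using True n by auto
      have i: "1 \<le> i" "i \<le> n" using pos unfolding i_def by (auto simp: nat_le_iff ceiling_le_iff) linarith
      have "(\<integral>\<^sup>+\<omega>. ennreal (\<bar>quantile (ecdf X n \<omega>) u - quantile F (real i / real (Suc n))\<bar> powr p) \<partial>M) =
        (\<integral>\<^sup>+s\<in>{0<..<1}. ennreal (os_density n i s) * ennreal (\<bar>quantile F s - quantile F (real i / real (Suc n))\<bar> powr p) \<partial>lborel)"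
        using True n by (intro nn_integral_sample_quantile) (auto simp: i_def)
      also have "\<dots> = (\<integral>\<^sup>+s\<in>{0<..<1}. ennreal (\<bar>quantile F s - quantile F (real i / real (Suc n))\<bar> powr p * os_density n i s) \<partial>lborel)"
        by (intro nn_integral_cong) (auto split: split_indicator simp: os_density_nonneg ennreal_mult'' mult.commute)
      also have "\<dots> \<le> ?C * J i" unfolding J_def by (intro hardy_os i p Q Q') auto
      finally show ?thesis using True by (simp add: i_def)
    qed simp
  qed
  also have "\<dots> \<le> (\<Sum>i\<in>{1..n}. ?C * J i) * ennreal (1 / real n)"
    by (rule nn_integral_ceiling_le[OF n])
  also have "\<dots> = ?C * ((\<Sum>i\<in>{1..n}. J i) * ennreal (1 / real n))"
    by (simp only: sum_distrib_left[symmetric] mult.assoc)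
  also have "(\<Sum>i\<in>{1..n}. J i) = (\<integral>\<^sup>+s. (\<Sum>i\<in>{1..n}. ennreal ((sqrt (s * (1 - s)) * Q' s) powr p * os_density n i s) * indicator {0<..<1} s) \<partial>lborel)"
    unfolding J_def
  proof (rule nn_integral_sum[symmetric])
    fix i
    have [measurable]: "os_density n i \<in> borel_measurable borel"
      by (intro borel_measurable_continuous_onI continuous_intros)
    have "(\<lambda>s. ennreal ((sqrt (s * (1 - s)) * Q' s) powr p * os_density n i s) * indicator {0<..<1} s) =
      (\<lambda>s. ennreal ((sqrt (s * (1 - s)) * (indicator {0<..<1} s * Q' s)) powr p * os_density n i s) * indicator {0<..<1} s)"
      by (auto simp: fun_eq_iff split: split_indicator)
    also have "\<dots> \<in> borel_measurable borel" using Qm by measurable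
    finally show "(\<lambda>s. ennreal ((sqrt (s * (1 - s)) * Q' s) powr p * os_density n i s) * indicator {0<..<1} s) \<in> borel_measurable lborel"
      by simp
  qed
  also have "\<dots> = (\<integral>\<^sup>+s. ennreal (real n) * (ennreal ((sqrt (s * (1 - s)) * Q' s) powr p) * indicator {0<..<1} s) \<partial>lborel)"
  proof (intro nn_integral_cong)
    fix s :: real
    show "(\<Sum>i\<in>{1..n}. ennreal ((sqrt (s * (1 - s)) * Q' s) powr p * os_density n i s) * indicator {0<..<1} s) =
      ennreal (real n) * (ennreal ((sqrt (s * (1 - s)) * Q' s) powr p) * indicator {0<..<1} s)"
    proof (cases "s \<in> {0<..<1}")
      case True
      have "(\<Sum>i\<in>{1..n}. ennreal ((sqrt (s * (1 - s)) * Q' s) powr p * os_density n i s)) =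
        ennreal (\<Sum>i\<in>{1..n}. (sqrt (s * (1 - s)) * Q' s) powr p * os_density n i s)"
        using True by (intro sum_ennreal) (auto intro!: mult_nonneg_nonneg os_density_nonneg)
      also have "(\<Sum>i\<in>{1..n}. (sqrt (s * (1 - s)) * Q' s) powr p * os_density n i s) =
         real n * (sqrt (s * (1 - s)) * Q' s) powr p"
        unfolding sum_distrib_left[symmetric] sum_os_density[OF n] by simp
      finally show ?thesis using True by (simp add: ennreal_mult)
    qed simp
  qed
  also have "\<dots> = ennreal (real n) * (\<integral>\<^sup>+s\<in>{0<..<1}. ennreal ((sqrt (s * (1 - s)) * Q' s) powr p) \<partial>lborel)"
  proof (rule nn_integral_cmult)
    have "(\<lambda>s. ennreal ((sqrt (s * (1 - s)) * Q' s) powr p) * indicator {0<..<1} s) =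
      (\<lambda>s. ennreal ((sqrt (s * (1 - s)) * (indicator {0<..<1} s * Q' s)) powr p) * indicator {0<..<1} s)"
      by (auto simp: fun_eq_iff split: split_indicator)
    also have "\<dots> \<in> borel_measurable borel" using Qm by measurable
    finally show "(\<lambda>s. ennreal ((sqrt (s * (1 - s)) * Q' s) powr p) * indicator {0<..<1} s) \<in> borel_measurable lborel"
      by simp
  qed
  also have "\<dots> * ennreal (1 / real n) = (\<integral>\<^sup>+s\<in>{0<..<1}. ennreal ((sqrt (s * (1 - s)) * Q' s) powr p) \<partial>lborel)"
  proof -
    have "ennreal (real n) * ennreal (1 / real n) = 1" using n by (subst ennreal_mult[symmetric]) auto
    then show ?thesis by (subst mult.commute, subst mult.assoc[symmetric]) (simp add: mult.commute)
  qed
  finally show ?thesis .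
qed

section \<open>Weak convergence of integral functionals\<close>

text \<open>Trigonometric polynomials in the first \<open>k\<close> coordinates. The inductive form
  lets convergence of expectations pass from characters to the whole class by rule
  induction.\<close>

inductive expsum :: "nat \<Rightarrow> ((nat \<Rightarrow> real) \<Rightarrow> complex) \<Rightarrow> bool" for k where
  char: "expsum k (\<lambda>x. iexp (\<Sum>l<k. t l * x l))"
| add: "expsum k f \<Longrightarrow> expsum k g \<Longrightarrow> expsum k (\<lambda>x. f x + g x)"
| scale: "expsum k f \<Longrightarrow> expsum k (\<lambda>x. c * f x)"

lemma expsum_mult:
  assumes "expsum k f" "expsum k g"
  shows "expsum k (\<lambda>x. f x * g x)"
  using assms(1)
proof induction
  case (char t)
  show ?case using assms(2)
  proof induction
    case (char s)
    have "iexp (\<Sum>l<k. t l * x l) * iexp (\<Sum>l<k. s l * x l) = iexp (\<Sum>l<k. (t l + s l) * x l)" for x :: "nat \<Rightarrow> real"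
      by (simp add: exp_add[symmetric] ring_distribs sum.distrib)
    then show ?case using expsum.char[of k "\<lambda>l. t l + s l"] by simp
  next
    case (add f g)
    then show ?case using expsum.add by (simp add: ring_distribs)
  next
    case (scale f c)
    then show ?case using expsum.scale[OF scale.IH, of c] by (simp add: mult_ac)
  qed
next
  case (add f g)
  then show ?case using expsum.add by (simp add: ring_distribs)
next
  case (scale f c)
  then show ?case using expsum.scale[OF scale.IH, of c] by (simp add: mult_ac)
qed

lemma expsum_const: "expsum k (\<lambda>x. c)"
  using expsum.scale[OF expsum.char[of k "\<lambda>_. 0"], of c] by simp

lemma expsum_sin:
  assumes "l < k"
  shows "expsum k (\<lambda>x. complex_of_real (sin (\<kappa> * x l)))"
proof -
  have s: "(\<Sum>j<k. (if j = l then a else 0) * x j) = a * x l" for a :: real and x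
    using assms by (simp add: if_distrib[of "\<lambda>b. b * _"] cong: if_cong)
  have "expsum k (\<lambda>x. (1 / (2 * \<i>)) * (iexp (\<Sum>j<k. (if j = l then \<kappa> else 0) * x j) +
     (- 1) * iexp (\<Sum>j<k. (if j = l then - \<kappa> else 0) * x j)))"
    by (intro expsum.intros)
  also have "(\<lambda>x. (1 / (2 * \<i>)) * (iexp (\<Sum>j<k. (if j = l then \<kappa> else 0) * x j) +
     (- 1) * iexp (\<Sum>j<k. (if j = l then - \<kappa> else 0) * x j))) = (\<lambda>x. complex_of_real (sin (\<kappa> * x l)))"
    unfolding s by (simp add: sin_exp_eq sin_of_real[symmetric] exp_minus)
  finally show ?thesis .
qed

lemma expsum_poly_sin:
  assumes "real_polynomial_function P" "l < k"
  shows "expsum k (\<lambda>x. complex_of_real (P (sin (\<kappa> * x l))))"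
  using assms(1)
proof induction
  case (linear f)
  then obtain c where c: "f = (\<lambda>x. x * c)" using real_bounded_linear[of f] by auto
  show ?case using expsum.scale[OF expsum_sin[OF assms(2)], of "complex_of_real c"] by (simp add: c mult.commute)
next
  case (const c)
  show ?case by (rule expsum_const)
next
  case (add f g)
  then show ?case using expsum.add by simp
next
  case (mult f g)
  then show ?case using expsum_mult by simp
qed

lemma expsum_prod_poly_sin:
  assumes "real_polynomial_function P"
  shows "expsum k (\<lambda>x. \<Prod>l<k. complex_of_real (P (sin (\<kappa> * x l))))"
proof -
  have "expsum k (\<lambda>x. \<Prod>l<j. complex_of_real (P (sin (\<kappa> * x l))))" if "j \<le> k" for j
    using that
  proof (induction j)
    case 0 show ?case using expsum_const by simp
  next
    case (Suc j)
    then show ?case using expsum_mult[OF Suc.IH expsum_poly_sin[OF assms, of j]] by simp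
  qed
  then show ?thesis by simp
qed

section \<open>Perturbation of characteristic functions and the method of moments\<close>

lemma norm_diff_chain:
  fixes a b a' b' :: "'a::real_normed_vector"
  shows "norm (a - b) \<le> norm (a - a') + norm (a' - b') + norm (b - b')"
  using norm_triangle_ineq[of "a - a'" "a' - b"] norm_triangle_ineq4[of "a' - b'" "b - b'"] by simp

lemma cmod_iexp_diff_le: "cmod (iexp x - iexp y) \<le> \<bar>x - y\<bar>"
proof -
  have "iexp x - iexp y = iexp y * (iexp (x - y) - 1)"
    by (simp add: ring_distribs exp_add[symmetric])
  then have "cmod (iexp x - iexp y) = cmod (iexp (x - y) - 1)" by (simp add: norm_mult)
  also have "\<dots> \<le> \<bar>x - y\<bar>" using iexp_approx1[of "x - y" 0] by simp
  finally show ?thesis .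
qed

lemma (in prob_space) integrable_iexp_real:
  assumes [measurable]: "g \<in> borel_measurable M"
  shows "integrable M (\<lambda>\<omega>. iexp (g \<omega>))"
  by (intro integrable_const_bound[where B = 1]) auto

text \<open>\<open>L\<^sup>1\<close>-closeness controls characteristic functions because
  \<open>iexp\<close> is 1-Lipschitz. Stating closeness with a nonnegative integral avoids
  integrability assumptions on \<open>U\<close> and \<open>V\<close> separately.\<close>

lemma (in prob_space) norm_expectation_iexp_diff_le:
  assumes [measurable]: "U \<in> borel_measurable M" "V \<in> borel_measurable M"
    and c: "(\<integral>\<^sup>+\<omega>. ennreal \<bar>U \<omega> - V \<omega>\<bar> \<partial>M) \<le> ennreal c" "0 \<le> c"
  shows "cmod ((\<integral>\<omega>. iexp (t * U \<omega>) \<partial>M) - (\<integral>\<omega>. iexp (t * V \<omega>) \<partial>M)) \<le> \<bar>t\<bar> * c"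
proof -
  have int: "integrable M (\<lambda>\<omega>. iexp (t * W \<omega>))" if [measurable]: "W \<in> borel_measurable M" for W
    by (intro integrable_const_bound[where B = 1]) auto
  have "(\<integral>\<omega>. iexp (t * U \<omega>) \<partial>M) - (\<integral>\<omega>. iexp (t * V \<omega>) \<partial>M) = (\<integral>\<omega>. iexp (t * U \<omega>) - iexp (t * V \<omega>) \<partial>M)"
    by (intro Bochner_Integration.integral_diff[symmetric] int assms)
  also have "ennreal (cmod \<dots>) \<le> (\<integral>\<^sup>+\<omega>. ennreal (cmod (iexp (t * U \<omega>) - iexp (t * V \<omega>))) \<partial>M)"
    by (intro integral_norm_bound_ennreal Bochner_Integration.integrable_diff int assms)
  also have "\<dots> \<le> (\<integral>\<^sup>+\<omega>. ennreal \<bar>t\<bar> * ennreal \<bar>U \<omega> - V \<omega>\<bar> \<partial>M)"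
  proof (intro nn_integral_mono)
    fix \<omega>
    have "cmod (iexp (t * U \<omega>) - iexp (t * V \<omega>)) \<le> \<bar>t\<bar> * \<bar>U \<omega> - V \<omega>\<bar>"
      using cmod_iexp_diff_le[of "t * U \<omega>" "t * V \<omega>"] by (simp add: right_diff_distrib[symmetric] abs_mult)
    then show "ennreal (cmod (iexp (t * U \<omega>) - iexp (t * V \<omega>))) \<le> ennreal \<bar>t\<bar> * ennreal \<bar>U \<omega> - V \<omega>\<bar>"
      by (simp add: ennreal_mult[symmetric])
  qed
  also have "\<dots> = ennreal \<bar>t\<bar> * (\<integral>\<^sup>+\<omega>. ennreal \<bar>U \<omega> - V \<omega>\<bar> \<partial>M)" by (intro nn_integral_cmult) simp
  also have "\<dots> \<le> ennreal \<bar>t\<bar> * ennreal c" by (intro mult_left_mono c) simp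
  also have "\<dots> = ennreal (\<bar>t\<bar> * c)" using c by (simp add: ennreal_mult)
  finally show ?thesis using c by simp
qed

text \<open>Taylor expansion under the expectation; the error depends on the law only through the
  bound \<open>K\<close>.\<close>

lemma (in prob_space) iexp_moment_approx:
  assumes [measurable]: "W \<in> borel_measurable M" and W: "\<And>\<omega>. \<omega> \<in> space M \<Longrightarrow> \<bar>W \<omega>\<bar> \<le> K"
  shows "cmod ((\<integral>\<omega>. iexp (t * W \<omega>) \<partial>M) -
      (\<Sum>k\<le>m. (\<i> * complex_of_real t) ^ k / fact k * of_real (\<integral>\<omega>. W \<omega> ^ k \<partial>M)))
    \<le> (\<bar>t\<bar> * \<bar>K\<bar>) ^ Suc m / fact (Suc m)"
proof -
  define c where "c k = (\<i> * complex_of_real t) ^ k / fact k" for k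
  have WK: "\<bar>W \<omega>\<bar> \<le> \<bar>K\<bar>" if "\<omega> \<in> space M" for \<omega> using W[OF that] by linarith
  have ip: "integrable M (\<lambda>\<omega>. W \<omega> ^ k)" for k
  proof (rule integrable_const_bound[where B = "\<bar>K\<bar> ^ k"])
    show "AE \<omega> in M. norm (W \<omega> ^ k) \<le> \<bar>K\<bar> ^ k"
      using WK by (intro AE_I2) (simp add: power_abs power_mono)
  qed simp
  have ii: "integrable M (\<lambda>\<omega>. iexp (t * W \<omega>))"
    by (intro integrable_const_bound[where B = 1]) auto
  have ints: "integrable M (\<lambda>\<omega>. \<Sum>k\<le>m. c k * of_real (W \<omega> ^ k))"
    by (intro Bochner_Integration.integrable_sum integrable_mult_right integrable_of_real ip)
  have "(\<Sum>k\<le>m. c k * of_real (\<integral>\<omega>. W \<omega> ^ k \<partial>M)) = (\<integral>\<omega>. (\<Sum>k\<le>m. c k * of_real (W \<omega> ^ k)) \<partial>M)"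
    by (subst Bochner_Integration.integral_sum)
      (auto intro!: integrable_mult_right integrable_of_real ip simp del: of_real_power)
  then have "cmod ((\<integral>\<omega>. iexp (t * W \<omega>) \<partial>M) - (\<Sum>k\<le>m. c k * of_real (\<integral>\<omega>. W \<omega> ^ k \<partial>M)))
     = cmod (\<integral>\<omega>. iexp (t * W \<omega>) - (\<Sum>k\<le>m. c k * of_real (W \<omega> ^ k)) \<partial>M)"
    using ii ints by simp
  also have "\<dots> \<le> (\<integral>\<omega>. cmod (iexp (t * W \<omega>) - (\<Sum>k\<le>m. c k * of_real (W \<omega> ^ k))) \<partial>M)"
    by (rule integral_norm_bound)
  also have "\<dots> \<le> (\<integral>\<omega>. (\<bar>t\<bar> * \<bar>K\<bar>) ^ Suc m / fact (Suc m) \<partial>M)"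
  proof (intro integral_mono integrable_norm Bochner_Integration.integrable_diff ii ints integrable_const)
    fix \<omega> assume \<omega>: "\<omega> \<in> space M"
    have "cmod (iexp (t * W \<omega>) - (\<Sum>k\<le>m. c k * of_real (W \<omega> ^ k))) =
      cmod (iexp (t * W \<omega>) - (\<Sum>k\<le>m. (\<i> * (t * W \<omega>)) ^ k / fact k))"
      unfolding c_def by (simp add: power_mult_distrib mult_ac)
    also have "\<dots> \<le> \<bar>t * W \<omega>\<bar> ^ Suc m / fact (Suc m)" by (rule iexp_approx1)
    also have "\<dots> \<le> (\<bar>t\<bar> * \<bar>K\<bar>) ^ Suc m / fact (Suc m)"
      using WK[OF \<omega>] by (intro divide_right_mono power_mono) (auto simp: abs_mult intro!: mult_left_mono)
    finally show "cmod (iexp (t * W \<omega>) - (\<Sum>k\<le>m. c k * of_real (W \<omega> ^ k))) \<le> (\<bar>t\<bar> * \<bar>K\<bar>) ^ Suc m / fact (Suc m)" .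
  qed
  finally show ?thesis by (simp add: prob_space c_def)
qed

text \<open>The method of moments under a uniform bound. The Taylor error is uniform in
  \<open>n\<close>, so the degree \<open>m\<close> is fixed first and only finitely many moments
  have to converge.\<close>

lemma bounded_moments_imp_iexp_tendsto:
  fixes U :: "nat \<Rightarrow> 'a \<Rightarrow> real" and V :: "'b \<Rightarrow> real"
  assumes "prob_space M" "prob_space N"
    and [measurable]: "\<And>n. U n \<in> borel_measurable M" "V \<in> borel_measurable N"
    and U: "\<And>n \<omega>. \<omega> \<in> space M \<Longrightarrow> \<bar>U n \<omega>\<bar> \<le> K" and V: "\<And>\<omega>. \<omega> \<in> space N \<Longrightarrow> \<bar>V \<omega>\<bar> \<le> K"
    and lim: "\<And>k. (\<lambda>n. \<integral>\<omega>. U n \<omega> ^ k \<partial>M) \<longlonglongrightarrow> (\<integral>\<omega>. V \<omega> ^ k \<partial>N)"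
  shows "(\<lambda>n. \<integral>\<omega>. iexp (t * U n \<omega>) \<partial>M) \<longlonglongrightarrow> (\<integral>\<omega>. iexp (t * V \<omega>) \<partial>N)"
proof (rule LIMSEQ_I)
  fix e :: real assume e: "e > 0"
  have sm: "(\<lambda>m. (\<bar>t\<bar> * \<bar>K\<bar>) ^ m / fact m) \<longlonglongrightarrow> 0"
    using summable_LIMSEQ_zero[OF summable_exp[of "\<bar>t\<bar> * \<bar>K\<bar>"]] by (simp add: divide_inverse mult.commute)
  then have "(\<lambda>m. (\<bar>t\<bar> * \<bar>K\<bar>) ^ Suc m / fact (Suc m)) \<longlonglongrightarrow> 0" by (rule LIMSEQ_Suc)
  then have "eventually (\<lambda>m. (\<bar>t\<bar> * \<bar>K\<bar>) ^ Suc m / fact (Suc m) < e / 3) sequentially"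
    by (rule order_tendstoD) (use e in simp)
  then obtain m where m: "(\<bar>t\<bar> * \<bar>K\<bar>) ^ Suc m / fact (Suc m) < e / 3"
    by (auto simp: eventually_sequentially)
  define c where "c k = (\<i> * complex_of_real t) ^ k / fact k" for k
  have "(\<lambda>n. \<Sum>k\<le>m. c k * of_real (\<integral>\<omega>. U n \<omega> ^ k \<partial>M)) \<longlonglongrightarrow> (\<Sum>k\<le>m. c k * of_real (\<integral>\<omega>. V \<omega> ^ k \<partial>N))"
    by (intro tendsto_intros lim)
  then have "eventually (\<lambda>n. dist (\<Sum>k\<le>m. c k * of_real (\<integral>\<omega>. U n \<omega> ^ k \<partial>M)) (\<Sum>k\<le>m. c k * of_real (\<integral>\<omega>. V \<omega> ^ k \<partial>N)) < e / 3) sequentially"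
    by (rule tendstoD) (use e in simp)
  then obtain n0 where n0: "\<And>n. n \<ge> n0 \<Longrightarrow>
     cmod ((\<Sum>k\<le>m. c k * of_real (\<integral>\<omega>. U n \<omega> ^ k \<partial>M)) - (\<Sum>k\<le>m. c k * of_real (\<integral>\<omega>. V \<omega> ^ k \<partial>N))) < e / 3"
    unfolding eventually_sequentially dist_norm by blast
  have "cmod ((\<integral>\<omega>. iexp (t * U n \<omega>) \<partial>M) - (\<integral>\<omega>. iexp (t * V \<omega>) \<partial>N)) < e" if "n \<ge> n0" for n
  proof -
    have 1: "cmod ((\<integral>\<omega>. iexp (t * U n \<omega>) \<partial>M) - (\<Sum>k\<le>m. c k * of_real (\<integral>\<omega>. U n \<omega> ^ k \<partial>M))) \<le> e / 3"
            unfolding c_def using m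
      by (intro order_trans[OF prob_space.iexp_moment_approx[where K = K]] assms U V) auto
    have 2: "cmod ((\<integral>\<omega>. iexp (t * V \<omega>) \<partial>N) - (\<Sum>k\<le>m. c k * of_real (\<integral>\<omega>. V \<omega> ^ k \<partial>N))) \<le> e / 3"
            unfolding c_def using m
      by (intro order_trans[OF prob_space.iexp_moment_approx[where K = K]] assms U V) auto
    have "cmod (a - b) < e" if "cmod (a - a') \<le> e / 3" "cmod (b - b') \<le> e / 3" "cmod (a' - b') < e / 3" for a b a' b'
      using norm_diff_chain[of a b a' b'] that by linarith
    from this[OF 1 2 n0[OF that]] show ?thesis .
  qed
  then show "\<exists>no. \<forall>n\<ge>no. norm ((\<integral>\<omega>. iexp (t * U n \<omega>) \<partial>M) - (\<integral>\<omega>. iexp (t * V \<omega>) \<partial>N)) < e" by blast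
qed


lemma real_polynomial_sin_bounded:
  assumes "real_polynomial_function (P :: real \<Rightarrow> real)"
  obtains K where "\<And>x. \<bar>P (sin x)\<bar> \<le> K" "0 \<le> K"
proof -
  have "continuous_on {- 1..1} P"
    using assms by (intro continuous_on_polymonial_function) (simp add: real_polynomial_function_eq)
  then have "compact (P ` {- 1..1})" by (rule compact_continuous_image) simp
  then obtain K where K: "\<And>y. y \<in> P ` {- 1..1} \<Longrightarrow> norm y \<le> K" "0 < K"
    using bounded_pos by (meson compact_imp_bounded)
  show thesis
  proof
    show "\<bar>P (sin x)\<bar> \<le> K" for x using K(1)[of "P (sin x)"] by auto
    show "0 \<le> K" using K by simp
  qed
qed

lemma real_polynomial_sin_measurable:
  assumes "real_polynomial_function (P :: real \<Rightarrow> real)"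
  shows "(\<lambda>x. P (sin (\<kappa> * x))) \<in> borel_measurable borel"
proof (rule borel_measurable_continuous_onI)
  have "continuous_on UNIV P"
    using assms by (intro continuous_on_polymonial_function) (simp add: real_polynomial_function_eq)
  then show "continuous_on UNIV (\<lambda>x. P (sin (\<kappa> * x)))"
    by (rule continuous_on_compose2) (auto intro!: continuous_intros)
qed

lemma measurable_section:
  assumes "(\<lambda>(\<omega>, u). D u \<omega>) \<in> borel_measurable (M \<Otimes>\<^sub>M K)" "u \<in> space K"
  shows "D u \<in> borel_measurable M"
proof -
  have "(\<lambda>\<omega>. case (\<omega>, u) of (\<omega>, u) \<Rightarrow> D u \<omega>) \<in> borel_measurable M"
    by (rule measurable_compose[OF measurable_Pair2' assms(1)]) (rule assms(2))
  then show ?thesis by simp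
qed

text \<open>Measurability is not assumed: for a non-integrable \<open>f\<close> the Bochner integral
  is 0, which satisfies the bound as well.\<close>

lemma (in prob_space) abs_expectation_le:
  fixes f :: "'a \<Rightarrow> real"
  assumes "\<And>\<omega>. \<bar>f \<omega>\<bar> \<le> C" "0 \<le> C"
  shows "\<bar>expectation f\<bar> \<le> C"
proof (cases "integrable M f")
  case True
  have "\<bar>expectation f\<bar> \<le> expectation (\<lambda>\<omega>. \<bar>f \<omega>\<bar>)" by (rule integral_abs_bound)
  also have "\<dots> \<le> expectation (\<lambda>_. C)" using True assms by (intro integral_mono) auto
  finally show ?thesis by (simp add: prob_space)
qed (simp add: not_integrable_integral_eq assms)

lemma (in prob_space) prod_poly_sin_integral_measurable:
  assumes E: "(\<lambda>(\<omega>, u). E u \<omega>) \<in> borel_measurable (M \<Otimes>\<^sub>M K)" and P: "real_polynomial_function (P :: real \<Rightarrow> real)"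
  shows "(\<lambda>u. \<integral>\<omega>. (\<Prod>l<k. P (sin (\<kappa> * E (u l) \<omega>))) \<partial>M) \<in> borel_measurable (\<Pi>\<^sub>M l\<in>{..<k::nat}. K)"
proof -
  let ?PP = "\<Pi>\<^sub>M l\<in>{..<k}. K"
  have "(\<lambda>z. P (sin (\<kappa> * E (fst z l) (snd z)))) \<in> borel_measurable (?PP \<Otimes>\<^sub>M M)" if "l < k" for l
  proof -
    have "(\<lambda>z. (snd z, fst z l)) \<in> ?PP \<Otimes>\<^sub>M M \<rightarrow>\<^sub>M M \<Otimes>\<^sub>M K"
      using that by (intro measurable_Pair measurable_snd measurable_compose[OF measurable_fst measurable_component_singleton]) auto
    from measurable_compose[OF measurable_compose[OF this E] real_polynomial_sin_measurable[OF P, of \<kappa>]]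
    show ?thesis by (simp add: split_beta')
  qed
  then have "(\<lambda>z. \<Prod>l<k. P (sin (\<kappa> * E (fst z l) (snd z)))) \<in> borel_measurable (?PP \<Otimes>\<^sub>M M)"
    by (intro borel_measurable_prod) auto
  then show ?thesis by (intro borel_measurable_lebesgue_integral) (simp add: split_beta')
qed

text \<open>The integrals on the left-hand side are almost surely those of integrable functions, so
  that the junk value of the Bochner integral does not matter.\<close>

lemma (in prob_space) nn_integral_functional_diff_le:
  fixes E :: "real \<Rightarrow> 'a \<Rightarrow> real"
  assumes E: "(\<lambda>(\<omega>, u). E u \<omega>) \<in> borel_measurable (M \<Otimes>\<^sub>M unif01)"
    and \<psi> [measurable]: "\<psi> \<in> borel_measurable borel"
    and C: "0 \<le> C" and mom: "(\<integral>\<^sup>+\<omega>. (\<integral>\<^sup>+u. ennreal (\<bar>E u \<omega>\<bar> powr p) \<partial>unif01) \<partial>M) \<le> ennreal C"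
    and P: "real_polynomial_function P" and \<epsilon>: "0 < \<epsilon>"
    and le: "AE \<omega> in M. \<forall>u\<in>{0<..<1}. \<bar>\<psi> (E u \<omega>) - P (sin (\<kappa> * E u \<omega>))\<bar> \<le> \<epsilon> * (1 + \<bar>E u \<omega>\<bar> powr p)"
  shows "(\<integral>\<^sup>+\<omega>. ennreal \<bar>(\<integral>u. \<psi> (E u \<omega>) \<partial>unif01) - (\<integral>u. P (sin (\<kappa> * E u \<omega>)) \<partial>unif01)\<bar> \<partial>M) \<le> ennreal (\<epsilon> * (1 + C))"
proof -
  interpret U: prob_space unif01 by (rule prob_space_unif01)
  obtain K where K: "\<And>x. \<bar>P (sin x)\<bar> \<le> K" "0 \<le> K" using real_polynomial_sin_bounded[OF P] by blast
  have Em: "(\<lambda>u. E u \<omega>) \<in> borel_measurable unif01" if "\<omega> \<in> space M" for \<omega>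
  proof -
    have "(\<lambda>u. case (\<omega>, u) of (\<omega>, u) \<Rightarrow> E u \<omega>) \<in> borel_measurable unif01"
      by (rule measurable_compose[OF measurable_Pair1' E]) (rule that)
    then show ?thesis by simp
  qed
  have mm: "(\<lambda>\<omega>. \<integral>\<^sup>+u. ennreal (\<bar>E u \<omega>\<bar> powr p) \<partial>unif01) \<in> borel_measurable M"
  proof (rule U.borel_measurable_nn_integral)
    have "(\<lambda>x. ennreal (\<bar>x\<bar> powr p)) \<in> borel_measurable borel" by measurable
    from measurable_compose[OF E this] show "(\<lambda>(\<omega>, u). ennreal (\<bar>E u \<omega>\<bar> powr p)) \<in> borel_measurable (M \<Otimes>\<^sub>M unif01)"
      by (simp add: split_beta')
  qed
  have fin: "AE \<omega> in M. (\<integral>\<^sup>+u. ennreal (\<bar>E u \<omega>\<bar> powr p) \<partial>unif01) \<noteq> \<infinity>"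
  proof (rule nn_integral_PInf_AE[OF mm])
    show "(\<integral>\<^sup>+\<omega>. (\<integral>\<^sup>+u. ennreal (\<bar>E u \<omega>\<bar> powr p) \<partial>unif01) \<partial>M) \<noteq> \<infinity>"
      using mom by (auto simp: top_unique)
  qed
  have "AE \<omega> in M. ennreal \<bar>(\<integral>u. \<psi> (E u \<omega>) \<partial>unif01) - (\<integral>u. P (sin (\<kappa> * E u \<omega>)) \<partial>unif01)\<bar>
      \<le> ennreal \<epsilon> * (1 + (\<integral>\<^sup>+u. ennreal (\<bar>E u \<omega>\<bar> powr p) \<partial>unif01))"
    using fin le AE_space
  proof eventually_elim
    case (elim \<omega>)
    have [measurable]: "(\<lambda>u. E u \<omega>) \<in> borel_measurable unif01" by (rule Em) fact
    have Pm: "(\<lambda>u. P (sin (\<kappa> * E u \<omega>))) \<in> borel_measurable unif01"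
      by (rule measurable_compose[OF _ real_polynomial_sin_measurable[OF P]]) measurable
    have i1: "integrable unif01 (\<lambda>u. P (sin (\<kappa> * E u \<omega>)))"
      by (rule U.integrable_const_bound[where B = K]) (auto simp: K Pm)
    have ip: "integrable unif01 (\<lambda>u. \<bar>E u \<omega>\<bar> powr p)"
      using elim(1) by (intro integrableI_bounded) (auto simp: top.not_eq_extremum)
    \<comment> \<open>The difference is dominated by the finite moment and
      \<open>P (sin (\<kappa> * x))\<close> is bounded, so integrability of
      \<open>\<psi> (E u \<omega>)\<close> follows by adding the two.\<close>
    have idiff: "integrable unif01 (\<lambda>u. \<psi> (E u \<omega>) - P (sin (\<kappa> * E u \<omega>)))"
    proof (rule Bochner_Integration.integrable_bound)
      show "integrable unif01 (\<lambda>u. \<epsilon> * (1 + \<bar>E u \<omega>\<bar> powr p))"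
        by (intro integrable_mult_right Bochner_Integration.integrable_add ip U.integrable_const)
      show "AE u in unif01. norm (\<psi> (E u \<omega>) - P (sin (\<kappa> * E u \<omega>))) \<le> norm (\<epsilon> * (1 + \<bar>E u \<omega>\<bar> powr p))"
        using elim(2) \<epsilon> by (intro AE_I2) (auto simp: space_restrict_space intro: order_trans[OF _ abs_ge_self])
      show "(\<lambda>u. \<psi> (E u \<omega>) - P (sin (\<kappa> * E u \<omega>))) \<in> borel_measurable unif01"
        using Pm by measurable
    qed
    have i2: "integrable unif01 (\<lambda>u. \<psi> (E u \<omega>))"
      using Bochner_Integration.integrable_add[OF idiff i1] by simp
    have "(\<integral>u. \<psi> (E u \<omega>) \<partial>unif01) - (\<integral>u. P (sin (\<kappa> * E u \<omega>)) \<partial>unif01) = (\<integral>u. \<psi> (E u \<omega>) - P (sin (\<kappa> * E u \<omega>)) \<partial>unif01)"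
      using i1 i2 by simp
    also have "ennreal \<bar>\<dots>\<bar> \<le> (\<integral>\<^sup>+u. ennreal \<bar>\<psi> (E u \<omega>) - P (sin (\<kappa> * E u \<omega>))\<bar> \<partial>unif01)"
      using integral_norm_bound_ennreal[OF idiff] by simp
    also have "\<dots> \<le> (\<integral>\<^sup>+u. ennreal \<epsilon> * (1 + ennreal (\<bar>E u \<omega>\<bar> powr p)) \<partial>unif01)"
    proof (intro nn_integral_mono)
      fix u assume "u \<in> space unif01"
      then have "ennreal \<bar>\<psi> (E u \<omega>) - P (sin (\<kappa> * E u \<omega>))\<bar> \<le> ennreal (\<epsilon> * (1 + \<bar>E u \<omega>\<bar> powr p))"
        using elim(2) by (intro ennreal_leI) (auto simp: space_restrict_space)
      also have "\<dots> = ennreal \<epsilon> * (1 + ennreal (\<bar>E u \<omega>\<bar> powr p))"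
        using \<epsilon> by (subst ennreal_mult) auto
      finally show "ennreal \<bar>\<psi> (E u \<omega>) - P (sin (\<kappa> * E u \<omega>))\<bar> \<le> ennreal \<epsilon> * (1 + ennreal (\<bar>E u \<omega>\<bar> powr p))" .
    qed
    also have "\<dots> = ennreal \<epsilon> * (1 + (\<integral>\<^sup>+u. ennreal (\<bar>E u \<omega>\<bar> powr p) \<partial>unif01))"
      using U.emeasure_space_1 by (subst nn_integral_cmult, simp, subst nn_integral_add) (simp_all add: space_restrict_space)
    finally show ?case .
  qed
  then have "(\<integral>\<^sup>+\<omega>. ennreal \<bar>(\<integral>u. \<psi> (E u \<omega>) \<partial>unif01) - (\<integral>u. P (sin (\<kappa> * E u \<omega>)) \<partial>unif01)\<bar> \<partial>M) \<le>
    (\<integral>\<^sup>+\<omega>. ennreal \<epsilon> * (1 + (\<integral>\<^sup>+u. ennreal (\<bar>E u \<omega>\<bar> powr p) \<partial>unif01)) \<partial>M)"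
    by (rule nn_integral_mono_AE)
  also have "\<dots> = ennreal \<epsilon> * (1 + (\<integral>\<^sup>+\<omega>. (\<integral>\<^sup>+u. ennreal (\<bar>E u \<omega>\<bar> powr p) \<partial>unif01) \<partial>M))"
    using mm by (subst nn_integral_cmult, simp, subst nn_integral_add) (auto simp: emeasure_space_1)
  also have "\<dots> \<le> ennreal \<epsilon> * (1 + ennreal C)" by (intro mult_left_mono add_left_mono mom) simp
  also have "\<dots> = ennreal (\<epsilon> * (1 + C))" using \<epsilon> C by (simp add: ennreal_mult)
  finally show ?thesis .
qed

section \<open>From finite-dimensional laws to integral functionals\<close>

text \<open>Finite-dimensional convergence is encoded by characteristic functions of linear
  combinations, so that it can be checked with a one-dimensional limit theorem. The two processes
  live on unrelated spaces, and no tightness in a function space is involved.\<close>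

locale fidi_conv =
  fixes M :: "'a measure" and N :: "'b measure"
    and D :: "nat \<Rightarrow> real \<Rightarrow> 'a \<Rightarrow> real" and B :: "real \<Rightarrow> 'b \<Rightarrow> real"
  assumes M: "prob_space M" and N: "prob_space N"
    and Dm [measurable]: "\<And>n. (\<lambda>(\<omega>, u). D n u \<omega>) \<in> borel_measurable (M \<Otimes>\<^sub>M unif01)"
    and Bm [measurable]: "(\<lambda>(\<omega>, u). B u \<omega>) \<in> borel_measurable (N \<Otimes>\<^sub>M unif01)"
    and fidi: "\<And>(k::nat) (t :: nat \<Rightarrow> real) u. (\<And>l. l < k \<Longrightarrow> u l \<in> {0<..<1}) \<Longrightarrow>
      (\<lambda>n. \<integral>\<omega>. iexp (\<Sum>l<k. t l * D n (u l) \<omega>) \<partial>M) \<longlonglongrightarrow> (\<integral>\<omega>. iexp (\<Sum>l<k. t l * B (u l) \<omega>) \<partial>N)"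
begin

sublocale M: prob_space M by (rule M)
sublocale N: prob_space N by (rule N)
sublocale U: prob_space unif01 by (rule prob_space_unif01)

lemma D_measurable: "u \<in> {0<..<1} \<Longrightarrow> D n u \<in> borel_measurable M"
  by (rule measurable_section[OF Dm]) (simp add: space_restrict_space)

lemma B_measurable: "u \<in> {0<..<1} \<Longrightarrow> B u \<in> borel_measurable N"
  by (rule measurable_section[OF Bm]) (simp add: space_restrict_space)

text \<open>Integrability is carried through the induction because additivity of the Bochner
  integral depends on it.\<close>

lemma expsum_conv:
  assumes "expsum k f" and u: "\<And>l. l < k \<Longrightarrow> u l \<in> {0<..<1}"
  shows "(\<forall>n. integrable M (\<lambda>\<omega>. f (\<lambda>l. D n (u l) \<omega>))) \<and> integrable N (\<lambda>\<omega>. f (\<lambda>l. B (u l) \<omega>)) \<and>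
    (\<lambda>n. \<integral>\<omega>. f (\<lambda>l. D n (u l) \<omega>) \<partial>M) \<longlonglongrightarrow> (\<integral>\<omega>. f (\<lambda>l. B (u l) \<omega>) \<partial>N)"
  using assms(1)
proof induction
  case (char t)
  have "(\<lambda>\<omega>. \<Sum>l<k. t l * D n (u l) \<omega>) \<in> borel_measurable M" for n
    by (intro borel_measurable_sum borel_measurable_times borel_measurable_const D_measurable u) auto
  moreover have "(\<lambda>\<omega>. \<Sum>l<k. t l * B (u l) \<omega>) \<in> borel_measurable N"
    by (intro borel_measurable_sum borel_measurable_times borel_measurable_const B_measurable u) auto
  ultimately show ?case
    by (intro conjI allI M.integrable_iexp_real N.integrable_iexp_real fidi u)
next
  case (add f g)
  then show ?case by (auto intro!: tendsto_add)
next
  case (scale f c)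
  then show ?case by (auto intro!: tendsto_mult_left)
qed

lemma prod_poly_sin_conv:
  assumes P: "real_polynomial_function P" and u: "\<And>l. l < (k::nat) \<Longrightarrow> u l \<in> {0<..<1}"
  shows "(\<lambda>n. \<integral>\<omega>. (\<Prod>l<k. P (sin (\<kappa> * D n (u l) \<omega>))) \<partial>M) \<longlonglongrightarrow> (\<integral>\<omega>. (\<Prod>l<k. P (sin (\<kappa> * B (u l) \<omega>))) \<partial>N)"
proof -
  have "(\<lambda>n. \<integral>\<omega>. (\<Prod>l<k. complex_of_real (P (sin (\<kappa> * D n (u l) \<omega>)))) \<partial>M) \<longlonglongrightarrow>
     (\<integral>\<omega>. (\<Prod>l<k. complex_of_real (P (sin (\<kappa> * B (u l) \<omega>)))) \<partial>N)"
    using expsum_conv[OF expsum_prod_poly_sin[OF P, of k \<kappa>] u] by auto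
  then have "(\<lambda>n. complex_of_real (\<integral>\<omega>. (\<Prod>l<k. P (sin (\<kappa> * D n (u l) \<omega>))) \<partial>M)) \<longlonglongrightarrow>
     complex_of_real (\<integral>\<omega>. (\<Prod>l<k. P (sin (\<kappa> * B (u l) \<omega>))) \<partial>N)"
    by (simp add: of_real_prod[symmetric] del: of_real_prod)
  then show ?thesis by (subst (asm) tendsto_of_real_iff)
qed

end

text \<open>A power of an integral is the integral of a product over independent copies of the
  variable; Fubini then moves the expectation inside, where only finitely many coordinates of the
  process occur.\<close>

lemma integral_power_eq_PiM:
  fixes g :: "'c \<Rightarrow> real"
  assumes K: "prob_space K" "prob_space M" and D [measurable]: "(\<lambda>(\<omega>, u). D u \<omega>) \<in> borel_measurable (M \<Otimes>\<^sub>M K)"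
    and D_le: "\<And>\<omega> u. \<bar>D u \<omega>\<bar> \<le> C" and "0 \<le> (C::real)"
  shows "(\<integral>\<omega>. (\<integral>u. D u \<omega> \<partial>K) ^ k \<partial>M) = (\<integral>u. (\<integral>\<omega>. (\<Prod>l<k. D (u l) \<omega>) \<partial>M) \<partial>(\<Pi>\<^sub>M l\<in>{..<k::nat}. K))"
proof -
  interpret K: prob_space K by fact
  interpret M: prob_space M by fact
  interpret P: product_prob_space "\<lambda>_. K" "{..<k}" by standard
  interpret PP: prob_space "\<Pi>\<^sub>M l\<in>{..<k}. K" by (intro prob_space_PiM K)
  interpret pair_sigma_finite M "\<Pi>\<^sub>M l\<in>{..<k}. K" ..
  interpret MP: prob_space "M \<Otimes>\<^sub>M (\<Pi>\<^sub>M l\<in>{..<k}. K)"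
    by (intro prob_space_pair assms prob_space_PiM)
  have bound: "\<bar>\<Prod>l<k. D (u l) \<omega>\<bar> \<le> C ^ k" for u \<omega>
  proof -
    have "\<bar>\<Prod>l<k. D (u l) \<omega>\<bar> = (\<Prod>l<k. \<bar>D (u l) \<omega>\<bar>)" by (rule abs_prod)
    also have "\<dots> \<le> (\<Prod>l<k. C)" by (intro prod_mono) (auto simp: D_le)
    finally show ?thesis by simp
  qed
  have int: "integrable K (\<lambda>u. D u \<omega>)" if "\<omega> \<in> space M" for \<omega>
  proof (rule K.integrable_const_bound[where B = C])
    have "(\<lambda>u. case (\<omega>, u) of (\<omega>, u) \<Rightarrow> D u \<omega>) \<in> borel_measurable K"
      by (rule measurable_compose[OF measurable_Pair1' D]) (rule that)
    then show "(\<lambda>u. D u \<omega>) \<in> borel_measurable K" by simp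
  qed (simp add: D_le)
  have "(\<integral>\<omega>. (\<integral>u. D u \<omega> \<partial>K) ^ k \<partial>M) = (\<integral>\<omega>. (\<integral>u. (\<Prod>l<k. D (u l) \<omega>) \<partial>(\<Pi>\<^sub>M l\<in>{..<k}. K)) \<partial>M)"
  proof (intro Bochner_Integration.integral_cong refl)
    fix \<omega> assume "\<omega> \<in> space M"
    then show "(\<integral>u. D u \<omega> \<partial>K) ^ k = (\<integral>u. (\<Prod>l<k. D (u l) \<omega>) \<partial>(\<Pi>\<^sub>M l\<in>{..<k}. K))"
      by (subst P.product_integral_prod) (auto intro!: int)
  qed
  also have "\<dots> = (\<integral>u. (\<integral>\<omega>. (\<Prod>l<k. D (u l) \<omega>) \<partial>M) \<partial>(\<Pi>\<^sub>M l\<in>{..<k}. K))"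
  proof (rule Fubini_integral[symmetric])
    have m: "(\<lambda>(\<omega>, u). D (u l) \<omega>) \<in> borel_measurable (M \<Otimes>\<^sub>M (\<Pi>\<^sub>M l\<in>{..<k}. K))" if "l < k" for l
    proof -
      have "(\<lambda>z. (fst z, snd z l)) \<in> M \<Otimes>\<^sub>M (\<Pi>\<^sub>M l\<in>{..<k}. K) \<rightarrow>\<^sub>M M \<Otimes>\<^sub>M K"
        using that by (intro measurable_Pair measurable_fst measurable_compose[OF measurable_snd measurable_component_singleton]) auto
      from measurable_compose[OF this D] show ?thesis by (simp add: split_beta')
    qed
    then have "(\<lambda>z. \<Prod>l<k. (case z of (\<omega>, u) \<Rightarrow> D (u l) \<omega>)) \<in> borel_measurable (M \<Otimes>\<^sub>M (\<Pi>\<^sub>M l\<in>{..<k}. K))"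
      by (intro borel_measurable_prod) auto
    then show "integrable (M \<Otimes>\<^sub>M (\<Pi>\<^sub>M l\<in>{..<k}. K)) (\<lambda>(\<omega>, u). \<Prod>l<k. D (u l) \<omega>)"
      by (intro MP.integrable_const_bound[where B = "C ^ k"]) (auto simp: bound split_beta')
  qed
  finally show ?thesis .
qed


context fidi_conv begin

lemma poly_sin_D_measurable:
  assumes "real_polynomial_function P"
  shows "(\<lambda>(\<omega>, u). P (sin (\<kappa> * D n u \<omega>))) \<in> borel_measurable (M \<Otimes>\<^sub>M unif01)"
    and "(\<lambda>(\<omega>, u). P (sin (\<kappa> * B u \<omega>))) \<in> borel_measurable (N \<Otimes>\<^sub>M unif01)"
  using measurable_compose[OF Dm real_polynomial_sin_measurable[OF assms, of \<kappa>]]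
    measurable_compose[OF Bm real_polynomial_sin_measurable[OF assms, of \<kappa>]]
  by (auto simp: split_beta')

text \<open>For each fixed tuple of points the inner expectations converge by finite-dimensional
  convergence; boundedness of \<open>P\<close> on \<open>[-1,1]\<close> provides the constant
  dominating function on the product space.\<close>

lemma integral_poly_sin_moments_conv:
  assumes P: "real_polynomial_function P"
  shows "(\<lambda>n. \<integral>\<omega>. (\<integral>u. P (sin (\<kappa> * D n u \<omega>)) \<partial>unif01) ^ k \<partial>M) \<longlonglongrightarrow>
    (\<integral>\<omega>. (\<integral>u. P (sin (\<kappa> * B u \<omega>)) \<partial>unif01) ^ k \<partial>N)"
proof -
  obtain C where C: "\<And>x. \<bar>P (sin x)\<bar> \<le> C" "0 \<le> C" using real_polynomial_sin_bounded[OF P] by blast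
  let ?PP = "\<Pi>\<^sub>M l\<in>{..<k}. unif01"
  interpret PP: prob_space ?PP by (intro prob_space_PiM prob_space_unif01)
  have bound: "\<bar>\<Prod>l<k. P (sin (x l))\<bar> \<le> C ^ k" for x
  proof -
    have "\<bar>\<Prod>l<k. P (sin (x l))\<bar> = (\<Prod>l<k. \<bar>P (sin (x l))\<bar>)" by (rule abs_prod)
    also have "\<dots> \<le> (\<Prod>l<k. C)" by (intro prod_mono) (auto simp: C)
    finally show ?thesis by simp
  qed
  have "(\<lambda>n. \<integral>u. (\<integral>\<omega>. (\<Prod>l<k. P (sin (\<kappa> * D n (u l) \<omega>))) \<partial>M) \<partial>?PP) \<longlonglongrightarrow>
     (\<integral>u. (\<integral>\<omega>. (\<Prod>l<k. P (sin (\<kappa> * B (u l) \<omega>))) \<partial>N) \<partial>?PP)"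
  proof (rule integral_dominated_convergence[where w = "\<lambda>_. C ^ k"])
    show "AE u in ?PP. (\<lambda>n. \<integral>\<omega>. (\<Prod>l<k. P (sin (\<kappa> * D n (u l) \<omega>))) \<partial>M) \<longlonglongrightarrow>
       (\<integral>\<omega>. (\<Prod>l<k. P (sin (\<kappa> * B (u l) \<omega>))) \<partial>N)"
      by (intro AE_I2 prod_poly_sin_conv P) (auto simp: space_PiM space_restrict_space PiE_def Pi_def)
    show "AE u in ?PP. norm (\<integral>\<omega>. (\<Prod>l<k. P (sin (\<kappa> * D n (u l) \<omega>))) \<partial>M) \<le> C ^ k" for n
      using C(2) bound by (intro AE_I2) (auto intro!: M.abs_expectation_le)
  qed (auto intro!: M.prod_poly_sin_integral_measurable N.prod_poly_sin_integral_measurable P)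
  then show ?thesis
    using C by (subst (1 2) integral_power_eq_PiM[where C = C])
      (auto intro!: M N prob_space_unif01 poly_sin_D_measurable P)
qed

lemma integral_poly_sin_iexp_conv:
  assumes P: "real_polynomial_function P"
  shows "(\<lambda>n. \<integral>\<omega>. iexp (t * (\<integral>u. P (sin (\<kappa> * D n u \<omega>)) \<partial>unif01)) \<partial>M) \<longlonglongrightarrow>
    (\<integral>\<omega>. iexp (t * (\<integral>u. P (sin (\<kappa> * B u \<omega>)) \<partial>unif01)) \<partial>N)"
proof -
  obtain C where C: "\<And>x. \<bar>P (sin x)\<bar> \<le> C" "0 \<le> C" using real_polynomial_sin_bounded[OF P] by blast
  have bound: "\<bar>\<integral>u. P (sin (f u)) \<partial>unif01\<bar> \<le> C" for f
    by (rule U.abs_expectation_le) (auto simp: C)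
  show ?thesis
    by (rule bounded_moments_imp_iexp_tendsto[where K = C])
      (auto intro!: M N bound integral_poly_sin_moments_conv P U.borel_measurable_lebesgue_integral poly_sin_D_measurable)
qed

text \<open>An argument with three errors on characteristic functions: replace
  \<open>\<phi>n n\<close> by a bounded function, pass to the limit there, and replace that function
  by \<open>\<phi>\<close>. The same bounded function has to serve both replacements. The bound
  \<open>r n\<close> restricts the approximation of \<open>\<phi>n n\<close> to values that the
  process actually takes.\<close>

theorem integral_functional_weak_conv:
  fixes \<phi>n :: "nat \<Rightarrow> real \<Rightarrow> real" and \<phi> :: "real \<Rightarrow> real" and C p :: real
  assumes [measurable]: "\<And>n. \<phi>n n \<in> borel_measurable borel" "\<phi> \<in> borel_measurable borel"
    and C: "0 \<le> C"
    and momD: "\<And>n. (\<integral>\<^sup>+\<omega>. (\<integral>\<^sup>+u. ennreal (\<bar>D n u \<omega>\<bar> powr p) \<partial>unif01) \<partial>M) \<le> ennreal C"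
    and momB: "(\<integral>\<^sup>+\<omega>. (\<integral>\<^sup>+u. ennreal (\<bar>B u \<omega>\<bar> powr p) \<partial>unif01) \<partial>N) \<le> ennreal C"
    and dom: "\<And>n. AE \<omega> in M. \<forall>u\<in>{0<..<1}. \<bar>D n u \<omega>\<bar> \<le> r n"
    and approx: "\<And>\<epsilon>. 0 < \<epsilon> \<Longrightarrow> \<exists>P \<kappa> n0. real_polynomial_function P \<and>
      (\<forall>n\<ge>n0. \<forall>x. \<bar>x\<bar> \<le> r n \<longrightarrow> \<bar>\<phi>n n x - P (sin (\<kappa> * x))\<bar> \<le> \<epsilon> * (1 + \<bar>x\<bar> powr p)) \<and>
      (\<forall>x. \<bar>\<phi> x - P (sin (\<kappa> * x))\<bar> \<le> \<epsilon> * (1 + \<bar>x\<bar> powr p))"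
  shows "weak_conv_m (\<lambda>n. distr M borel (\<lambda>\<omega>. \<integral>u. \<phi>n n (D n u \<omega>) \<partial>unif01))
     (distr N borel (\<lambda>\<omega>. \<integral>u. \<phi> (B u \<omega>) \<partial>unif01))"
proof -
  define \<xi> where "\<xi> n \<omega> = (\<integral>u. \<phi>n n (D n u \<omega>) \<partial>unif01)" for n \<omega>
  define \<zeta> where "\<zeta> \<omega> = (\<integral>u. \<phi> (B u \<omega>) \<partial>unif01)" for \<omega>
  have \<xi>m [measurable]: "\<xi> n \<in> borel_measurable M" for n
    unfolding \<xi>_def using measurable_compose[OF Dm, of "\<phi>n n" borel n]
    by (intro U.borel_measurable_lebesgue_integral) (simp add: split_beta')
  have \<zeta>m [measurable]: "\<zeta> \<in> borel_measurable N"
    unfolding \<zeta>_def using measurable_compose[OF Bm, of \<phi> borel]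
    by (intro U.borel_measurable_lebesgue_integral) (simp add: split_beta')
  have char_conv: "(\<lambda>n. \<integral>\<omega>. iexp (t * \<xi> n \<omega>) \<partial>M) \<longlonglongrightarrow> (\<integral>\<omega>. iexp (t * \<zeta> \<omega>) \<partial>N)" for t
  proof (rule LIMSEQ_I)
    fix e :: real assume e: "e > 0"
    \<comment> \<open>Each replacement costs at most
      \<open>\<bar>t\<bar> * \<epsilon> * (1 + C)\<close>, which must be below \<open>e / 3\<close>;
      using \<open>1 + \<bar>t\<bar>\<close> covers \<open>t = 0\<close>.\<close>
    define \<epsilon> where "\<epsilon> = e / (3 * (1 + \<bar>t\<bar>) * (1 + C))"
    have \<epsilon>: "0 < \<epsilon>" unfolding \<epsilon>_def using e C by (intro divide_pos_pos mult_pos_pos) auto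
    have t\<epsilon>: "\<bar>t\<bar> * (\<epsilon> * (1 + C)) \<le> e / 3"
    proof -
      have "\<bar>t\<bar> * (\<epsilon> * (1 + C)) = (e / 3) * (\<bar>t\<bar> / (1 + \<bar>t\<bar>))"
        unfolding \<epsilon>_def using C by (simp add: divide_simps)
      also have "\<dots> \<le> (e / 3) * 1" using e by (intro mult_left_mono) auto
      finally show ?thesis by simp
    qed
    obtain P \<kappa> n0 where P: "real_polynomial_function P"
      and n0: "\<And>n x. n \<ge> n0 \<Longrightarrow> \<bar>x\<bar> \<le> r n \<Longrightarrow> \<bar>\<phi>n n x - P (sin (\<kappa> * x))\<bar> \<le> \<epsilon> * (1 + \<bar>x\<bar> powr p)"
      and \<phi>P: "\<And>x. \<bar>\<phi> x - P (sin (\<kappa> * x))\<bar> \<le> \<epsilon> * (1 + \<bar>x\<bar> powr p)"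
      using approx[OF \<epsilon>] by blast
    define I where "I n \<omega> = (\<integral>u. P (sin (\<kappa> * D n u \<omega>)) \<partial>unif01)" for n \<omega>
    define J where "J \<omega> = (\<integral>u. P (sin (\<kappa> * B u \<omega>)) \<partial>unif01)" for \<omega>
    have Im [measurable]: "I n \<in> borel_measurable M" for n
      unfolding I_def by (intro U.borel_measurable_lebesgue_integral poly_sin_D_measurable P)
    have Jm [measurable]: "J \<in> borel_measurable N"
      unfolding J_def by (intro U.borel_measurable_lebesgue_integral poly_sin_D_measurable P)
    have "(\<lambda>n. \<integral>\<omega>. iexp (t * I n \<omega>) \<partial>M) \<longlonglongrightarrow> (\<integral>\<omega>. iexp (t * J \<omega>) \<partial>N)"
      unfolding I_def J_def by (rule integral_poly_sin_iexp_conv[OF P])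
    then obtain n1 where n1: "\<And>n. n \<ge> n1 \<Longrightarrow> cmod ((\<integral>\<omega>. iexp (t * I n \<omega>) \<partial>M) - (\<integral>\<omega>. iexp (t * J \<omega>) \<partial>N)) < e / 3"
      using LIMSEQ_D[of _ _ "e / 3"] e by (metis divide_pos_pos zero_less_numeral)
    have 2: "cmod ((\<integral>\<omega>. iexp (t * \<zeta> \<omega>) \<partial>N) - (\<integral>\<omega>. iexp (t * J \<omega>) \<partial>N)) \<le> \<bar>t\<bar> * (\<epsilon> * (1 + C))"
    proof (rule N.norm_expectation_iexp_diff_le)
      show "(\<integral>\<^sup>+\<omega>. ennreal \<bar>\<zeta> \<omega> - J \<omega>\<bar> \<partial>N) \<le> ennreal (\<epsilon> * (1 + C))"
        unfolding \<zeta>_def J_def using Bm assms(2) C momB P \<epsilon> \<phi>P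
        by (intro N.nn_integral_functional_diff_le[where p = p]) auto
    qed (use \<epsilon> C in auto)
    have "cmod ((\<integral>\<omega>. iexp (t * \<xi> n \<omega>) \<partial>M) - (\<integral>\<omega>. iexp (t * \<zeta> \<omega>) \<partial>N)) < e" if "n \<ge> max n0 n1" for n
    proof -
      have 1: "cmod ((\<integral>\<omega>. iexp (t * \<xi> n \<omega>) \<partial>M) - (\<integral>\<omega>. iexp (t * I n \<omega>) \<partial>M)) \<le> \<bar>t\<bar> * (\<epsilon> * (1 + C))"
      proof (rule M.norm_expectation_iexp_diff_le)
        have "AE \<omega> in M. \<forall>u\<in>{0<..<1}. \<bar>\<phi>n n (D n u \<omega>) - P (sin (\<kappa> * D n u \<omega>))\<bar> \<le> \<epsilon> * (1 + \<bar>D n u \<omega>\<bar> powr p)"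
          using dom[of n]
        proof eventually_elim
          case (elim \<omega>)
          then show ?case using that by (auto intro!: n0)
        qed
        then show "(\<integral>\<^sup>+\<omega>. ennreal \<bar>\<xi> n \<omega> - I n \<omega>\<bar> \<partial>M) \<le> ennreal (\<epsilon> * (1 + C))"
          unfolding \<xi>_def I_def using Dm assms(1) C momD P \<epsilon>
          by (intro M.nn_integral_functional_diff_le[where p = p]) auto
      qed (use \<epsilon> C in auto)
      have "cmod (a - b) < e" if "cmod (a - a') \<le> e / 3" "cmod (b - b') \<le> e / 3" "cmod (a' - b') < e / 3" for a b a' b'
        using norm_diff_chain[of a b a' b'] that by linarith
      from this[OF order_trans[OF 1 t\<epsilon>] order_trans[OF 2 t\<epsilon>] n1] that show ?thesis by simp
    qed
    then show "\<exists>no. \<forall>n\<ge>no. norm ((\<integral>\<omega>. iexp (t * \<xi> n \<omega>) \<partial>M) - (\<integral>\<omega>. iexp (t * \<zeta> \<omega>) \<partial>N)) < e" by blast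
  qed
  have "weak_conv_m (\<lambda>n. distr M borel (\<xi> n)) (distr N borel \<zeta>)"
    by (rule levy_continuity)
      (use char_conv in \<open>auto simp: char_def integral_distr intro!: M.real_distribution_distr N.real_distribution_distr\<close>)
  then show ?thesis unfolding \<xi>_def[abs_def] \<zeta>_def[abs_def] .
qed

end

section \<open>Rescaled costs\<close>

text \<open>Polya's theorem: monotonicity traps \<open>f n x\<close> between its values at
  neighbouring grid points, and uniform continuity of the limit makes these values close to
  \<open>g x\<close>.\<close>

lemma polya_uniform_conv:
  fixes f :: "nat \<Rightarrow> real \<Rightarrow> real" and g :: "real \<Rightarrow> real"
  assumes K: "0 < K" and mono: "\<And>n x y. 0 \<le> x \<Longrightarrow> x \<le> y \<Longrightarrow> y \<le> K \<Longrightarrow> f n x \<le> f n y"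
    and lim: "\<And>x. 0 \<le> x \<Longrightarrow> x \<le> K \<Longrightarrow> (\<lambda>n. f n x) \<longlonglongrightarrow> g x"
    and cont: "continuous_on {0..K} g" and e: "0 < (e::real)"
  shows "\<exists>n0. \<forall>n\<ge>n0. \<forall>x\<in>{0..K}. \<bar>f n x - g x\<bar> \<le> e"
proof -
  have "uniformly_continuous_on {0..K} g" by (rule compact_uniformly_continuous[OF cont]) simp
  then obtain d where d: "0 < d" "\<And>x y. x \<in> {0..K} \<Longrightarrow> y \<in> {0..K} \<Longrightarrow> dist x y < d \<Longrightarrow> dist (g x) (g y) < e / 2"
    unfolding uniformly_continuous_on_def using e by (metis dist_commute half_gt_zero)
  obtain m :: nat where m: "K / d < real m" using reals_Archimedean2 by blast
  then have m0: "0 < real m" using K d(1) by (meson divide_pos_pos less_trans)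
  define a where "a j = K * real j / real m" for j :: nat
  have "eventually (\<lambda>n. \<forall>j\<in>{..m}. \<bar>f n (a j) - g (a j)\<bar> < e / 2) sequentially"
  proof (intro eventually_ball_finite ballI)
    fix j assume "j \<in> {..m}"
    then have "0 \<le> a j" "a j \<le> K" using K m0 by (auto simp: a_def field_simps)
    then have "eventually (\<lambda>n. dist (f n (a j)) (g (a j)) < e / 2) sequentially"
      using lim e by (intro tendstoD) auto
    then show "eventually (\<lambda>n. \<bar>f n (a j) - g (a j)\<bar> < e / 2) sequentially" by (simp add: dist_real_def)
  qed simp
  then obtain n0 where n0: "\<And>n j. n \<ge> n0 \<Longrightarrow> j \<le> m \<Longrightarrow> \<bar>f n (a j) - g (a j)\<bar> < e / 2"
    unfolding eventually_sequentially by auto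
  have "\<bar>f n x - g x\<bar> \<le> e" if n: "n \<ge> n0" and x: "x \<in> {0..K}" for n x
  proof -
    define j where "j = nat \<lfloor>x * real m / K\<rfloor>"
    have xm: "0 \<le> x * real m / K" "x * real m / K \<le> real m" using x K m0 by (auto simp: field_simps)
    have j1: "real j \<le> x * real m / K" unfolding j_def using xm by (simp add: of_nat_floor)
    have j2: "x * real m / K < real j + 1" unfolding j_def using xm by linarith
    have jm: "j \<le> m" using j1 xm by linarith
    have al: "a j \<le> x" using j1 K m0 by (simp add: a_def field_simps)
    have step: "K / real m < d" using m m0 d(1) by (simp add: field_simps)
    have au: "x \<le> a j + K / real m" using j2 K m0 by (simp add: a_def field_simps)
    have aj: "a j \<in> {0..K}" using K m0 al x by (auto simp: a_def)
    have lower: "g x - e \<le> f n x"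
    proof -
      have "dist (g (a j)) (g x) < e / 2" using al au step aj x by (intro d(2)) (auto simp: dist_real_def)
      moreover have "f n (a j) \<le> f n x" using al aj x by (intro mono) auto
      ultimately show ?thesis using n0[OF n jm] unfolding dist_real_def by linarith
    qed
    have upper: "f n x \<le> g x + e"
    \<comment> \<open>The last grid point has no right neighbour; it is selected only for
      \<open>x = K\<close>, which is itself on the grid.\<close>
    proof (cases "j = m")
      case True
      then have "x = K" using al x m0 by (simp add: a_def)
      then have "x = a m" using m0 by (simp add: a_def)
      then show ?thesis using n0[OF n order_refl] e unfolding \<open>x = a m\<close> by linarith
    next
      case False
      then have jm': "Suc j \<le> m" using jm by simp
      have as: "a (Suc j) = a j + K / real m" by (simp add: a_def field_simps add_divide_distrib)
      have asK: "a (Suc j) \<in> {0..K}" proof -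
        have "real (Suc j) / real m \<le> 1" using jm' m0 by simp
        then have "K * (real (Suc j) / real m) \<le> K * 1" using K by (intro mult_left_mono) auto
        then show ?thesis using K by (simp add: a_def)
      qed
      have "dist (g (a (Suc j))) (g x) < e / 2" using al au step asK x as by (intro d(2)) (auto simp: dist_real_def)
      moreover have "f n x \<le> f n (a (Suc j))" using au as asK x by (intro mono) auto
      ultimately show ?thesis using n0[OF n jm'] unfolding dist_real_def by linarith
    qed
    show ?thesis using lower upper by auto
  qed
  then show ?thesis by blast
qed

text \<open>Composing with \<open>sin (\<kappa> x)\<close> makes a polynomial approximation on \<open>[-K, K]\<close> globally bounded
  by the supremum of the approximated function, so that the growth bound takes care of the rest.\<close>

lemma poly_sin_approx:
  fixes \<phi>n :: "nat \<Rightarrow> real \<Rightarrow> real" and \<phi> :: "real \<Rightarrow> real"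
  assumes q: "0 \<le> q" "q < p" and C: "0 \<le> C"
    and \<phi>: "continuous_on UNIV \<phi>" "\<And>x. \<bar>\<phi> x\<bar> \<le> C * (1 + \<bar>x\<bar> powr q)"
    and \<phi>n: "\<And>n x. n \<ge> n1 \<Longrightarrow> \<bar>x\<bar> \<le> r n \<Longrightarrow> \<bar>\<phi>n n x\<bar> \<le> C * (1 + \<bar>x\<bar> powr q)"
    and unif: "\<And>K e. 0 < K \<Longrightarrow> 0 < e \<Longrightarrow> \<exists>n0. \<forall>n\<ge>n0. \<forall>x\<in>{-K..K}. \<bar>\<phi>n n x - \<phi> x\<bar> \<le> e"
    and \<epsilon>: "0 < \<epsilon>"
  shows "\<exists>P \<kappa> n0. real_polynomial_function P \<and>
      (\<forall>n\<ge>n0. \<forall>x. \<bar>x\<bar> \<le> r n \<longrightarrow> \<bar>\<phi>n n x - P (sin (\<kappa> * x))\<bar> \<le> \<epsilon> * (1 + \<bar>x\<bar> powr p)) \<and>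
      (\<forall>x. \<bar>\<phi> x - P (sin (\<kappa> * x))\<bar> \<le> \<epsilon> * (1 + \<bar>x\<bar> powr p))"
proof -
  \<comment> \<open>The constant 4: two functions of size \<open>C * (1 + x powr q)\<close> are
    compared, and \<open>1 + x powr q \<le> 2 * x powr q\<close> for
    \<open>x \<ge> 1\<close>.\<close>
  have "((\<lambda>x. 4 * C * x powr (q - p)) \<longlongrightarrow> 4 * C * 0) at_top"
    using q by (intro tendsto_intros tendsto_neg_powr filterlim_ident) auto
  then have "eventually (\<lambda>x. 4 * C * x powr (q - p) < \<epsilon>) at_top"
    by (rule order_tendstoD) (use \<epsilon> in simp)
  with eventually_ge_at_top[of "1::real"] have "eventually (\<lambda>x. 1 \<le> x \<and> 4 * C * x powr (q - p) < \<epsilon>) at_top"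
    by eventually_elim simp
  then obtain K where K: "1 \<le> K" "4 * C * K powr (q - p) < \<epsilon>" using eventually_happens'[OF trivial_limit_at_top_linorder] by blast
  have tail: "2 * C * (1 + x powr q) \<le> \<epsilon> * x powr p" if "K \<le> x" for x
  proof -
    have x: "1 \<le> x" using that K by simp
    have "x powr (q - p) \<le> K powr (q - p)" using that K q by (intro powr_mono2') auto
    then have "4 * C * x powr (q - p) \<le> \<epsilon>" using K C mult_left_mono[of "x powr (q - p)" "K powr (q - p)" "4 * C"] by linarith
    then have "4 * C * x powr (q - p) * x powr p \<le> \<epsilon> * x powr p" by (intro mult_right_mono) auto
    moreover have "x powr (q - p) * x powr p = x powr q" using x by (simp add: powr_add[symmetric])
    ultimately have "4 * C * x powr q \<le> \<epsilon> * x powr p" by (simp add: mult.assoc)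
    moreover have "2 * C * (1 + x powr q) \<le> 2 * C * (x powr q + x powr q)"
      using C x q by (intro mult_left_mono add_right_mono ge_one_powr_ge_zero) auto
    ultimately show ?thesis by (simp add: algebra_simps)
  qed
  \<comment> \<open>This scale maps \<open>[-K,K]\<close> onto \<open>[-pi/2,pi/2]\<close>, where
    \<open>sin\<close> is inverted by \<open>arcsin\<close>.\<close>
  define \<kappa> where "\<kappa> = pi / (2 * K)"
  have \<kappa>: "\<kappa> > 0" using K by (simp add: \<kappa>_def)
  have arc: "\<bar>arcsin y / \<kappa>\<bar> \<le> K" if "y \<in> {-1..1}" for y
  proof -
    have "\<bar>arcsin y\<bar> \<le> pi / 2" using arcsin_lbound[of y] arcsin_ubound[of y] that by auto
    then have "\<bar>arcsin y\<bar> / \<kappa> \<le> (pi / 2) / \<kappa>" using \<kappa> by (intro divide_right_mono) auto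
    then show ?thesis using K \<kappa> by (simp add: \<kappa>_def abs_divide abs_mult)
  qed
  have "continuous_on {-1..1} (\<lambda>y. \<phi> (arcsin y / \<kappa>))"
    by (rule continuous_on_compose2[OF \<phi>(1)]) (use \<kappa> in \<open>auto intro!: continuous_intros\<close>)
  then obtain P where P: "real_polynomial_function P" "\<And>y. y \<in> {-1..1} \<Longrightarrow> \<bar>\<phi> (arcsin y / \<kappa>) - P y\<bar> < \<epsilon> / 2"
    using Stone_Weierstrass_real_polynomial_function[of "{-1..1::real}" _ "\<epsilon> / 2"] \<epsilon> by (metis compact_Icc half_gt_zero)
  have inner: "\<bar>\<phi> x - P (sin (\<kappa> * x))\<bar> \<le> \<epsilon> / 2" if "\<bar>x\<bar> \<le> K" for x
  proof -
    have "\<bar>\<kappa> * x\<bar> \<le> pi / 2" using that K by (simp add: \<kappa>_def abs_mult field_simps)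
    then have "arcsin (sin (\<kappa> * x)) = \<kappa> * x" by (intro arcsin_sin) auto
    then show ?thesis using P(2)[of "sin (\<kappa> * x)"] \<kappa> by simp
  qed
  have outer: "\<bar>P (sin (\<kappa> * x))\<bar> \<le> \<epsilon> / 2 + C * (1 + \<bar>x\<bar> powr q)" if "K < \<bar>x\<bar>" for x
  proof -
    \<comment> \<open>Outside \<open>[-K,K]\<close> the sine folds \<open>x\<close> back to a point
      \<open>?z\<close> of that interval. There the growth bound of \<open>\<phi>\<close> is no
      larger than its value at \<open>x\<close>, since
      \<open>\<bar>?z\<bar> \<le> K < \<bar>x\<bar>\<close>.\<close>
    let ?z = "arcsin (sin (\<kappa> * x)) / \<kappa>"
    have s: "sin (\<kappa> * x) \<in> {-1..1}" by simp
    have z: "\<bar>?z\<bar> \<le> K" by (intro arc) simp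
    have "\<bar>P (sin (\<kappa> * x))\<bar> \<le> \<epsilon> / 2 + \<bar>\<phi> ?z\<bar>" using P(2)[of "sin (\<kappa> * x)", OF s] by linarith
    also have "\<bar>\<phi> ?z\<bar> \<le> C * (1 + \<bar>?z\<bar> powr q)" by (rule \<phi>(2))
    also have "\<dots> \<le> C * (1 + \<bar>x\<bar> powr q)"
      using z that C q by (intro mult_left_mono add_left_mono powr_mono2) auto
    finally show ?thesis by simp
  qed
  have far: "\<bar>y - P (sin (\<kappa> * x))\<bar> \<le> \<epsilon> * (1 + \<bar>x\<bar> powr p)" if "K < \<bar>x\<bar>" "\<bar>y\<bar> \<le> C * (1 + \<bar>x\<bar> powr q)" for x y
  proof -
    have "\<bar>y - P (sin (\<kappa> * x))\<bar> \<le> \<epsilon> / 2 + 2 * C * (1 + \<bar>x\<bar> powr q)"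
      using outer[OF that(1)] that(2) by linarith
    also have "\<dots> \<le> \<epsilon> / 2 + \<epsilon> * \<bar>x\<bar> powr p" using tail[of "\<bar>x\<bar>"] that by simp
    also have "\<dots> \<le> \<epsilon> * (1 + \<bar>x\<bar> powr p)" using \<epsilon> by (simp add: algebra_simps)
    finally show ?thesis .
  qed
  have half: "\<epsilon> \<le> \<epsilon> * (1 + \<bar>x\<bar> powr p)" for x using \<epsilon> by simp
  obtain n2 where n2: "\<And>n x. n \<ge> n2 \<Longrightarrow> x \<in> {-K..K} \<Longrightarrow> \<bar>\<phi>n n x - \<phi> x\<bar> \<le> \<epsilon> / 2"
    using unif[of K "\<epsilon> / 2"] K \<epsilon> by (meson half_gt_zero less_le_trans zero_less_one)
  have "\<bar>\<phi>n n x - P (sin (\<kappa> * x))\<bar> \<le> \<epsilon> * (1 + \<bar>x\<bar> powr p)" if n: "n \<ge> max n1 n2" and x: "\<bar>x\<bar> \<le> r n" for n x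
  proof (cases "\<bar>x\<bar> \<le> K")
    case True
    then have "\<bar>\<phi>n n x - \<phi> x\<bar> \<le> \<epsilon> / 2" using n by (intro n2) auto
    then have "\<bar>\<phi>n n x - P (sin (\<kappa> * x))\<bar> \<le> \<epsilon>" using inner[OF True] by linarith
    then show ?thesis using half[of x] by linarith
  next
    case False
    then show ?thesis using n x by (intro far \<phi>n) auto
  qed
  moreover have "\<bar>\<phi> x - P (sin (\<kappa> * x))\<bar> \<le> \<epsilon> * (1 + \<bar>x\<bar> powr p)" for x
  proof (cases "\<bar>x\<bar> \<le> K")
    case True
    then show ?thesis using inner[OF True] half[of x] \<epsilon> by linarith
  next
    case False
    then show ?thesis by (intro far \<phi>) auto
  qed
  ultimately show ?thesis using P(1) by blast
qed

section \<open>Regular variation of the branches at zero\<close>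

lemma branch_ratio_tendsto:
  assumes r: "regular_branch r b x0" "0 < x0" and x: "0 < x"
  shows "((\<lambda>y. r (x * y) / r y) \<longlongrightarrow> x powr b) (at_right 0)"
proof -
  obtain L where L: "\<And>x. 0 < x \<Longrightarrow> x \<le> x0 \<Longrightarrow> r x = x powr b * L x \<and> 0 < r x \<and> 0 < L x"
    "slowly_varying_at_0 L"
    using r unfolding regular_branch_def by blast
  have lim: "((\<lambda>y. x powr b * (L (x * y) / L y)) \<longlongrightarrow> x powr b * 1) (at_right 0)"
    using L(2) x by (intro tendsto_intros) (simp add: slowly_varying_at_0_def)
  have "eventually (\<lambda>y. x powr b * (L (x * y) / L y) = r (x * y) / r y) (at_right 0)"
    unfolding eventually_at_right_field
  proof (intro exI[of _ "min x0 (x0 / x)"] conjI allI impI)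
    show "0 < min x0 (x0 / x)" using r x by simp
    fix y assume y: "0 < y" "y < min x0 (x0 / x)"
    then have "x * y \<le> x0" using x by (simp add: field_simps)
    then have "r (x * y) = (x * y) powr b * L (x * y)" "r y = y powr b * L y" "0 < L y"
      using L(1)[of "x * y"] L(1)[of y] x y by auto
    then show "x powr b * (L (x * y) / L y) = r (x * y) / r y" using x y by (simp add: powr_mult)
  qed
  from tendsto_cong[OF this, of "x powr b"] lim show ?thesis by simp
qed

text \<open>A Potter bound by dyadic iteration. Since \<open>b < q\<close>, doubling a small
  argument multiplies \<open>r\<close> by at most \<open>2 powr q\<close>, and monotonicity fills in
  between powers of 2. The range \<open>x * y \<le> 1\<close> exceeds the neighbourhood of 0 where
  this works; beyond it \<open>r\<close> is bounded by \<open>r 1\<close>.\<close>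

lemma branch_potter:
  assumes r: "regular_branch r b x0" "0 < x0" and b: "b < q"
    and mono: "\<And>x y. 0 \<le> x \<Longrightarrow> x \<le> y \<Longrightarrow> r x \<le> r y" and r0: "0 \<le> r 0"
  shows "\<exists>y0>0. \<exists>C\<ge>0. \<forall>y x. 0 < y \<longrightarrow> y \<le> y0 \<longrightarrow> 0 \<le> x \<longrightarrow> x * y \<le> 1 \<longrightarrow> r (x * y) \<le> C * (1 + x powr q) * r y"
proof -
  have q: "0 < q" using r b unfolding regular_branch_def by linarith
  have pos: "0 < r x" if "0 < x" "x \<le> x0" for x
    using r that unfolding regular_branch_def by blast
  have "2 powr b < 2 powr q" using b by simp
  then have "eventually (\<lambda>y. r (2 * y) / r y < 2 powr q) (at_right 0)"
    by (intro order_tendstoD[OF branch_ratio_tendsto[OF r]]) auto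
  then obtain d where d: "0 < d" "\<And>y. 0 < y \<Longrightarrow> y < d \<Longrightarrow> r (2 * y) / r y < 2 powr q"
    unfolding eventually_at_right_field by blast
  define y0 where "y0 = min (d / 2) x0"
  have y0: "0 < y0" "y0 < d" "y0 \<le> x0" using d r by (auto simp: y0_def)
  have dbl: "r (2 * y) \<le> 2 powr q * r y" if "0 < y" "y \<le> y0" for y
    using d(2)[of y] pos[of y] that y0 by (simp add: field_simps)
  \<comment> \<open>The bound \<open>2 * y0\<close> on the final argument leaves the argument before
    the last doubling at most \<open>y0\<close>, which is what \<open>dbl\<close> needs.\<close>
  have iter: "r (2 ^ k * y) \<le> (2 ^ k) powr q * r y" if "0 < y" "2 ^ k * y \<le> 2 * y0" for k :: nat and y
    using that
  proof (induction k)
    case (Suc k)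
    then have le: "2 ^ k * y \<le> y0" by simp
    have "r (2 * (2 ^ k * y)) \<le> 2 powr q * r (2 ^ k * y)" using le Suc.prems by (intro dbl) auto
    also have "\<dots> \<le> 2 powr q * ((2 ^ k) powr q * r y)" using Suc le y0 by (intro mult_left_mono Suc.IH) auto
    finally show ?case by (simp add: powr_mult mult.assoc)
  qed simp
  have small: "r (x * y) \<le> 2 powr q * x powr q * r y" if "0 < y" "1 \<le> x" "x * y \<le> y0" for x y
  proof -
    define k where "k = nat \<lfloor>log 2 x\<rfloor>"
    have l: "0 \<le> log 2 x" using that by simp
    have k1: "2 ^ k \<le> x"
    proof -
      have "2 powr real k \<le> 2 powr log 2 x" unfolding k_def using l by (intro powr_mono) auto
      then show ?thesis using that by (simp add: powr_realpow)
    qed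
    have k2: "x \<le> 2 ^ Suc k"
    proof -
      have "2 powr log 2 x \<le> 2 powr real (Suc k)" unfolding k_def using l by (intro powr_mono) (auto, linarith)
      then show ?thesis using that by (simp add: powr_realpow[symmetric] powr_add del: powr_realpow)
    qed
    have y: "y \<le> y0"
    proof -
      have "1 * y \<le> x * y" using that by (intro mult_right_mono) auto
      then show ?thesis using that(3) by linarith
    qed
    have "r (x * y) \<le> r (2 ^ Suc k * y)" using k2 that by (intro mono mult_right_mono) auto
    also have "\<dots> \<le> (2 ^ Suc k) powr q * r y"
    proof (rule iter)
      have "2 ^ k * y \<le> x * y" using k1 that by (intro mult_right_mono) auto
      then have "2 ^ k * y \<le> y0" using that(3) by linarith
      then show "2 ^ Suc k * y \<le> 2 * y0" by simp
    qed (use that in simp)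
    also have "\<dots> \<le> (2 * x) powr q * r y"
      using k1 q pos[of y] that y y0 by (intro mult_right_mono powr_mono2) auto
    finally show ?thesis using that by (simp add: powr_mult)
  qed
  \<comment> \<open>The summand 1 serves small arguments, where rounding up to a power of 2 costs
    \<open>2 powr q\<close>. The quotient serves arguments above \<open>y0\<close>, where
    \<open>r\<close> is at most \<open>r 1\<close>.\<close>
  define C where "C = 2 powr q * (1 + r 1 / r y0)"
  have r1: "0 \<le> r 1" using mono[of 0 1] r0 by simp
  have ry0: "0 < r y0" using pos y0 by simp
  have C2: "2 powr q \<le> C" and C1: "1 \<le> C"
  proof -
    have "2 powr q * 1 \<le> 2 powr q * (1 + r 1 / r y0)" using r1 ry0 by (intro mult_left_mono) auto
    then show "2 powr q \<le> C" by (simp add: C_def)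
    moreover have "1 \<le> 2 powr q" using q by (intro ge_one_powr_ge_zero) auto
    ultimately show "1 \<le> C" by linarith
  qed
  have "r (x * y) \<le> C * (1 + x powr q) * r y" if "0 < y" "y \<le> y0" "0 \<le> x" "x * y \<le> 1" for x y
  proof -
    have ry: "0 < r y" using pos that y0 by simp
    consider "x \<le> 1" | "1 \<le> x" "x * y \<le> y0" | "1 \<le> x" "y0 < x * y" by linarith
    then show ?thesis
    proof cases
      case 1
      have "x * y \<le> 1 * y" using 1 that by (intro mult_right_mono) auto
      then have "r (x * y) \<le> r y" using that by (intro mono) auto
      also have "\<dots> = 1 * (1 + 0) * r y" by simp
      also have "\<dots> \<le> C * (1 + x powr q) * r y" using C1 ry by (intro mult_right_mono mult_mono add_mono) auto
      finally show ?thesis .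
    next
      case 2
      have "r (x * y) \<le> 2 powr q * x powr q * r y" using 2 that by (intro small) auto
      also have "\<dots> \<le> C * (1 + x powr q) * r y" using C2 C1 ry by (intro mult_right_mono mult_mono) auto
      finally show ?thesis .
    next
      case 3
      have "1 \<le> y0 / y" using that by (simp add: field_simps)
      then have "r (y0 / y * y) \<le> 2 powr q * (y0 / y) powr q * r y" using that by (intro small) auto
      also have "(y0 / y) powr q \<le> x powr q"
        using 3 that y0 q by (intro powr_mono2) (auto simp: field_simps)
      finally have a: "r y0 \<le> 2 powr q * x powr q * r y" using that ry by (simp add: mult_left_mono mult_right_mono)
      have "r (x * y) \<le> r 1" using that by (intro mono) auto
      also have "\<dots> = (r 1 / r y0) * r y0" using ry0 by simp
      also have "\<dots> \<le> (r 1 / r y0) * (2 powr q * x powr q * r y)" using a r1 ry0 by (intro mult_left_mono) auto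
      also have "\<dots> = (2 powr q * (r 1 / r y0)) * x powr q * r y" by simp
      also have "\<dots> \<le> C * (1 + x powr q) * r y"
        using C1 ry by (intro mult_right_mono mult_mono) (auto simp: C_def algebra_simps)
      finally show ?thesis .
    qed
  qed
  then show ?thesis using y0(1) C1 by (intro exI[of _ y0] conjI exI[of _ C]) auto
qed


section \<open>Rescaled admissible costs and their limit\<close>

text \<open>The integrand of \<open>limit_functional\<close> as one function of the process value.
  As \<open>0 powr b = 0\<close>, only the summand matching the sign of \<open>x\<close> can be
  nonzero.\<close>

definition limit_cost :: "real \<Rightarrow> real \<Rightarrow> real \<Rightarrow> real \<Rightarrow> real \<Rightarrow> real" where
  "limit_cost bneg bpos \<pi>neg \<pi>pos x = \<pi>neg * max 0 (- x) powr bneg + \<pi>pos * max 0 x powr bpos"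

lemma continuous_on_limit_cost:
  assumes "0 < bneg" "0 < bpos"
  shows "continuous_on A (limit_cost bneg bpos \<pi>neg \<pi>pos)"
  unfolding limit_cost_def[abs_def] using assms
  by (intro continuous_intros continuous_on_powr') auto

locale admissible_cost =
  fixes \<rho>c :: "real \<Rightarrow> real" and bneg bpos \<pi>neg \<pi>pos :: real
  assumes adm: "locally_admissible \<rho>c bneg bpos \<pi>neg \<pi>pos"
begin

lemma convex: "convex_on UNIV \<rho>c" and nonneg: "0 \<le> \<rho>c x" and zero: "\<rho>c 0 = 0"
  and \<pi>neg: "0 \<le> \<pi>neg" "\<pi>neg \<le> 1" and \<pi>pos: "0 \<le> \<pi>pos" "\<pi>pos \<le> 1"
  and neg_lim: "((\<lambda>x. branch_neg \<rho>c x / branch_max \<rho>c x) \<longlongrightarrow> \<pi>neg) (at_right 0)"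
  and pos_lim: "((\<lambda>x. branch_pos \<rho>c x / branch_max \<rho>c x) \<longlongrightarrow> \<pi>pos) (at_right 0)"
  using adm by (auto simp: locally_admissible_def)

lemma regular: "\<exists>x0>0. regular_branch (branch_pos \<rho>c) bpos x0 \<and> regular_branch (branch_neg \<rho>c) bneg x0"
  using adm by (auto simp: locally_admissible_def)

lemma b_ge_1: "1 \<le> bneg" "1 \<le> bpos"
  using regular by (auto simp: regular_branch_def)

text \<open>Convexity along the segment from 0 to \<open>x\<close>, together with
  \<open>\<rho>c 0 = 0\<close>; it makes both branches nondecreasing.\<close>

lemma cost_scale: "0 \<le> t \<Longrightarrow> t \<le> 1 \<Longrightarrow> \<rho>c (t * x) \<le> \<rho>c x"
proof -
  assume t: "0 \<le> t" "t \<le> 1"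
  have "\<rho>c ((1 - t) *\<^sub>R 0 + t *\<^sub>R x) \<le> (1 - t) * \<rho>c 0 + t * \<rho>c x"
    using t by (intro convex_onD[OF convex]) auto
  also have "\<dots> \<le> 1 * \<rho>c x" unfolding zero using t nonneg[of x] by (simp add: mult_left_le_one_le)
  finally show ?thesis by simp
qed

lemma pos_mono: "0 \<le> x \<Longrightarrow> x \<le> y \<Longrightarrow> branch_pos \<rho>c x \<le> branch_pos \<rho>c y"
  using cost_scale[of "x / y" y] by (cases "y = 0") (auto simp: branch_pos_def)

lemma neg_mono: "0 \<le> x \<Longrightarrow> x \<le> y \<Longrightarrow> branch_neg \<rho>c x \<le> branch_neg \<rho>c y"
  using cost_scale[of "x / y" "- y"] by (cases "y = 0") (auto simp: branch_neg_def)

lemma eventually_max_pos: "eventually (\<lambda>y. 0 < branch_pos \<rho>c y \<and> 0 < branch_neg \<rho>c y) (at_right 0)"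
proof -
  obtain x0 where x0: "0 < x0" "regular_branch (branch_pos \<rho>c) bpos x0" "regular_branch (branch_neg \<rho>c) bneg x0"
    using regular by blast
  then have "0 < branch_pos \<rho>c y \<and> 0 < branch_neg \<rho>c y" if "0 < y" "y < x0" for y
    using that unfolding regular_branch_def by (meson less_imp_le)
  then show ?thesis unfolding eventually_at_right_field using x0(1) by blast
qed

text \<open>Near 0 one of the two ratios always equals 1, so their maximum tends to 1. Thus at least
  one sign of the process carries full weight, which is the starting point for positivity of the
  limit.\<close>

lemma max_\<pi>: "\<pi>neg = 1 \<or> \<pi>pos = 1"
proof -
  have "((\<lambda>x. max (branch_neg \<rho>c x / branch_max \<rho>c x) (branch_pos \<rho>c x / branch_max \<rho>c x)) \<longlongrightarrow> max \<pi>neg \<pi>pos) (at_right 0)"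
    by (intro tendsto_max neg_lim pos_lim)
  moreover have "eventually (\<lambda>x. max (branch_neg \<rho>c x / branch_max \<rho>c x) (branch_pos \<rho>c x / branch_max \<rho>c x) = 1) (at_right 0)"
    using eventually_max_pos by eventually_elim (auto simp: branch_max_def max_def divide_simps)
  ultimately have "((\<lambda>x. 1) \<longlongrightarrow> max \<pi>neg \<pi>pos) (at_right (0::real))"
    using tendsto_cong by force
  then have "max \<pi>neg \<pi>pos = 1" by (simp add: tendsto_const_iff)
  then show ?thesis by (auto simp: max_def split: if_splits)
qed

lemma root_inverse_tendsto: "filterlim (\<lambda>n. 1 / sqrt (real n)) (at_right 0) sequentially"
  unfolding filterlim_at
proof (intro conjI)
  show "eventually (\<lambda>n. 1 / sqrt (real n) \<in> {0<..} \<and> 1 / sqrt (real n) \<noteq> 0) sequentially"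
    using eventually_gt_at_top[of 0] by eventually_elim auto
  have "filterlim (\<lambda>n. sqrt (real n)) at_top sequentially"
    by (intro filterlim_compose[OF sqrt_at_top] filterlim_real_sequentially)
  then show "(\<lambda>n. 1 / sqrt (real n)) \<longlonglongrightarrow> 0"
    using tendsto_inverse_0_at_top by (simp add: inverse_eq_divide)
qed

text \<open>For \<open>n = 0\<close>, division by zero yields the zero function, so the identity
  with the normalized statistic holds for every \<open>n\<close>.\<close>

definition scaled_cost :: "nat \<Rightarrow> real \<Rightarrow> real" where
  "scaled_cost n x = 1 / branch_max \<rho>c (1 / sqrt (real n)) * \<rho>c (x / sqrt (real n))"

text \<open>With \<open>y = 1 / sqrt n\<close> the quotient factors into the share of this branch in
  the maximum, tending to \<open>\<pi>\<close>, and the ratio \<open>r (x * y) / r y\<close>,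
  governed by regular variation.\<close>

lemma branch_lim:
  assumes "regular_branch r b x0" "0 < x0" and x: "0 \<le> x" and r0: "r 0 = 0"
    and \<pi>: "((\<lambda>y. r y / branch_max \<rho>c y) \<longlongrightarrow> \<pi>) (at_right 0)"
    and pos: "eventually (\<lambda>y. 0 < r y) (at_right 0)"
  shows "(\<lambda>n. 1 / branch_max \<rho>c (1 / sqrt (real n)) * r (x / sqrt (real n))) \<longlonglongrightarrow> \<pi> * x powr b"
proof (cases "x = 0")
  case False
  have "((\<lambda>y. (r y / branch_max \<rho>c y) * (r (x * y) / r y)) \<longlongrightarrow> \<pi> * x powr b) (at_right 0)"
    by (intro tendsto_mult \<pi> branch_ratio_tendsto[OF assms(1,2)]) (use False x in auto)
  then have "((\<lambda>y. 1 / branch_max \<rho>c y * r (x * y)) \<longlongrightarrow> \<pi> * x powr b) (at_right 0)"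
    by (rule Lim_transform_eventually) (use pos in eventually_elim, auto)
  from filterlim_compose[OF this root_inverse_tendsto] show ?thesis by simp
qed (simp add: r0)

lemma scaled_cost_pos: "0 \<le> x \<Longrightarrow> scaled_cost n x = 1 / branch_max \<rho>c (1 / sqrt (real n)) * branch_pos \<rho>c (x / sqrt (real n))"
  by (simp add: scaled_cost_def branch_pos_def)

lemma scaled_cost_neg: "scaled_cost n (- x) = 1 / branch_max \<rho>c (1 / sqrt (real n)) * branch_neg \<rho>c (x / sqrt (real n))"
  by (simp add: scaled_cost_def branch_neg_def)

lemma max_nonneg: "0 \<le> branch_max \<rho>c y"
  unfolding branch_max_def branch_pos_def using nonneg by (simp add: le_max_iff_disj)

text \<open>Each half-line is treated separately, since monotonicity, and with it Polya's theorem,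
  holds only branch by branch.\<close>

lemma scaled_cost_uniform:
  assumes "0 < K" "0 < e"
  shows "\<exists>n0. \<forall>n\<ge>n0. \<forall>x\<in>{-K..K}. \<bar>scaled_cost n x - limit_cost bneg bpos \<pi>neg \<pi>pos x\<bar> \<le> e"
proof -
  obtain x0 where x0: "0 < x0" "regular_branch (branch_pos \<rho>c) bpos x0" "regular_branch (branch_neg \<rho>c) bneg x0"
    using regular by blast
  have "\<exists>n0. \<forall>n\<ge>n0. \<forall>x\<in>{0..K}. \<bar>1 / branch_max \<rho>c (1 / sqrt (real n)) * branch_pos \<rho>c (x / sqrt (real n)) - \<pi>pos * x powr bpos\<bar> \<le> e"
  proof (rule polya_uniform_conv[OF assms(1) _ _ _ assms(2)])
    show "(\<lambda>n. 1 / branch_max \<rho>c (1 / sqrt (real n)) * branch_pos \<rho>c (x / sqrt (real n))) \<longlonglongrightarrow> \<pi>pos * x powr bpos"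
      if "0 \<le> x" for x
      using that by (intro branch_lim[OF x0(2,1)] pos_lim eventually_mono[OF eventually_max_pos])
        (auto simp: branch_pos_def zero)
    show "continuous_on {0..K} (\<lambda>x. \<pi>pos * x powr bpos)"
      using b_ge_1 by (intro continuous_intros continuous_on_powr') auto
  qed (auto intro!: mult_left_mono pos_mono divide_right_mono simp: max_nonneg)
  moreover have "\<exists>n0. \<forall>n\<ge>n0. \<forall>x\<in>{0..K}. \<bar>1 / branch_max \<rho>c (1 / sqrt (real n)) * branch_neg \<rho>c (x / sqrt (real n)) - \<pi>neg * x powr bneg\<bar> \<le> e"
  proof (rule polya_uniform_conv[OF assms(1) _ _ _ assms(2)])
    show "(\<lambda>n. 1 / branch_max \<rho>c (1 / sqrt (real n)) * branch_neg \<rho>c (x / sqrt (real n))) \<longlonglongrightarrow> \<pi>neg * x powr bneg"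
      if "0 \<le> x" for x
      using that by (intro branch_lim[OF x0(3,1)] neg_lim eventually_mono[OF eventually_max_pos])
        (auto simp: branch_neg_def zero)
    show "continuous_on {0..K} (\<lambda>x. \<pi>neg * x powr bneg)"
      using b_ge_1 by (intro continuous_intros continuous_on_powr') auto
  qed (auto intro!: mult_left_mono neg_mono divide_right_mono simp: max_nonneg)
  ultimately obtain n1 n2 where
    n1: "\<And>n x. n \<ge> n1 \<Longrightarrow> x \<in> {0..K} \<Longrightarrow> \<bar>1 / branch_max \<rho>c (1 / sqrt (real n)) * branch_pos \<rho>c (x / sqrt (real n)) - \<pi>pos * x powr bpos\<bar> \<le> e"
    and n2: "\<And>n x. n \<ge> n2 \<Longrightarrow> x \<in> {0..K} \<Longrightarrow> \<bar>1 / branch_max \<rho>c (1 / sqrt (real n)) * branch_neg \<rho>c (x / sqrt (real n)) - \<pi>neg * x powr bneg\<bar> \<le> e"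
    by blast
  have "\<bar>scaled_cost n x - limit_cost bneg bpos \<pi>neg \<pi>pos x\<bar> \<le> e" if "n \<ge> max n1 n2" "x \<in> {-K..K}" for n x
  proof (cases "0 \<le> x")
    case True
    then have "limit_cost bneg bpos \<pi>neg \<pi>pos x = \<pi>pos * x powr bpos" by (simp add: limit_cost_def)
    then show ?thesis using n1[of n x] that True by (simp only: scaled_cost_pos) simp
  next
    case False
    then have "limit_cost bneg bpos \<pi>neg \<pi>pos x = \<pi>neg * (- x) powr bneg" by (simp add: limit_cost_def)
    then show ?thesis using n2[of n "- x"] that False scaled_cost_neg[of n "- x"] by simp
  qed
  then show ?thesis by blast
qed

lemma limit_cost_bound:
  assumes q: "bneg \<le> q" "bpos \<le> q"
  shows "0 \<le> limit_cost bneg bpos \<pi>neg \<pi>pos x" "limit_cost bneg bpos \<pi>neg \<pi>pos x \<le> 1 + \<bar>x\<bar> powr q"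
proof -
  have 1: "\<bar>x\<bar> powr b \<le> 1 + \<bar>x\<bar> powr q" if "1 \<le> b" "b \<le> q" for b
  proof (cases "\<bar>x\<bar> \<le> 1")
    case True
    then have "\<bar>x\<bar> powr b \<le> 1" using that by (intro powr_le1) auto
    then show ?thesis by (simp add: add_increasing2)
  next
    case False
    then have "\<bar>x\<bar> powr b \<le> \<bar>x\<bar> powr q" using that by (intro powr_mono) auto
    then show ?thesis by simp
  qed
  have 2: "\<pi> * \<bar>x\<bar> powr b \<le> 1 + \<bar>x\<bar> powr q" if "0 \<le> \<pi>" "\<pi> \<le> 1" "1 \<le> b" "b \<le> q" for \<pi> b
    using mult_right_mono[OF that(2), of "\<bar>x\<bar> powr b"] 1[OF that(3,4)] by simp
  show "0 \<le> limit_cost bneg bpos \<pi>neg \<pi>pos x" using \<pi>neg \<pi>pos by (simp add: limit_cost_def)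
  show "limit_cost bneg bpos \<pi>neg \<pi>pos x \<le> 1 + \<bar>x\<bar> powr q"
    using 2[OF \<pi>neg b_ge_1(1) q(1)] 2[OF \<pi>pos b_ge_1(2) q(2)]
    by (cases "0 \<le> x") (simp_all add: limit_cost_def)
qed

text \<open>The Potter bounds with \<open>y = 1 / sqrt n\<close>: their range
  \<open>x * y \<le> 1\<close> is exactly \<open>\<bar>x\<bar> \<le> sqrt n\<close>. Dividing by the
  maximum of the branches instead of the branch itself only helps.\<close>

lemma scaled_cost_bound:
  assumes q: "bneg < q" "bpos < q"
  shows "\<exists>C\<ge>0. \<exists>n1. \<forall>n\<ge>n1. \<forall>x. \<bar>x\<bar> \<le> sqrt (real n) \<longrightarrow> \<bar>scaled_cost n x\<bar> \<le> C * (1 + \<bar>x\<bar> powr q)"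
proof -
  obtain x0 where x0: "0 < x0" "regular_branch (branch_pos \<rho>c) bpos x0" "regular_branch (branch_neg \<rho>c) bneg x0"
    using regular by blast
  obtain y1 C1 where 1: "0 < y1" "0 \<le> C1" "\<And>x y. 0 < y \<Longrightarrow> y \<le> y1 \<Longrightarrow> 0 \<le> x \<Longrightarrow> x * y \<le> 1 \<Longrightarrow>
      branch_pos \<rho>c (x * y) \<le> C1 * (1 + x powr q) * branch_pos \<rho>c y"
    using branch_potter[OF x0(2,1) q(2) pos_mono] nonneg by (auto simp: branch_pos_def)
  obtain y2 C2 where 2: "0 < y2" "0 \<le> C2" "\<And>x y. 0 < y \<Longrightarrow> y \<le> y2 \<Longrightarrow> 0 \<le> x \<Longrightarrow> x * y \<le> 1 \<Longrightarrow>
      branch_neg \<rho>c (x * y) \<le> C2 * (1 + x powr q) * branch_neg \<rho>c y"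
    using branch_potter[OF x0(3,1) q(1) neg_mono] nonneg by (auto simp: branch_neg_def)
  have "eventually (\<lambda>y. 0 < y \<and> y \<le> min y1 y2) (at_right 0)"
    unfolding eventually_at_right_field using 1(1) 2(1) by (intro exI[of _ "min y1 y2"]) auto
  then have "eventually (\<lambda>y. 0 < y \<and> y \<le> min y1 y2 \<and> 0 < branch_pos \<rho>c y \<and> 0 < branch_neg \<rho>c y) (at_right 0)"
    using eventually_max_pos by eventually_elim auto
  from eventually_compose_filterlim[OF this root_inverse_tendsto]
  obtain n1 where n1: "\<And>n. n \<ge> n1 \<Longrightarrow> 0 < 1 / sqrt (real n) \<and> 1 / sqrt (real n) \<le> min y1 y2 \<and>
      0 < branch_pos \<rho>c (1 / sqrt (real n)) \<and> 0 < branch_neg \<rho>c (1 / sqrt (real n))"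
    unfolding eventually_sequentially by blast
  have key: "1 / branch_max \<rho>c y * r (x * y) \<le> C * (1 + x powr q)"
    if "r (x * y) \<le> C * (1 + x powr q) * r y" "0 < r y" "r y \<le> branch_max \<rho>c y" "0 \<le> C" for r x y C
  proof -
    have "1 / branch_max \<rho>c y * r (x * y) \<le> 1 / branch_max \<rho>c y * (C * (1 + x powr q) * r y)"
      using that by (intro mult_left_mono) auto
    also have "\<dots> = C * (1 + x powr q) * (r y / branch_max \<rho>c y)" by simp
    also have "\<dots> \<le> C * (1 + x powr q) * 1" using that by (intro mult_left_mono) auto
    finally show ?thesis by simp
  qed
  have "\<bar>scaled_cost n x\<bar> \<le> (C1 + C2) * (1 + \<bar>x\<bar> powr q)" if n: "n \<ge> n1" and x: "\<bar>x\<bar> \<le> sqrt (real n)" for n x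
  proof -
    let ?y = "1 / sqrt (real n)"
    note y = n1[OF n]
    have xy: "\<bar>x\<bar> * ?y \<le> 1" using x y by (simp add: field_simps)
    have sc0: "0 \<le> scaled_cost n x" unfolding scaled_cost_def using nonneg max_nonneg by simp
    have C12: "C1 * (1 + \<bar>x\<bar> powr q) \<le> (C1 + C2) * (1 + \<bar>x\<bar> powr q)" "C2 * (1 + \<bar>x\<bar> powr q) \<le> (C1 + C2) * (1 + \<bar>x\<bar> powr q)"
      using 1(2) 2(2) by (auto intro!: mult_right_mono)
    show ?thesis
    proof (cases "0 \<le> x")
      case True
      have "1 / branch_max \<rho>c ?y * branch_pos \<rho>c (\<bar>x\<bar> * ?y) \<le> C1 * (1 + \<bar>x\<bar> powr q)"
        using y xy 1(2) by (intro key 1(3)) (auto simp: branch_max_def)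
      then show ?thesis using C12(1) sc0 True by (simp add: scaled_cost_pos)
    next
      case False
      have "1 / branch_max \<rho>c ?y * branch_neg \<rho>c (\<bar>x\<bar> * ?y) \<le> C2 * (1 + \<bar>x\<bar> powr q)"
        using y xy 2(2) by (intro key 2(3)) (auto simp: branch_max_def)
      then show ?thesis using C12(2) sc0 False scaled_cost_neg[of n "- x"] by simp
    qed
  qed
  then show ?thesis using 1(2) 2(2) by (intro exI[of _ "C1 + C2"]) auto
qed

lemma scaled_cost_approx:
  assumes p: "bneg < p" "bpos < p" and \<epsilon>: "0 < \<epsilon>"
  shows "\<exists>P \<kappa> n0. real_polynomial_function P \<and>
      (\<forall>n\<ge>n0. \<forall>x. \<bar>x\<bar> \<le> sqrt (real n) \<longrightarrow> \<bar>scaled_cost n x - P (sin (\<kappa> * x))\<bar> \<le> \<epsilon> * (1 + \<bar>x\<bar> powr p)) \<and>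
      (\<forall>x. \<bar>limit_cost bneg bpos \<pi>neg \<pi>pos x - P (sin (\<kappa> * x))\<bar> \<le> \<epsilon> * (1 + \<bar>x\<bar> powr p))"
proof -
  \<comment> \<open>Strictly above both exponents for the Potter bound, strictly below
    \<open>p\<close> so that the growth is negligible at infinity.\<close>
  define q where "q = (max bneg bpos + p) / 2"
  have q: "bneg < q" "bpos < q" "q < p" "0 \<le> q" using p b_ge_1 by (auto simp: q_def max_def)
  obtain C n1 where C: "0 \<le> C" "\<And>n x. n \<ge> n1 \<Longrightarrow> \<bar>x\<bar> \<le> sqrt (real n) \<Longrightarrow> \<bar>scaled_cost n x\<bar> \<le> C * (1 + \<bar>x\<bar> powr q)"
    using scaled_cost_bound[OF q(1,2)] by blast
  have up: "a * (1 + \<bar>x\<bar> powr q) \<le> max C 1 * (1 + \<bar>x\<bar> powr q)" if "a \<le> max C 1" for a x :: real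
    using that by (intro mult_right_mono) auto
  show ?thesis
  proof (rule poly_sin_approx[where q = q and C = "max C 1" and ?n1.0 = n1 and r = "\<lambda>n. sqrt (real n)"])
    show "continuous_on UNIV (limit_cost bneg bpos \<pi>neg \<pi>pos)"
      using b_ge_1 by (intro continuous_on_limit_cost) auto
    show "\<bar>limit_cost bneg bpos \<pi>neg \<pi>pos x\<bar> \<le> max C 1 * (1 + \<bar>x\<bar> powr q)" for x
      using limit_cost_bound[of q x] q up[of 1 x] by simp
    show "\<bar>scaled_cost n x\<bar> \<le> max C 1 * (1 + \<bar>x\<bar> powr q)" if "n \<ge> n1" "\<bar>x\<bar> \<le> sqrt (real n)" for n x
      using C(2)[OF that] up[of C x] by simp
  qed (use q C \<epsilon> scaled_cost_uniform in auto)
qed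

end

section \<open>Finite-dimensional convergence\<close>

text \<open>Used with \<open>Suc\<close>: samples are numbered from 1, while the central limit
  theorem takes sequences indexed by all naturals.\<close>

lemma (in prob_space) indep_vars_reindex_inj:
  assumes f: "inj f" and X: "indep_vars (\<lambda>_. K) X (range f)"
  shows "indep_vars (\<lambda>_. K) (\<lambda>i. X (f i)) UNIV"
proof -
  have "indep_sets (\<lambda>i. sigma_sets (space M) {X (f i) -` A \<inter> space M |A. A \<in> sets K}) UNIV"
  proof (rule indep_setsI)
    show "sigma_sets (space M) {X (f i) -` A \<inter> space M |A. A \<in> sets K} \<subseteq> events" for i
      using X unfolding indep_vars_def indep_sets_def by auto
    fix A J assume J: "J \<noteq> {}" "finite J"
      and A: "\<forall>j\<in>J. A j \<in> sigma_sets (space M) {X (f j) -` A \<inter> space M |A. A \<in> sets K}"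
    have "prob (\<Inter>k\<in>f ` J. A (inv f k)) = (\<Prod>k\<in>f ` J. prob (A (inv f k)))"
      using X J A f unfolding indep_vars_def by (intro indep_setsD[of _ "range f"]) auto
    then show "prob (\<Inter>j\<in>J. A j) = (\<Prod>j\<in>J. prob (A j))"
      using f by (simp add: prod.reindex inj_on_subset[OF f])
  qed
  then show ?thesis using X unfolding indep_vars_def by auto
qed

lemma (in prob_space) iid_iexp_tendsto:
  fixes \<xi> :: "nat \<Rightarrow> 'a \<Rightarrow> real"
  assumes indep: "indep_vars (\<lambda>_. borel) \<xi> {1..}"
    and ident: "\<And>i. i \<ge> 1 \<Longrightarrow> distr M borel (\<xi> i) = distr M borel (\<xi> 1)"
    and bound: "\<And>i \<omega>. \<bar>\<xi> i \<omega>\<bar> \<le> C" and mean: "expectation (\<xi> 1) = 0"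
  shows "(\<lambda>n. \<integral>\<omega>. iexp ((\<Sum>i\<in>{1..n}. \<xi> i \<omega>) / sqrt (real n)) \<partial>M) \<longlonglongrightarrow>
    complex_of_real (exp (- (expectation (\<lambda>\<omega>. (\<xi> 1 \<omega>)\<^sup>2)) / 2))"
proof -
  have m [measurable]: "\<xi> i \<in> borel_measurable M" if "i \<ge> 1" for i
    using indep that by (auto simp: indep_vars_def)
  have m1 [measurable]: "\<xi> (Suc i) \<in> borel_measurable M" for i by (rule m) simp
  have C: "0 \<le> C" using bound[of 0 undefined] abs_ge_zero order_trans by blast
  have sq: "(\<xi> i \<omega>)\<^sup>2 \<le> C\<^sup>2" for i \<omega> using bound[of i \<omega>] C by (simp add: abs_le_square_iff[symmetric])
  have int2: "integrable M (\<lambda>\<omega>. (\<xi> (Suc i) \<omega>)\<^sup>2)" for i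
    by (intro integrable_const_bound[where B = "C\<^sup>2"]) (auto simp: sq)
  have tr: "expectation (\<lambda>\<omega>. g (\<xi> (Suc i) \<omega>)) = expectation (\<lambda>\<omega>. g (\<xi> 1 \<omega>))"
    if [measurable]: "g \<in> borel_measurable borel" for g :: "real \<Rightarrow> real" and i
  proof -
    have "expectation (\<lambda>\<omega>. g (\<xi> (Suc i) \<omega>)) = (\<integral>x. g x \<partial>distr M borel (\<xi> (Suc i)))"
      by (subst integral_distr) auto
    also have "\<dots> = (\<integral>x. g x \<partial>distr M borel (\<xi> 1))" by (subst ident) auto
    also have "\<dots> = expectation (\<lambda>\<omega>. g (\<xi> 1 \<omega>))" by (subst integral_distr) auto
    finally show ?thesis .
  qed
  have mean': "expectation (\<xi> (Suc i)) = 0" for i using tr[of "\<lambda>x. x" i] mean by simp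
  define \<tau> where "\<tau> = sqrt (expectation (\<lambda>\<omega>. (\<xi> 1 \<omega>)\<^sup>2))"
  have \<tau>2: "\<tau>\<^sup>2 = expectation (\<lambda>\<omega>. (\<xi> 1 \<omega>)\<^sup>2)" unfolding \<tau>_def by simp
  have shift: "(\<Sum>i\<in>{1..n}. \<xi> i \<omega>) = (\<Sum>i<n. \<xi> (Suc i) \<omega>)" for n \<omega>
    by (rule sum.reindex_bij_witness[where i = Suc and j = "\<lambda>i. i - 1"]) auto
  show ?thesis
  proof (cases "\<tau> = 0")
    \<comment> \<open>With zero variance, which the central limit theorem excludes, the variables
      vanish almost surely and both sides are 1.\<close>
    case True
    then have z: "expectation (\<lambda>\<omega>. (\<xi> (Suc i) \<omega>)\<^sup>2) = 0" for i using tr[of "\<lambda>x. x\<^sup>2" i] \<tau>2 by simp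
    have "AE \<omega> in M. (\<xi> (Suc i) \<omega>)\<^sup>2 = 0" for i
      using z[of i] integral_nonneg_eq_0_iff_AE[OF int2[of i]] by simp
    then have "AE \<omega> in M. \<forall>i. \<xi> (Suc i) \<omega> = 0" by (simp add: AE_all_countable)
    then have "AE \<omega> in M. iexp ((\<Sum>i\<in>{1..n}. \<xi> i \<omega>) / sqrt (real n)) = 1" for n
      unfolding shift by eventually_elim simp
    then have "(\<integral>\<omega>. iexp ((\<Sum>i\<in>{1..n}. \<xi> i \<omega>) / sqrt (real n)) \<partial>M) = (\<integral>\<omega>. 1 \<partial>M)" for n
      unfolding shift by (intro integral_cong_AE) auto
    then show ?thesis using True \<tau>2[symmetric] by (simp add: prob_space)
  next
    case False
    then have \<tau>: "\<tau> > 0" unfolding \<tau>_def by (simp add: less_le)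
    have ind: "indep_vars (\<lambda>_. borel) (\<lambda>i. \<xi> (Suc i)) UNIV"
    proof (rule indep_vars_reindex_inj)
      show "indep_vars (\<lambda>_. borel) \<xi> (range Suc)" by (rule indep_vars_subset[OF indep]) auto
    qed simp
    have tr2: "expectation (\<lambda>\<omega>. (\<xi> (Suc i) \<omega>)\<^sup>2) = \<tau>\<^sup>2" for i using tr[of "\<lambda>x. x\<^sup>2" i] \<tau>2 by simp
    have "weak_conv_m (\<lambda>n. distr M borel (\<lambda>\<omega>. (\<Sum>i<n. \<xi> (Suc i) \<omega>) / sqrt (real n * \<tau>\<^sup>2))) std_normal_distribution"
    proof (rule central_limit_theorem_zero_mean[OF ind mean' \<tau> int2, where \<mu> = "distr M borel (\<xi> 1)"])
      show "variance (\<xi> (Suc i)) = \<tau>\<^sup>2" for i unfolding mean' diff_0_right by (rule tr2)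
      show "distr M borel (\<xi> (Suc i)) = distr M borel (\<xi> 1)" for i by (rule ident) simp
    qed
    \<comment> \<open>Evaluating the characteristic function at \<open>\<tau>\<close> undoes the
      division by the standard deviation.\<close>
    then have "(\<lambda>n. char (distr M borel (\<lambda>\<omega>. (\<Sum>i<n. \<xi> (Suc i) \<omega>) / sqrt (real n * \<tau>\<^sup>2))) \<tau>) \<longlonglongrightarrow> char std_normal_distribution \<tau>"
      by (intro levy_continuity1 real_distribution_distr real_dist_normal_dist) auto
    moreover have "char (distr M borel (\<lambda>\<omega>. (\<Sum>i<n. \<xi> (Suc i) \<omega>) / sqrt (real n * \<tau>\<^sup>2))) \<tau> =
       (\<integral>\<omega>. iexp ((\<Sum>i\<in>{1..n}. \<xi> i \<omega>) / sqrt (real n)) \<partial>M)" for n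
      unfolding char_def shift using \<tau> by (subst integral_distr) (auto simp: real_sqrt_mult)
    ultimately show ?thesis using \<tau>2[symmetric] by (simp add: char_std_normal_distribution exp_of_real[symmetric])
  qed
qed

section \<open>Negligibility in probability\<close>

definition (in prob_space) null_in_prob :: "(nat \<Rightarrow> 'a \<Rightarrow> real) \<Rightarrow> bool" where
  "null_in_prob U \<longleftrightarrow> (\<forall>n. U n \<in> borel_measurable M) \<and> (\<forall>e>0. (\<lambda>n. prob {\<omega> \<in> space M. e < \<bar>U n \<omega>\<bar>}) \<longlonglongrightarrow> 0)"

context prob_space begin

lemma null_in_prob_zero: "null_in_prob (\<lambda>n \<omega>. 0)"
  by (simp add: null_in_prob_def)

lemma null_in_prob_add:
  assumes "null_in_prob U" "null_in_prob V"
  shows "null_in_prob (\<lambda>n \<omega>. U n \<omega> + V n \<omega>)"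
  unfolding null_in_prob_def
proof (intro conjI allI impI)
  have [measurable]: "U n \<in> borel_measurable M" "V n \<in> borel_measurable M" for n
    using assms by (auto simp: null_in_prob_def)
  show "(\<lambda>\<omega>. U n \<omega> + V n \<omega>) \<in> borel_measurable M" for n by measurable
  fix e :: real assume e: "e > 0"
  have "(\<lambda>n. prob {\<omega> \<in> space M. e / 2 < \<bar>U n \<omega>\<bar>} + prob {\<omega> \<in> space M. e / 2 < \<bar>V n \<omega>\<bar>}) \<longlonglongrightarrow> 0 + 0"
    using assms half_gt_zero[OF e] unfolding null_in_prob_def by (intro tendsto_add) blast+
  then have lim: "(\<lambda>n. prob {\<omega> \<in> space M. e / 2 < \<bar>U n \<omega>\<bar>} + prob {\<omega> \<in> space M. e / 2 < \<bar>V n \<omega>\<bar>}) \<longlonglongrightarrow> 0"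
    unfolding add_0 .
  show "(\<lambda>n. prob {\<omega> \<in> space M. e < \<bar>U n \<omega> + V n \<omega>\<bar>}) \<longlonglongrightarrow> 0"
  proof (rule Lim_null_comparison[OF always_eventually lim], intro allI)
    fix n
    have "prob {\<omega> \<in> space M. e < \<bar>U n \<omega> + V n \<omega>\<bar>} \<le> prob ({\<omega> \<in> space M. e / 2 < \<bar>U n \<omega>\<bar>} \<union> {\<omega> \<in> space M. e / 2 < \<bar>V n \<omega>\<bar>})"
      by (intro finite_measure_mono) auto
    also have "\<dots> \<le> prob {\<omega> \<in> space M. e / 2 < \<bar>U n \<omega>\<bar>} + prob {\<omega> \<in> space M. e / 2 < \<bar>V n \<omega>\<bar>}"
      by (rule measure_Un_le) measurable
    finally show "norm (prob {\<omega> \<in> space M. e < \<bar>U n \<omega> + V n \<omega>\<bar>}) \<le>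
      prob {\<omega> \<in> space M. e / 2 < \<bar>U n \<omega>\<bar>} + prob {\<omega> \<in> space M. e / 2 < \<bar>V n \<omega>\<bar>}" by simp
  qed
qed

lemma null_in_prob_scale:
  assumes "null_in_prob U"
  shows "null_in_prob (\<lambda>n \<omega>. c * U n \<omega>)"
proof (cases "c = 0")
  case False
  have "{\<omega> \<in> space M. e < \<bar>c * U n \<omega>\<bar>} = {\<omega> \<in> space M. e / \<bar>c\<bar> < \<bar>U n \<omega>\<bar>}" for e n
    using False by (auto simp: abs_mult field_simps)
  moreover have "(\<lambda>\<omega>. c * U n \<omega>) \<in> borel_measurable M" for n
    using assms unfolding null_in_prob_def by (intro borel_measurable_times) auto
  ultimately show ?thesis using assms False by (auto simp: null_in_prob_def)
qed (simp add: null_in_prob_zero)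

lemma null_in_prob_sum:
  assumes "\<And>i. i \<in> I \<Longrightarrow> null_in_prob (U i)"
  shows "null_in_prob (\<lambda>n \<omega>. \<Sum>i\<in>I. U i n \<omega>)"
  using assms by (induction I rule: infinite_finite_induct) (auto simp: null_in_prob_zero intro!: null_in_prob_add)

text \<open>Slutsky's lemma for characteristic functions: the difference of the exponentials is at
  most the distance of the arguments and at most 2, the latter being used on the event of small
  probability.\<close>

lemma iexp_tendsto_null_in_prob:
  assumes UV: "null_in_prob (\<lambda>n \<omega>. U n \<omega> - V n \<omega>)" and [measurable]: "\<And>n. U n \<in> borel_measurable M" "\<And>n. V n \<in> borel_measurable M"
    and lim: "(\<lambda>n. \<integral>\<omega>. iexp (V n \<omega>) \<partial>M) \<longlonglongrightarrow> c"
  shows "(\<lambda>n. \<integral>\<omega>. iexp (U n \<omega>) \<partial>M) \<longlonglongrightarrow> c"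
proof -
  have "(\<lambda>n. (\<integral>\<omega>. iexp (U n \<omega>) \<partial>M) - (\<integral>\<omega>. iexp (V n \<omega>) \<partial>M)) \<longlonglongrightarrow> 0"
  proof (rule LIMSEQ_I)
    fix e :: real assume e: "e > 0"
    have "(\<lambda>n. prob {\<omega> \<in> space M. e / 2 < \<bar>U n \<omega> - V n \<omega>\<bar>}) \<longlonglongrightarrow> 0" using UV half_gt_zero[OF e] unfolding null_in_prob_def by blast
    then have "eventually (\<lambda>n. prob {\<omega> \<in> space M. e / 2 < \<bar>U n \<omega> - V n \<omega>\<bar>} < e / 4) sequentially"
      by (rule order_tendstoD) (use e in simp)
    then obtain n0 where n0: "\<And>n. n \<ge> n0 \<Longrightarrow> prob {\<omega> \<in> space M. e / 2 < \<bar>U n \<omega> - V n \<omega>\<bar>} < e / 4"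
      by (auto simp: eventually_sequentially)
    have "cmod ((\<integral>\<omega>. iexp (U n \<omega>) \<partial>M) - (\<integral>\<omega>. iexp (V n \<omega>) \<partial>M)) < e" if "n \<ge> n0" for n
    proof -
      let ?A = "{\<omega> \<in> space M. e / 2 < \<bar>U n \<omega> - V n \<omega>\<bar>}"
      have i: "integrable M (\<lambda>\<omega>. iexp (U n \<omega>))" "integrable M (\<lambda>\<omega>. iexp (V n \<omega>))"
        by (auto intro!: integrable_iexp_real)
      have "cmod ((\<integral>\<omega>. iexp (U n \<omega>) \<partial>M) - (\<integral>\<omega>. iexp (V n \<omega>) \<partial>M)) = cmod (\<integral>\<omega>. iexp (U n \<omega>) - iexp (V n \<omega>) \<partial>M)"
        using i by simp
      also have "\<dots> \<le> (\<integral>\<omega>. cmod (iexp (U n \<omega>) - iexp (V n \<omega>)) \<partial>M)" by (rule integral_norm_bound)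
      also have "\<dots> \<le> (\<integral>\<omega>. e / 2 + 2 * indicator ?A \<omega> \<partial>M)"
      proof (intro integral_mono)
        fix \<omega> assume "\<omega> \<in> space M"
        have "cmod (iexp (U n \<omega>) - iexp (V n \<omega>)) \<le> 2"
          by (rule order_trans[OF norm_triangle_ineq4]) simp
        then show "cmod (iexp (U n \<omega>) - iexp (V n \<omega>)) \<le> e / 2 + 2 * indicator ?A \<omega>"
          using cmod_iexp_diff_le[of "U n \<omega>" "V n \<omega>"] e \<open>\<omega> \<in> space M\<close> by (auto split: split_indicator)
      qed (use i in \<open>auto simp: less_top[symmetric]\<close>)
      also have "\<dots> = e / 2 + 2 * prob ?A"
        by (subst Bochner_Integration.integral_add) (auto simp: prob_space less_top[symmetric])
      also have "\<dots> < e" using n0[OF that] e by simp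
      finally show ?thesis .
    qed
    then show "\<exists>no. \<forall>n\<ge>no. norm ((\<integral>\<omega>. iexp (U n \<omega>) \<partial>M) - (\<integral>\<omega>. iexp (V n \<omega>) \<partial>M) - 0) < e" by auto
  qed
  from tendsto_add[OF this lim] show ?thesis by simp
qed

lemma second_moment_sum:
  fixes Z :: "'i \<Rightarrow> 'a \<Rightarrow> real"
  assumes I: "finite I" and indep: "indep_vars (\<lambda>_. borel) Z I"
    and mean: "\<And>i. i \<in> I \<Longrightarrow> expectation (Z i) = 0" and bound: "\<And>i \<omega>. i \<in> I \<Longrightarrow> \<bar>Z i \<omega>\<bar> \<le> C"
  shows "expectation (\<lambda>\<omega>. (\<Sum>i\<in>I. Z i \<omega>)\<^sup>2) = (\<Sum>i\<in>I. expectation (\<lambda>\<omega>. (Z i \<omega>)\<^sup>2))"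
proof -
  have [measurable]: "Z i \<in> borel_measurable M" if "i \<in> I" for i using indep that by (auto simp: indep_vars_def)
  have int1: "integrable M (Z i)" if "i \<in> I" for i
    using that bound by (intro integrable_const_bound[where B = C]) auto
  have int2: "integrable M (\<lambda>\<omega>. Z i \<omega> * Z j \<omega>)" if "i \<in> I" "j \<in> I" for i j
  proof (rule integrable_const_bound[where B = "C * C"])
    show "AE \<omega> in M. norm (Z i \<omega> * Z j \<omega>) \<le> C * C"
      using that bound by (intro AE_I2) (auto simp: abs_mult intro!: mult_mono order_trans[OF abs_ge_zero bound])
  qed (use that in measurable)
  have prod: "expectation (\<lambda>\<omega>. Z i \<omega> * Z j \<omega>) = (if i = j then expectation (\<lambda>\<omega>. (Z i \<omega>)\<^sup>2) else 0)" if ij: "i \<in> I" "j \<in> I" for i j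
  proof (cases "i = j")
    case False
    have "expectation (\<lambda>\<omega>. \<Prod>k\<in>{i, j}. Z k \<omega>) = (\<Prod>k\<in>{i, j}. expectation (Z k))"
      using ij by (intro indep_vars_lebesgue_integral indep_vars_subset[OF indep]) (auto intro: int1)
    then show ?thesis using False mean ij by simp
  qed (simp add: power2_eq_square)
  have "expectation (\<lambda>\<omega>. (\<Sum>i\<in>I. Z i \<omega>)\<^sup>2) = expectation (\<lambda>\<omega>. \<Sum>i\<in>I. \<Sum>j\<in>I. Z i \<omega> * Z j \<omega>)"
    by (simp add: power2_eq_square sum_product)
  also have "\<dots> = (\<Sum>i\<in>I. \<Sum>j\<in>I. expectation (\<lambda>\<omega>. Z i \<omega> * Z j \<omega>))"
    by (subst Bochner_Integration.integral_sum, auto intro!: Bochner_Integration.integrable_sum int2)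
      (intro sum.cong refl Bochner_Integration.integral_sum, auto intro!: int2)
  also have "\<dots> = (\<Sum>i\<in>I. expectation (\<lambda>\<omega>. (Z i \<omega>)\<^sup>2))"
    using I by (intro sum.cong refl) (simp add: prod)
  finally show ?thesis .
qed

lemma prob_abs_gt_le_second_moment:
  assumes [measurable]: "A \<in> borel_measurable M" and i: "integrable M (\<lambda>\<omega>. (A \<omega>)\<^sup>2)" and a: "0 < (a::real)"
  shows "prob {\<omega> \<in> space M. a < \<bar>A \<omega>\<bar>} \<le> expectation (\<lambda>\<omega>. (A \<omega>)\<^sup>2) / a\<^sup>2"
proof -
  have "prob {\<omega> \<in> space M. a < \<bar>A \<omega>\<bar>} \<le> prob {\<omega> \<in> space M. a\<^sup>2 \<le> (A \<omega>)\<^sup>2}"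
    using a by (intro finite_measure_mono) (auto simp: abs_le_square_iff[symmetric])
  also have "\<dots> \<le> expectation (\<lambda>\<omega>. (A \<omega>)\<^sup>2) / a\<^sup>2"
    using a by (intro integral_Markov_inequality_measure[OF i sets.empty_sets]) auto
  finally show ?thesis .
qed

end

section \<open>Empirical increments and the Bahadur representation\<close>

context iid_sample begin

lemma ecdf_measurable [measurable]: "(\<lambda>\<omega>. ecdf X n \<omega> x) \<in> borel_measurable M"
proof -
  have "(\<lambda>\<omega>. real (count n x \<omega>) / real n) \<in> borel_measurable M" by measurable
  then show ?thesis by (simp add: ecdf_def count_def)
qed

lemma ecdf_eq_sum: "ecdf X n \<omega> x = (\<Sum>i\<in>{1..n}. indicator {..x} (X i \<omega>)) / real n"
proof -
  have "(\<Sum>i\<in>{1..n}. indicator {..x} (X i \<omega>)) = (\<Sum>i\<in>{1..n}. if X i \<omega> \<le> x then 1 else (0::real))"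
    by (intro sum.cong) (auto simp: indicator_def)
  then show ?thesis unfolding ecdf_def by (simp add: sum.If_cases Int_def)
qed

lemma expectation_indicator_X:
  assumes "1 \<le> i"
  shows "expectation (\<lambda>\<omega>. indicator {..x} (X i \<omega>)) = F x"
proof -
  have "expectation (\<lambda>\<omega>. indicator {..x} (X i \<omega>)) = expectation (indicator {\<omega> \<in> space M. X i \<omega> \<le> x})"
    by (intro Bochner_Integration.integral_cong) (auto simp: indicator_def)
  also have "\<dots> = prob {\<omega> \<in> space M. X i \<omega> \<le> x}"
    using X_measurable[OF assms] by (simp add: Int_absorb2)
  finally show ?thesis using prob_X_le[OF assms] by simp
qed

lemma integrable_indicator_X:
  "1 \<le> i \<Longrightarrow> integrable M (\<lambda>\<omega>. indicator {..z} (X i \<omega>) :: real)"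
  using X_measurable by (intro integrable_const_bound[where B = 1]) auto

text \<open>A generic weight \<open>w\<close> covers the empirical distribution function and its
  increments in one computation; the variance of \<open>w (X i)\<close> is bounded by its second
  moment.\<close>

lemma empirical_mean_second_moment:
  fixes w :: "real \<Rightarrow> real"
  assumes n: "1 \<le> n" and w [measurable]: "w \<in> borel_measurable borel" and wb: "\<And>x. \<bar>w x\<bar> \<le> 1"
    and Ew: "\<And>i. 1 \<le> i \<Longrightarrow> expectation (\<lambda>\<omega>. w (X i \<omega>)) = a"
    and Ew2: "\<And>i. 1 \<le> i \<Longrightarrow> expectation (\<lambda>\<omega>. (w (X i \<omega>))\<^sup>2) \<le> b"
  shows "integrable M (\<lambda>\<omega>. (sqrt (real n) * ((\<Sum>i\<in>{1..n}. w (X i \<omega>)) / real n - a))\<^sup>2)"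
    and "expectation (\<lambda>\<omega>. (sqrt (real n) * ((\<Sum>i\<in>{1..n}. w (X i \<omega>)) / real n - a))\<^sup>2) \<le> b"
proof -
  define Z where "Z i \<omega> = w (X i \<omega>) - a" for i \<omega>
  have iw: "integrable M (\<lambda>\<omega>. w (X i \<omega>))" "integrable M (\<lambda>\<omega>. (w (X i \<omega>))\<^sup>2)" if "1 \<le> i" for i
    using X_measurable[OF that] wb
    by (auto intro!: integrable_const_bound[where B = 1] simp: power_abs abs_square_le_1)
  have ab: "\<bar>a\<bar> \<le> 1" unfolding Ew[OF order_refl, symmetric] by (intro abs_expectation_le wb) simp
  have Zb: "\<bar>Z i \<omega>\<bar> \<le> 2" for i \<omega>
    using wb[of "X i \<omega>"] ab unfolding Z_def by linarith
  have Zm [measurable]: "Z i \<in> borel_measurable M" if "1 \<le> i" for i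
    unfolding Z_def using X_measurable[OF that] by measurable
  have EZ: "expectation (Z i) = 0" if "1 \<le> i" for i
    unfolding Z_def using iw[OF that] Ew[OF that] by (simp add: prob_space)
  have EZ2: "expectation (\<lambda>\<omega>. (Z i \<omega>)\<^sup>2) \<le> b" if i: "1 \<le> i" for i
  proof -
    have "expectation (\<lambda>\<omega>. (Z i \<omega>)\<^sup>2) = expectation (\<lambda>\<omega>. (w (X i \<omega>))\<^sup>2) - (expectation (\<lambda>\<omega>. w (X i \<omega>)))\<^sup>2"
      unfolding Z_def Ew[OF i, symmetric] by (rule variance_eq[OF iw[OF i]])
    then show ?thesis using Ew2[OF i] zero_le_power2[of "expectation (\<lambda>\<omega>. w (X i \<omega>))"] by linarith
  qed
  have eq: "sqrt (real n) * ((\<Sum>i\<in>{1..n}. w (X i \<omega>)) / real n - a) = (\<Sum>i\<in>{1..n}. Z i \<omega>) / sqrt (real n)" for \<omega>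
  proof -
    have "(\<Sum>i\<in>{1..n}. Z i \<omega>) = real n * ((\<Sum>i\<in>{1..n}. w (X i \<omega>)) / real n - a)"
      using n by (simp add: Z_def sum_subtractf right_diff_distrib)
    then have "(\<Sum>i\<in>{1..n}. Z i \<omega>) / sqrt (real n) = (real n / sqrt (real n)) * ((\<Sum>i\<in>{1..n}. w (X i \<omega>)) / real n - a)"
      by simp
    then show ?thesis by (simp add: real_div_sqrt)
  qed
  have sb: "(\<Sum>i\<in>{1..n}. Z i \<omega>)\<^sup>2 \<le> (real n * 2)\<^sup>2" for \<omega>
  proof -
    have "\<bar>\<Sum>i\<in>{1..n}. Z i \<omega>\<bar> \<le> (\<Sum>i\<in>{1..n}. \<bar>Z i \<omega>\<bar>)" by (rule sum_abs)
    also have "\<dots> \<le> real (card {1..n}) * 2" by (intro sum_bounded_above Zb)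
    finally show ?thesis by (intro iffD1[OF abs_le_square_iff]) simp
  qed
  have sm: "(\<lambda>\<omega>. \<Sum>i\<in>{1..n}. Z i \<omega>) \<in> borel_measurable M" by (intro borel_measurable_sum Zm) auto
  show "integrable M (\<lambda>\<omega>. (sqrt (real n) * ((\<Sum>i\<in>{1..n}. w (X i \<omega>)) / real n - a))\<^sup>2)"
    unfolding eq power_divide
  proof (intro Bochner_Integration.integrable_divide integrable_const_bound[where B = "(real n * 2)\<^sup>2"] AE_I2)
    show "norm ((\<Sum>i\<in>{1..n}. Z i \<omega>)\<^sup>2) \<le> (real n * 2)\<^sup>2" for \<omega>
      using sb[of \<omega>] by (simp only: real_norm_def abs_power2)
  qed (use sm in measurable)
  have "indep_vars (\<lambda>_. borel) Z {1..n}"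
    unfolding Z_def by (rule indep_vars_compose2[OF indep_vars_subset[OF indep]]) auto
  then have "expectation (\<lambda>\<omega>. (\<Sum>i\<in>{1..n}. Z i \<omega>)\<^sup>2) = (\<Sum>i\<in>{1..n}. expectation (\<lambda>\<omega>. (Z i \<omega>)\<^sup>2))"
    by (intro second_moment_sum[where C = 2]) (auto simp: EZ Zb)
  also have "\<dots> \<le> (\<Sum>i\<in>{1..n}. b)" by (intro sum_mono EZ2) auto
  finally have "expectation (\<lambda>\<omega>. (\<Sum>i\<in>{1..n}. Z i \<omega>)\<^sup>2) \<le> real n * b" by simp
  then show "expectation (\<lambda>\<omega>. (sqrt (real n) * ((\<Sum>i\<in>{1..n}. w (X i \<omega>)) / real n - a))\<^sup>2) \<le> b"
    unfolding eq power_divide using n by (simp add: field_simps)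
qed

text \<open>Up to sign the weight is the indicator of the interval between \<open>x\<close> and
  \<open>y\<close>, so its square has expectation \<open>\<bar>F y - F x\<bar>\<close>. This
  smallness for close points is the stochastic equicontinuity behind the Bahadur
  representation.\<close>

lemma empirical_increment_second_moment:
  assumes n: "1 \<le> n"
  shows "integrable M (\<lambda>\<omega>. (sqrt (real n) * ((ecdf X n \<omega> y - ecdf X n \<omega> x) - (F y - F x)))\<^sup>2)"
    and "expectation (\<lambda>\<omega>. (sqrt (real n) * ((ecdf X n \<omega> y - ecdf X n \<omega> x) - (F y - F x)))\<^sup>2) \<le> \<bar>F y - F x\<bar>"
proof -
  let ?w = "\<lambda>z. indicator {..y} z - indicator {..x} z :: real"
  have eq: "ecdf X n \<omega> y - ecdf X n \<omega> x = (\<Sum>i\<in>{1..n}. ?w (X i \<omega>)) / real n" for \<omega>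
    by (simp add: ecdf_eq_sum sum_subtractf diff_divide_distrib)
  have wb: "\<bar>?w z\<bar> \<le> 1" for z by (auto simp: indicator_def)
  have Ew: "expectation (\<lambda>\<omega>. ?w (X i \<omega>)) = F y - F x" if "1 \<le> i" for i
    using that by (simp add: integrable_indicator_X expectation_indicator_X)
  have Ew2: "expectation (\<lambda>\<omega>. (?w (X i \<omega>))\<^sup>2) \<le> \<bar>F y - F x\<bar>" if i: "1 \<le> i" for i
  proof (cases "x \<le> y")
    case True
    then have "(\<lambda>\<omega>. (?w (X i \<omega>))\<^sup>2) = (\<lambda>\<omega>. ?w (X i \<omega>))" by (auto simp: indicator_def fun_eq_iff)
    then show ?thesis using Ew[OF i] by (simp only: abs_ge_self)
  next
    case False
    then have "(\<lambda>\<omega>. (?w (X i \<omega>))\<^sup>2) = (\<lambda>\<omega>. - ?w (X i \<omega>))" by (auto simp: indicator_def fun_eq_iff)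
    then have "expectation (\<lambda>\<omega>. (?w (X i \<omega>))\<^sup>2) = - expectation (\<lambda>\<omega>. ?w (X i \<omega>))" by (simp only: integral_minus)
    then show ?thesis using Ew[OF i] by (simp only: abs_ge_minus_self)
  qed
  note * = empirical_mean_second_moment[OF n _ wb Ew Ew2]
  show "integrable M (\<lambda>\<omega>. (sqrt (real n) * ((ecdf X n \<omega> y - ecdf X n \<omega> x) - (F y - F x)))\<^sup>2)"
    unfolding eq by (rule *(1)) auto
  show "expectation (\<lambda>\<omega>. (sqrt (real n) * ((ecdf X n \<omega> y - ecdf X n \<omega> x) - (F y - F x)))\<^sup>2) \<le> \<bar>F y - F x\<bar>"
    unfolding eq by (rule *(2)) auto
qed

lemma empirical_second_moment:
  assumes n: "1 \<le> n"
  shows "integrable M (\<lambda>\<omega>. (sqrt (real n) * (ecdf X n \<omega> x - F x))\<^sup>2)"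
    and "expectation (\<lambda>\<omega>. (sqrt (real n) * (ecdf X n \<omega> x - F x))\<^sup>2) \<le> 1"
proof -
  have wb: "\<bar>indicator {..x} z :: real\<bar> \<le> 1" for z by (auto simp: indicator_def)
  have Ew2: "expectation (\<lambda>\<omega>. (indicator {..x} (X i \<omega>) :: real)\<^sup>2) \<le> 1" if i: "1 \<le> i" for i
  proof -
    have "(\<lambda>\<omega>. (indicator {..x} (X i \<omega>) :: real)\<^sup>2) = (\<lambda>\<omega>. indicator {..x} (X i \<omega>))"
      by (auto simp: indicator_def fun_eq_iff)
    then show ?thesis using expectation_indicator_X[OF i, of x] F_bounds(2)[of x] by (simp only:)
  qed
  note * = empirical_mean_second_moment[OF n _ wb expectation_indicator_X Ew2]
  show "integrable M (\<lambda>\<omega>. (sqrt (real n) * (ecdf X n \<omega> x - F x))\<^sup>2)"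
    unfolding ecdf_eq_sum by (rule *(1)) auto
  show "expectation (\<lambda>\<omega>. (sqrt (real n) * (ecdf X n \<omega> x - F x))\<^sup>2) \<le> 1"
    unfolding ecdf_eq_sum by (rule *(2)) auto
qed

text \<open>The Bahadur representation in probability, by Ghosh's argument: the event
  \<open>T \<le> t\<close> for the normalized quantile \<open>T\<close> is the event \<open>R \<le> t + o(1)\<close> for the linear
  statistic \<open>R\<close>, and comparing on a finite grid of \<open>t\<close> suffices as \<open>R\<close> is tight.\<close>

lemma bahadur:
  assumes u: "0 < u" "u < 1" and q: "F q = u" and d: "(F has_real_derivative d) (at q)" "0 < d"
  shows "null_in_prob (\<lambda>n \<omega>. sqrt (real n) * (quantile (ecdf X n \<omega>) u - q) - sqrt (real n) * (u - ecdf X n \<omega> q) / d)"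
proof -
  define T where "T n \<omega> = sqrt (real n) * (quantile (ecdf X n \<omega>) u - q)" for n \<omega>
  define R where "R n \<omega> = sqrt (real n) * (u - ecdf X n \<omega> q) / d" for n \<omega>
  have "null_in_prob (\<lambda>n \<omega>. T n \<omega> - R n \<omega>)"
    unfolding null_in_prob_def
  proof (intro conjI allI impI)
  have meas: "(\<lambda>\<omega>. T n \<omega> - R n \<omega>) \<in> borel_measurable M" for n
  proof (cases "1 \<le> n")
    case True
    have [measurable]: "(\<lambda>\<omega>. quantile (ecdf X n \<omega>) u) \<in> borel_measurable M"
      using True u by (intro sample_quantile_measurable1) auto
    show ?thesis unfolding T_def R_def by measurable
  next
    case False
    then have "n = 0" by simp
    then show ?thesis by (simp add: T_def R_def)
  qed
  then show "(\<lambda>\<omega>. T n \<omega> - R n \<omega>) \<in> borel_measurable M" for n .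
  have Tm [measurable]: "T n \<in> borel_measurable M" if "1 \<le> n" for n
    unfolding T_def using sample_quantile_measurable1[OF that, of u] u
    by (intro borel_measurable_times borel_measurable_diff borel_measurable_const) auto
  have Rm [measurable]: "R n \<in> borel_measurable M" for n unfolding R_def by measurable
  fix e :: real assume e: "e > 0"
  define \<delta> where "\<delta> = e / 3"
  have \<delta>: "\<delta> > 0" using e by (simp add: \<delta>_def)
  define x where "x n t = q + t / sqrt (real n)" for n t
  define A where "A n t \<omega> = sqrt (real n) * ((ecdf X n \<omega> (x n t) - ecdf X n \<omega> q) - (F (x n t) - F q))" for n t \<omega>
  define a where "a n t = sqrt (real n) * (F (x n t) - F q)" for n t
  have A [measurable]: "A n t \<in> borel_measurable M" for n t unfolding A_def by measurable
  \<comment> \<open>The Galois connection at \<open>x n t\<close>. The empirical value there is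
    split into the linear statistic \<open>R\<close>, the increment \<open>A\<close>, which is
    negligible in probability, and the drift \<open>a\<close>, which tends to
    \<open>d * t\<close>.\<close>
  have T_iff: "T n \<omega> \<le> t \<longleftrightarrow> d * R n \<omega> \<le> A n t \<omega> + a n t" if n: "1 \<le> n" for n t \<omega>
  proof -
    have sn: "0 < sqrt (real n)" using n by simp
    have "T n \<omega> \<le> t \<longleftrightarrow> quantile (ecdf X n \<omega>) u \<le> x n t"
    proof -
      have "T n \<omega> \<le> t \<longleftrightarrow> quantile (ecdf X n \<omega>) u - q \<le> t / sqrt (real n)"
        unfolding T_def using sn by (simp add: pos_le_divide_eq mult.commute)
      then show ?thesis unfolding x_def by linarith
    qed
    also have "\<dots> \<longleftrightarrow> u \<le> ecdf X n \<omega> (x n t)" by (rule sample_quantile_le_iff[OF n u])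
    also have "\<dots> \<longleftrightarrow> 0 \<le> sqrt (real n) * (ecdf X n \<omega> (x n t) - u)" using sn by (simp add: zero_le_mult_iff)
    also have "sqrt (real n) * (ecdf X n \<omega> (x n t) - u) = A n t \<omega> + a n t - d * R n \<omega>"
      proof -
      have "d * R n \<omega> = sqrt (real n) * (u - ecdf X n \<omega> q)" using d(2) by (simp add: R_def)
      then show ?thesis by (simp add: A_def a_def q algebra_simps)
    qed
    finally show ?thesis by simp
  qed
  have rt: "(\<lambda>n. t / sqrt (real n)) \<longlonglongrightarrow> 0" for t :: real
    by (intro tendsto_divide_0[OF tendsto_const] filterlim_at_top_imp_at_infinity
        filterlim_compose[OF sqrt_at_top] filterlim_real_sequentially)
  have x_lim: "(\<lambda>n. x n t) \<longlonglongrightarrow> q" for t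
    using tendsto_add[OF tendsto_const[of q] rt[of t]] by (simp add: x_def)
  have F_lim: "(\<lambda>n. F (x n t)) \<longlonglongrightarrow> F q" for t
    using isCont_tendsto_compose[OF DERIV_isCont[OF d(1)] x_lim] .
  have a_lim: "(\<lambda>n. a n t) \<longlonglongrightarrow> d * t" for t
  proof (cases "t = 0")
    case False
    have "filterlim (\<lambda>n. t / sqrt (real n)) (at 0) sequentially"
      unfolding filterlim_at using rt[of t] False
      by (auto intro!: eventually_mono[OF eventually_gt_at_top[of 0]])
    moreover have "((\<lambda>h. (F (q + h) - F q) / h) \<longlongrightarrow> d) (at 0)" using d(1) by (simp add: DERIV_def)
    ultimately have "(\<lambda>n. (F (q + t / sqrt (real n)) - F q) / (t / sqrt (real n))) \<longlonglongrightarrow> d"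
      by (rule filterlim_compose[rotated])
    then have "(\<lambda>n. (F (q + t / sqrt (real n)) - F q) / (t / sqrt (real n)) * t) \<longlonglongrightarrow> d * t"
      by (intro tendsto_mult tendsto_const)
    then show ?thesis using False by (simp add: a_def x_def mult.commute)
  qed (simp add: a_def x_def)
  have A_lim: "(\<lambda>n. prob {\<omega> \<in> space M. \<eta> < \<bar>A n t \<omega>\<bar>}) \<longlonglongrightarrow> 0" if \<eta>: "0 < \<eta>" for t \<eta>
  proof (rule Lim_null_comparison)
    show "eventually (\<lambda>n. norm (prob {\<omega> \<in> space M. \<eta> < \<bar>A n t \<omega>\<bar>}) \<le> \<bar>F (x n t) - F q\<bar> / \<eta>\<^sup>2) sequentially"
      using eventually_ge_at_top[of 1]
    proof eventually_elim
      case (elim n)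
      have "prob {\<omega> \<in> space M. \<eta> < \<bar>A n t \<omega>\<bar>} \<le> expectation (\<lambda>\<omega>. (A n t \<omega>)\<^sup>2) / \<eta>\<^sup>2"
        using empirical_increment_second_moment(1)[OF elim, of "x n t" q] \<eta> unfolding A_def[symmetric]
        by (intro prob_abs_gt_le_second_moment) auto
      also have "\<dots> \<le> \<bar>F (x n t) - F q\<bar> / \<eta>\<^sup>2"
        using empirical_increment_second_moment(2)[OF elim, of "x n t" q] unfolding A_def[symmetric] by (intro divide_right_mono) auto
      finally show ?case by simp
    qed
    have "(\<lambda>n. \<bar>F (x n t) - F q\<bar> / \<eta>\<^sup>2) \<longlonglongrightarrow> \<bar>F q - F q\<bar> / \<eta>\<^sup>2"
      by (intro tendsto_intros F_lim) (use \<eta> in simp)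
    then show "(\<lambda>n. \<bar>F (x n t) - F q\<bar> / \<eta>\<^sup>2) \<longlonglongrightarrow> 0" by simp
  qed
  have R_tail: "prob {\<omega> \<in> space M. K < \<bar>R n \<omega>\<bar>} \<le> 1 / (d * K)\<^sup>2" if n: "1 \<le> n" and K: "0 < K" for n K
  proof -
    have "{\<omega> \<in> space M. K < \<bar>R n \<omega>\<bar>} = {\<omega> \<in> space M. d * K < \<bar>sqrt (real n) * (ecdf X n \<omega> q - F q)\<bar>}"
      using d(2) by (auto simp: R_def q abs_mult abs_minus_commute field_simps)
    then have "prob {\<omega> \<in> space M. K < \<bar>R n \<omega>\<bar>} \<le> expectation (\<lambda>\<omega>. (sqrt (real n) * (ecdf X n \<omega> q - F q))\<^sup>2) / (d * K)\<^sup>2"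
      using empirical_second_moment(1)[OF n] d(2) K by (simp only:) (intro prob_abs_gt_le_second_moment, auto)
    also have "\<dots> \<le> 1 / (d * K)\<^sup>2"
      using empirical_second_moment(2)[OF n] by (intro divide_right_mono) auto
    finally show ?thesis .
  qed
  show "(\<lambda>n. prob {\<omega> \<in> space M. e < \<bar>T n \<omega> - R n \<omega>\<bar>}) \<longlonglongrightarrow> 0"
  proof (rule LIMSEQ_I)
    fix \<eta> :: real assume \<eta>: "0 < \<eta>"
    \<comment> \<open>Chebyshev's inequality then gives \<open>\<eta> / 4\<close> for the tail of
      \<open>R\<close>; the exceptional events at the grid points take less than
      \<open>\<eta> / 2\<close>.\<close>
    define K where "K = 1 / d * (2 / sqrt \<eta>)"
    have K: "0 < K" using \<eta> d(2) by (simp add: K_def)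
    have K2: "1 / (d * K)\<^sup>2 = \<eta> / 4" using \<eta> d(2) by (simp add: K_def power_divide)
    define J where "J = nat \<lceil>(2 * K + 8 * \<delta>) / \<delta>\<rceil>"
    \<comment> \<open>A grid of mesh \<open>\<delta>\<close> from \<open>- K - 3 * \<delta>\<close>
      to at least \<open>K + 5 * \<delta>\<close>: the margins keep the points two steps away from
      the cell of any \<open>r\<close> in \<open>[-K,K]\<close> on the grid.\<close>
    define g where "g j = - K - 3 * \<delta> + real j * \<delta>" for j
    have "eventually (\<lambda>n. \<forall>j\<in>{..J}. \<bar>a n (g j) - d * g j\<bar> < d * \<delta> / 2) sequentially"
    proof (intro eventually_ball_finite ballI)
      fix j
      show "eventually (\<lambda>n. \<bar>a n (g j) - d * g j\<bar> < d * \<delta> / 2) sequentially"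
        using tendstoD[OF a_lim, of "d * \<delta> / 2" "g j"] d(2) \<delta> by (simp add: dist_real_def)
    qed simp
    moreover have "(\<lambda>n. \<Sum>j\<in>{..J}. prob {\<omega> \<in> space M. d * \<delta> / 2 < \<bar>A n (g j) \<omega>\<bar>}) \<longlonglongrightarrow> (\<Sum>j\<in>{..J}. 0)"
      using d(2) \<delta> by (intro tendsto_sum A_lim) auto
    then have "eventually (\<lambda>n. (\<Sum>j\<in>{..J}. prob {\<omega> \<in> space M. d * \<delta> / 2 < \<bar>A n (g j) \<omega>\<bar>}) < \<eta> / 2) sequentially"
      by (rule order_tendstoD) (use \<eta> in simp)
    ultimately have "eventually (\<lambda>n. prob {\<omega> \<in> space M. e < \<bar>T n \<omega> - R n \<omega>\<bar>} < \<eta>) sequentially"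
      using eventually_ge_at_top[of 1]
    proof eventually_elim
      case (elim n)
      note n = elim(3)
      let ?B = "\<lambda>j. {\<omega> \<in> space M. d * \<delta> / 2 < \<bar>A n (g j) \<omega>\<bar>}"
      have incl: "{\<omega> \<in> space M. e < \<bar>T n \<omega> - R n \<omega>\<bar>} \<subseteq> {\<omega> \<in> space M. K < \<bar>R n \<omega>\<bar>} \<union> (\<Union>j\<in>{..J}. ?B j)"
      proof (rule ccontr)
        assume nincl: "\<not> ?thesis"
        then obtain \<omega> where \<omega>: "e < \<bar>T n \<omega> - R n \<omega>\<bar>" "\<bar>R n \<omega>\<bar> \<le> K" "\<And>j. j \<le> J \<Longrightarrow> \<bar>A n (g j) \<omega>\<bar> \<le> d * \<delta> / 2"
        proof -
          from nincl obtain \<omega> where "\<omega> \<in> space M" "e < \<bar>T n \<omega> - R n \<omega>\<bar>" "\<not> K < \<bar>R n \<omega>\<bar>"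
            "\<And>j. j \<in> {..J} \<Longrightarrow> \<not> d * \<delta> / 2 < \<bar>A n (g j) \<omega>\<bar>" by blast
          then show thesis by (intro that[of \<omega>]) (simp_all only: not_less atMost_iff)
        qed
        define r where "r = R n \<omega>"
        have close: "\<bar>A n (g j) \<omega> + a n (g j) - d * g j\<bar> \<le> d * \<delta>" if "j \<le> J" for j
          proof -
          have "\<bar>a n (g j) - d * g j\<bar> < d * \<delta> / 2" using elim(1) that by simp
          then show ?thesis using \<omega>(3)[OF that] by linarith
        qed
        have le: "T n \<omega> \<le> g j \<Longrightarrow> r \<le> g j + \<delta>" and gt: "g j < T n \<omega> \<Longrightarrow> g j - \<delta> < r" if j: "j \<le> J" for j
        proof -
          assume "T n \<omega> \<le> g j"
          then have "d * r \<le> d * (g j + \<delta>)" using T_iff[OF n, of \<omega> "g j"] close[OF j] unfolding r_def distrib_left by linarith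
          then show "r \<le> g j + \<delta>" using d(2) by (simp only: mult_le_cancel_left_pos)
        next
          assume "g j < T n \<omega>"
          then have "d * (g j - \<delta>) < d * r"
            using T_iff[OF n, of \<omega> "g j"] close[OF j] unfolding r_def right_diff_distrib by linarith
          then show "g j - \<delta> < r" using d(2) by (simp only: mult_less_cancel_left_pos)
        qed
        \<comment> \<open>\<open>g j\<close> is the grid point just below \<open>r\<close>. Each
          comparison at a grid point is off by at most \<open>\<delta>\<close>, so two steps up and
          down are enough to trap \<open>T n \<omega>\<close>, within
          \<open>3 * \<delta> = e\<close> of \<open>r\<close>.\<close>
        define j where "j = nat \<lfloor>(r + K + 3 * \<delta>) / \<delta>\<rfloor>"
        have rK: "- K \<le> r" "r \<le> K" using \<omega>(2) unfolding r_def by linarith+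
        have p3: "3 \<le> (r + K + 3 * \<delta>) / \<delta>" using rK \<delta> by (simp add: le_divide_eq)
        have j1: "real j \<le> (r + K + 3 * \<delta>) / \<delta>" unfolding j_def using p3 by (intro of_nat_floor) linarith
        have j2: "(r + K + 3 * \<delta>) / \<delta> < real j + 1" unfolding j_def using p3 by linarith
        have j3: "3 \<le> j" unfolding j_def using p3 by (simp add: le_nat_iff le_floor_iff)
        have "real j * \<delta> \<le> r + K + 3 * \<delta>" using j1 \<delta> by (simp add: le_divide_eq)
        then have gj: "g j \<le> r" by (simp add: g_def)
        have "r + K + 3 * \<delta> < (real j + 1) * \<delta>" using j2 \<delta> by (simp add: divide_less_eq)
        then have gj1: "r < g j + \<delta>" by (simp add: g_def distrib_right)
        have gadd: "g (j + 2) = g j + 2 * \<delta>" by (simp add: g_def distrib_right)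
        have gsub: "g (j - 2) = g j - 2 * \<delta>" using j3 by (simp add: g_def of_nat_diff left_diff_distrib)
        have jJ: "j + 2 \<le> J"
        proof -
          have "real j + 2 \<le> (r + K + 3 * \<delta>) / \<delta> + 2" using j1 by simp
          also have "\<dots> = (r + K + 5 * \<delta>) / \<delta>" using \<delta> by (simp add: add_divide_distrib)
          also have "\<dots> \<le> (2 * K + 8 * \<delta>) / \<delta>" using rK \<delta> by (intro divide_right_mono) auto
          also have "\<dots> \<le> real J" unfolding J_def by (rule real_nat_ceiling_ge)
          finally show ?thesis by linarith
        qed
        have "T n \<omega> \<le> g (j + 2)"
        proof (rule ccontr)
          assume "\<not> T n \<omega> \<le> g (j + 2)"
          then have "g (j + 2) - \<delta> < r" using gt[OF jJ] by linarith
          then show False using gadd gj1 by linarith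
        qed
        moreover have "g (j - 2) < T n \<omega>"
        proof (rule ccontr)
          assume "\<not> g (j - 2) < T n \<omega>"
          then have "r \<le> g (j - 2) + \<delta>" using le[of "j - 2"] jJ by linarith
          then show False using gsub gj \<delta> by linarith
        qed
        ultimately have "\<bar>T n \<omega> - r\<bar> \<le> 3 * \<delta>" using gadd gsub gj gj1 \<delta> by linarith
        then show False using \<omega>(1) by (simp add: \<delta>_def r_def)
      qed
      have "prob {\<omega> \<in> space M. e < \<bar>T n \<omega> - R n \<omega>\<bar>} \<le> prob ({\<omega> \<in> space M. K < \<bar>R n \<omega>\<bar>} \<union> (\<Union>j\<in>{..J}. ?B j))"
        using incl by (rule finite_measure_mono) measurable
      also have "\<dots> \<le> prob {\<omega> \<in> space M. K < \<bar>R n \<omega>\<bar>} + prob (\<Union>j\<in>{..J}. ?B j)"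
        by (rule measure_Un_le) measurable
      also have "prob (\<Union>j\<in>{..J}. ?B j) \<le> (\<Sum>j\<in>{..J}. prob (?B j))"
        by (rule measure_UNION_le) auto
      also have "prob {\<omega> \<in> space M. K < \<bar>R n \<omega>\<bar>} \<le> \<eta> / 4" using R_tail[OF n K] K2 by simp
      finally show ?case using elim(2) \<eta> by simp
    qed
    then show "\<exists>no. \<forall>n\<ge>no. norm (prob {\<omega> \<in> space M. e < \<bar>T n \<omega> - R n \<omega>\<bar>} - 0) < \<eta>"
      by (auto simp: eventually_sequentially)
  qed
  qed
  then show ?thesis unfolding T_def R_def .
qed

end


section \<open>Paired samples and the joint central limit theorem\<close>

locale iid_pairs = prob_space M for M :: "'a measure" +
  fixes X Y :: "nat \<Rightarrow> 'a \<Rightarrow> real" and F :: "real \<Rightarrow> real" and H :: "real \<Rightarrow> real \<Rightarrow> real"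
  assumes pindep: "indep_vars (\<lambda>_. borel) (\<lambda>i \<omega>. (X i \<omega>, Y i \<omega>)) {1..}"
    and pident: "\<And>i. i \<ge> 1 \<Longrightarrow>
      distr M borel (\<lambda>\<omega>. (X i \<omega>, Y i \<omega>)) = distr M borel (\<lambda>\<omega>. (X 1 \<omega>, Y 1 \<omega>))"
    and FX: "F = cdf (distr M borel (X 1))" and FY: "F = cdf (distr M borel (Y 1))"
    and H: "\<And>x y. H x y = prob {\<omega> \<in> space M. X 1 \<omega> \<le> x \<and> Y 1 \<omega> \<le> y}"
begin

lemma pair_measurable: "i \<ge> 1 \<Longrightarrow> (\<lambda>\<omega>. (X i \<omega>, Y i \<omega>)) \<in> borel_measurable M"
  using pindep by (auto simp: indep_vars_def)

lemma pair_compose: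
  fixes g :: "real \<times> real \<Rightarrow> real"
  assumes g [measurable]: "g \<in> borel_measurable borel"
  shows "indep_vars (\<lambda>_. borel) (\<lambda>i \<omega>. g (X i \<omega>, Y i \<omega>)) {1..}"
    and "i \<ge> 1 \<Longrightarrow> distr M borel (\<lambda>\<omega>. g (X i \<omega>, Y i \<omega>)) = distr M borel (\<lambda>\<omega>. g (X 1 \<omega>, Y 1 \<omega>))"
proof -
  show "indep_vars (\<lambda>_. borel) (\<lambda>i \<omega>. g (X i \<omega>, Y i \<omega>)) {1..}"
    by (rule indep_vars_compose2[OF pindep]) (rule g)
  have d: "distr M borel (\<lambda>\<omega>. g (X i \<omega>, Y i \<omega>)) = distr (distr M borel (\<lambda>\<omega>. (X i \<omega>, Y i \<omega>))) borel g"
    if "i \<ge> 1" for i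
    using pair_measurable[OF that] by (subst distr_distr) (auto simp: comp_def)
  show "i \<ge> 1 \<Longrightarrow> distr M borel (\<lambda>\<omega>. g (X i \<omega>, Y i \<omega>)) = distr M borel (\<lambda>\<omega>. g (X 1 \<omega>, Y 1 \<omega>))"
    using d[of i] d[of 1] pident[of i] by simp
qed

sublocale X: iid_sample M X F
proof
  have f: "(fst :: real \<times> real \<Rightarrow> real) \<in> borel_measurable borel"
    by (intro borel_measurable_continuous_onI continuous_intros)
  show "indep_vars (\<lambda>_. borel) X {1..}" using pair_compose(1)[OF f] by simp
  show "i \<ge> 1 \<Longrightarrow> distr M borel (X i) = distr M borel (X 1)" for i using pair_compose(2)[OF f, of i] by simp
qed (rule FX)

sublocale Y: iid_sample M Y F
proof
  have f: "(snd :: real \<times> real \<Rightarrow> real) \<in> borel_measurable borel"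
    by (intro borel_measurable_continuous_onI continuous_intros)
  show "indep_vars (\<lambda>_. borel) Y {1..}" using pair_compose(1)[OF f] by simp
  show "i \<ge> 1 \<Longrightarrow> distr M borel (Y i) = distr M borel (Y 1)" for i using pair_compose(2)[OF f, of i] by simp
qed (rule FY)

lemma expectation_indicators:
  "expectation (\<lambda>\<omega>. indicator {..x} (X 1 \<omega>) * indicator {..y} (X 1 \<omega>)) = F (min x y)"
  "expectation (\<lambda>\<omega>. indicator {..x} (Y 1 \<omega>) * indicator {..y} (Y 1 \<omega>)) = F (min x y)"
  "expectation (\<lambda>\<omega>. indicator {..x} (X 1 \<omega>) * indicator {..y} (Y 1 \<omega>)) = H x y"
proof -
  have i: "(\<lambda>\<omega>. indicator {..x} (Z \<omega>) * indicator {..y} (Z \<omega>)) = (\<lambda>\<omega>. indicator {..min x y} (Z \<omega>) :: real)"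
    for Z :: "'a \<Rightarrow> real"
    by (auto simp: indicator_def fun_eq_iff)
  show "expectation (\<lambda>\<omega>. indicator {..x} (X 1 \<omega>) * indicator {..y} (X 1 \<omega>)) = F (min x y)"
    "expectation (\<lambda>\<omega>. indicator {..x} (Y 1 \<omega>) * indicator {..y} (Y 1 \<omega>)) = F (min x y)"
    unfolding i by (simp_all only: X.expectation_indicator_X Y.expectation_indicator_X order_refl)
  have [measurable]: "X 1 \<in> borel_measurable M" "Y 1 \<in> borel_measurable M"
    using X.X_measurable[of 1] Y.X_measurable[of 1] by auto
  have "expectation (\<lambda>\<omega>. indicator {..x} (X 1 \<omega>) * indicator {..y} (Y 1 \<omega>)) =
    expectation (indicator {\<omega> \<in> space M. X 1 \<omega> \<le> x \<and> Y 1 \<omega> \<le> y} :: 'a \<Rightarrow> real)"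
    by (intro Bochner_Integration.integral_cong) (auto simp: indicator_def)
  also have "\<dots> = H x y" unfolding H by (simp add: Int_absorb2)
  finally show "expectation (\<lambda>\<omega>. indicator {..x} (X 1 \<omega>) * indicator {..y} (Y 1 \<omega>)) = H x y" .
qed

text \<open>At \<open>u = F x\<close> and \<open>v = F y\<close> with \<open>F\<close> invertible,
  this is the covariance of the difference of the two bridges, whose terms \<open>u * v\<close>
  cancel. \<open>Y\<close> comes first because quantiles move against empirical distribution
  functions.\<close>

lemma expectation_increment_product:
  "expectation (\<lambda>\<omega>. (indicator {..x} (Y 1 \<omega>) - indicator {..x} (X 1 \<omega>)) * (indicator {..y} (Y 1 \<omega>) - indicator {..y} (X 1 \<omega>)))
    = 2 * F (min x y) - H x y - H y x"
proof -
  have [measurable]: "X 1 \<in> borel_measurable M" "Y 1 \<in> borel_measurable M"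
    using X.X_measurable[of 1] Y.X_measurable[of 1] by auto
  have b: "integrable M (\<lambda>\<omega>. indicator {..a} (f \<omega>) * indicator {..b} (g \<omega>) :: real)"
    if [measurable]: "f \<in> borel_measurable M" "g \<in> borel_measurable M" for a b :: real and f g
    by (intro integrable_const_bound[where B = 1]) (auto simp: indicator_def)
  have "expectation (\<lambda>\<omega>. (indicator {..x} (Y 1 \<omega>) - indicator {..x} (X 1 \<omega>)) * (indicator {..y} (Y 1 \<omega>) - indicator {..y} (X 1 \<omega>)) :: real)
    = expectation (\<lambda>\<omega>. (indicator {..x} (Y 1 \<omega>) * indicator {..y} (Y 1 \<omega>) + indicator {..x} (X 1 \<omega>) * indicator {..y} (X 1 \<omega>))
       - (indicator {..x} (X 1 \<omega>) * indicator {..y} (Y 1 \<omega>) + indicator {..y} (X 1 \<omega>) * indicator {..x} (Y 1 \<omega>)) :: real)"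
    by (intro Bochner_Integration.integral_cong) (auto simp: algebra_simps)
  also have "\<dots> = 2 * F (min x y) - H x y - H y x"
    by (subst Bochner_Integration.integral_diff Bochner_Integration.integral_add, (intro b Bochner_Integration.integrable_add; simp)+)+
      (simp only: expectation_indicators mult_2 diff_diff_add)
  finally show ?thesis .
qed

definition quantile_diff :: "nat \<Rightarrow> real \<Rightarrow> 'a \<Rightarrow> real" where
  "quantile_diff n u \<omega> = sqrt (real n) * (quantile (ecdf X n \<omega>) u - quantile (ecdf Y n \<omega>) u)"

lemma quantile_diff_measurable: "(\<lambda>(\<omega>, u). quantile_diff n u \<omega>) \<in> borel_measurable (M \<Otimes>\<^sub>M unif01)"
proof (cases "1 \<le> n")
  case True
  note [measurable] = sample_quantile_measurable[OF X.X_measurable True] sample_quantile_measurable[OF Y.X_measurable True]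
  show ?thesis unfolding quantile_diff_def[abs_def] split_beta' using X.X_measurable Y.X_measurable
      sample_quantile_measurable[OF X.X_measurable True] sample_quantile_measurable[OF Y.X_measurable True]
    by (intro borel_measurable_times borel_measurable_diff) (auto simp: split_beta')
next
  case False
  then have "n = 0" by simp
  then show ?thesis by (simp add: quantile_diff_def split_beta')
qed

text \<open>The Bahadur representation applied to both samples reduces a linear combination of
  quantile differences, up to a null term, to a normalized sum of bounded i.i.d. variables
  \<open>g (X i, Y i)\<close>. So the one-dimensional limit theorem suffices, and the double sum is
  the second moment of \<open>g\<close>.\<close>

lemma quantile_diff_iexp_tendsto:
  fixes t u q d :: "nat \<Rightarrow> real" and k :: nat
  assumes u: "\<And>l. l < k \<Longrightarrow> u l \<in> {0<..<1}" and q: "\<And>l. l < k \<Longrightarrow> F (q l) = u l"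
    and d: "\<And>l. l < k \<Longrightarrow> (F has_real_derivative d l) (at (q l))" "\<And>l. l < k \<Longrightarrow> 0 < d l"
  shows "(\<lambda>n. \<integral>\<omega>. iexp (\<Sum>l<k. t l * quantile_diff n (u l) \<omega>) \<partial>M) \<longlonglongrightarrow>
    complex_of_real (exp (- (\<Sum>l<k. \<Sum>m<k. (t l / d l) * (t m / d m) *
      (2 * F (min (q l) (q m)) - H (q l) (q m) - H (q m) (q l))) / 2))"
proof -
  define S where "S n \<omega> = (\<Sum>l<k. t l * (sqrt (real n) * (ecdf Y n \<omega> (q l) - ecdf X n \<omega> (q l)) / d l))" for n \<omega>
  define g :: "real \<times> real \<Rightarrow> real" where "g z = (\<Sum>l<k. (t l / d l) * (indicator {..q l} (snd z) - indicator {..q l} (fst z)))" for z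
  define C where "C = (\<Sum>l<k. \<bar>t l / d l\<bar>)"
  have gm: "g \<in> borel_measurable borel"
  proof -
    have [measurable]: "(fst :: real \<times> real \<Rightarrow> real) \<in> borel_measurable borel" "(snd :: real \<times> real \<Rightarrow> real) \<in> borel_measurable borel"
      by (intro borel_measurable_continuous_onI continuous_intros)+
    show ?thesis unfolding g_def by measurable
  qed
  have gC: "\<bar>g z\<bar> \<le> C" for z
    unfolding g_def C_def
    by (rule order_trans[OF sum_abs]) (auto intro!: sum_mono simp: abs_mult indicator_def)
  have ii: "integrable M (\<lambda>\<omega>. indicator {..z} (Y 1 \<omega>) - indicator {..z} (X 1 \<omega>) :: real)" for z
    by (intro Bochner_Integration.integrable_diff X.integrable_indicator_X Y.integrable_indicator_X) auto
  have Eg: "expectation (\<lambda>\<omega>. g (X 1 \<omega>, Y 1 \<omega>)) = 0"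
    unfolding g_def using X.integrable_indicator_X[of 1] Y.integrable_indicator_X[of 1]
    by (subst Bochner_Integration.integral_sum)
      (auto intro!: integrable_mult_right ii simp: X.expectation_indicator_X[of 1, simplified] Y.expectation_indicator_X[of 1, simplified])
  have Eg2: "expectation (\<lambda>\<omega>. (g (X 1 \<omega>, Y 1 \<omega>))\<^sup>2) = (\<Sum>l<k. \<Sum>m<k. (t l / d l) * (t m / d m) *
      (2 * F (min (q l) (q m)) - H (q l) (q m) - H (q m) (q l)))"
  proof -
    let ?w = "\<lambda>l \<omega>. indicator {..q l} (Y 1 \<omega>) - indicator {..q l} (X 1 \<omega>) :: real"
    have [measurable]: "X 1 \<in> borel_measurable M" "Y 1 \<in> borel_measurable M"
      using X.X_measurable[of 1] Y.X_measurable[of 1] by auto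
    have iw: "integrable M (\<lambda>\<omega>. ?w l \<omega> * ?w m \<omega>)" for l m
      by (intro integrable_const_bound[where B = 1]) (auto simp: indicator_def)
    have "expectation (\<lambda>\<omega>. (g (X 1 \<omega>, Y 1 \<omega>))\<^sup>2) = expectation (\<lambda>\<omega>. \<Sum>l<k. \<Sum>m<k. ((t l / d l) * (t m / d m)) * (?w l \<omega> * ?w m \<omega>))"
      unfolding g_def power2_eq_square sum_product by (simp add: mult_ac)
    also have "\<dots> = (\<Sum>l<k. \<Sum>m<k. ((t l / d l) * (t m / d m)) * expectation (\<lambda>\<omega>. ?w l \<omega> * ?w m \<omega>))"
      by (subst Bochner_Integration.integral_sum, intro Bochner_Integration.integrable_sum integrable_mult_right iw,
          intro sum.cong refl, subst Bochner_Integration.integral_sum, intro integrable_mult_right iw) simp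
    finally show ?thesis unfolding expectation_increment_product .
  qed
  have S_eq: "S n \<omega> = (\<Sum>i\<in>{1..n}. g (X i \<omega>, Y i \<omega>)) / sqrt (real n)" for n \<omega>
  proof -
    have "(\<Sum>i\<in>{1..n}. g (X i \<omega>, Y i \<omega>)) = (\<Sum>l<k. (t l / d l) * (\<Sum>i\<in>{1..n}. indicator {..q l} (Y i \<omega>) - indicator {..q l} (X i \<omega>)))"
      unfolding g_def by (subst sum.swap) (simp add: sum_distrib_left)
    then have "(\<Sum>i\<in>{1..n}. g (X i \<omega>, Y i \<omega>)) / sqrt (real n) =
      (\<Sum>l<k. (t l / d l) * (\<Sum>i\<in>{1..n}. indicator {..q l} (Y i \<omega>) - indicator {..q l} (X i \<omega>)) / sqrt (real n))"
      by (simp add: sum_divide_distrib)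
    also have "\<dots> = S n \<omega>"
      unfolding S_def X.ecdf_eq_sum Y.ecdf_eq_sum diff_divide_distrib[symmetric] sum_subtractf
    proof (intro sum.cong refl)
      fix l
      have "sqrt (real n) * (z / real n) = z / sqrt (real n)" for z
        by (cases "n = 0") (simp_all add: field_simps)
      then show "(t l / d l) * ((\<Sum>i\<in>{1..n}. indicator {..q l} (Y i \<omega>)) - (\<Sum>i\<in>{1..n}. indicator {..q l} (X i \<omega>))) / sqrt (real n) =
         t l * (sqrt (real n) * (((\<Sum>i\<in>{1..n}. indicator {..q l} (Y i \<omega>)) - (\<Sum>i\<in>{1..n}. indicator {..q l} (X i \<omega>))) / real n) / d l)"
        by simp
    qed
    finally show ?thesis by simp
  qed
  have lim: "(\<lambda>n. \<integral>\<omega>. iexp (S n \<omega>) \<partial>M) \<longlonglongrightarrow>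
     complex_of_real (exp (- expectation (\<lambda>\<omega>. (g (X 1 \<omega>, Y 1 \<omega>))\<^sup>2) / 2))"
    unfolding S_eq by (rule iid_iexp_tendsto[where C = C, OF pair_compose(1)[OF gm] pair_compose(2)[OF gm] gC Eg])
  show ?thesis unfolding Eg2[symmetric]
  proof (rule iexp_tendsto_null_in_prob[OF _ _ _ lim])
    have [measurable]: "(\<lambda>\<omega>. quantile_diff n (u l) \<omega>) \<in> borel_measurable M" if "l < k" for n l
      using measurable_section[OF quantile_diff_measurable, of "u l" n] u[OF that] by (simp add: space_restrict_space)
    then show "(\<lambda>\<omega>. \<Sum>l<k. t l * quantile_diff n (u l) \<omega>) \<in> borel_measurable M" for n
      by (intro borel_measurable_sum borel_measurable_times borel_measurable_const) auto
    show "S n \<in> borel_measurable M" for n unfolding S_def by measurable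
    have "null_in_prob (\<lambda>n \<omega>. \<Sum>l<k. t l * ((sqrt (real n) * (quantile (ecdf X n \<omega>) (u l) - q l) - sqrt (real n) * (u l - ecdf X n \<omega> (q l)) / d l)
       + (- 1) * (sqrt (real n) * (quantile (ecdf Y n \<omega>) (u l) - q l) - sqrt (real n) * (u l - ecdf Y n \<omega> (q l)) / d l)))"
      using u q d by (intro null_in_prob_sum null_in_prob_scale null_in_prob_add X.bahadur Y.bahadur) auto
    also have "(\<lambda>n \<omega>. \<Sum>l<k. t l * ((sqrt (real n) * (quantile (ecdf X n \<omega>) (u l) - q l) - sqrt (real n) * (u l - ecdf X n \<omega> (q l)) / d l)
       + (- 1) * (sqrt (real n) * (quantile (ecdf Y n \<omega>) (u l) - q l) - sqrt (real n) * (u l - ecdf Y n \<omega> (q l)) / d l)))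
      = (\<lambda>n \<omega>. (\<Sum>l<k. t l * quantile_diff n (u l) \<omega>) - S n \<omega>)"
      unfolding S_def quantile_diff_def sum_subtractf[symmetric]
      by (intro ext sum.cong refl) (simp add: algebra_simps diff_divide_distrib)
    finally show "null_in_prob (\<lambda>n \<omega>. (\<Sum>l<k. t l * quantile_diff n (u l) \<omega>) - S n \<omega>)" .
  qed
qed

end

section \<open>The Gaussian limit\<close>

text \<open>Writing the law as that of \<open>\<sigma>\<close> times a standard normal variable
  treats the degenerate case together with the others.\<close>

lemma normal_eq_distr_std_normal:
  assumes "0 \<le> \<sigma>"
  shows "(if \<sigma> = 0 then return borel 0 else density lborel (\<lambda>x. ennreal (normal_density 0 \<sigma> x))) =
    distr std_normal_distribution borel (\<lambda>x. \<sigma> * x)"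
proof (cases "\<sigma> = 0")
  case True
  interpret real_distribution std_normal_distribution by (rule real_dist_normal_dist)
  have "distr std_normal_distribution borel (\<lambda>x. 0 :: real) = return borel 0"
    by (rule measure_eqI) (auto simp: emeasure_distr indicator_def emeasure_space_1[simplified])
  then show ?thesis using True by simp
next
  case False
  interpret real_distribution std_normal_distribution by (rule real_dist_normal_dist)
  have "distributed std_normal_distribution lborel (\<lambda>x. x) std_normal_density"
    unfolding distributed_def by (auto simp: distr_id2)
  then have "distributed std_normal_distribution lborel (\<lambda>x. 0 + \<sigma> * x) (normal_density (0 + \<sigma> * 0) (\<bar>\<sigma>\<bar> * 1))"
    using False by (intro normal_density_affine) auto
  then have "distr std_normal_distribution lborel (\<lambda>x. \<sigma> * x) = density lborel (\<lambda>x. ennreal (normal_density 0 \<sigma> x))"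
    using assms by (simp add: distributed_def)
  moreover have "distr std_normal_distribution lborel (\<lambda>x. \<sigma> * x) = distr std_normal_distribution borel (\<lambda>x. \<sigma> * x)"
    by (rule distr_cong) auto
  ultimately show ?thesis using False by simp
qed

definition abs_normal_moment :: "real \<Rightarrow> ennreal" where
  "abs_normal_moment p = (\<integral>\<^sup>+x. ennreal (\<bar>x\<bar> powr p) \<partial>std_normal_distribution)"

lemma abs_normal_moment_finite: "0 \<le> p \<Longrightarrow> abs_normal_moment p < \<infinity>"
proof -
  assume p: "0 \<le> p"
  interpret real_distribution std_normal_distribution by (rule real_dist_normal_dist)
  define k where "k = nat \<lceil>p\<rceil>"
  have k: "p \<le> real (2 * k)" unfolding k_def using p by linarith
  have le: "\<bar>x\<bar> powr p \<le> 1 + x ^ (2 * k)" for x :: real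
  proof (cases "\<bar>x\<bar> \<le> 1")
    case True
    then have "\<bar>x\<bar> powr p \<le> 1" using p by (intro powr_le1) auto
    moreover have "0 \<le> x ^ (2 * k)" by simp
    ultimately show ?thesis by linarith
  next
    case False
    then have "\<bar>x\<bar> powr p \<le> \<bar>x\<bar> powr real (2 * k)" using k by (intro powr_mono) auto
    also have "\<dots> = \<bar>x\<bar> ^ (2 * k)" using False by (subst powr_realpow) auto
    also have "\<dots> = x ^ (2 * k)" by (simp add: power_mult)
    finally show ?thesis by simp
  qed
  have "integrable std_normal_distribution (\<lambda>x. 1 + x ^ (2 * k))"
    by (intro Bochner_Integration.integrable_add integrable_std_normal_distribution_moment integrable_const)
  then have fin: "(\<integral>\<^sup>+x. ennreal (1 + x ^ (2 * k)) \<partial>std_normal_distribution) < \<infinity>"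
    by (subst nn_integral_eq_integral) (auto simp: zero_le_even_power)
  have "abs_normal_moment p \<le> (\<integral>\<^sup>+x. ennreal (1 + x ^ (2 * k)) \<partial>std_normal_distribution)"
    unfolding abs_normal_moment_def by (intro nn_integral_mono ennreal_leI le)
  then show ?thesis using fin by (rule order.strict_trans1)
qed

lemma std_normal_second_moment:
  "integrable std_normal_distribution (\<lambda>x. x\<^sup>2)" "(\<integral>x. x\<^sup>2 \<partial>std_normal_distribution) = 1"
  "integrable std_normal_distribution (\<lambda>x. x)" "(\<integral>x. x \<partial>std_normal_distribution) = 0"
  using integrable_std_normal_distribution_moment[of 2] std_normal_distribution_even_moments[of 1]
    integrable_std_normal_distribution_moment[of 1] integral_std_normal_distribution_moment_odd[of 1]
  by (auto simp: fact_numeral numeral_eq_Suc)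

lemma std_normal_small_ball:
  assumes "0 \<le> \<epsilon>"
  shows "measure std_normal_distribution {- \<epsilon>..\<epsilon>} \<le> \<epsilon>"
proof -
  have d: "std_normal_density x \<le> 1 / 2" for x
  proof -
    have "4 \<le> 2 * pi" using pi_gt3 by simp
    then have "sqrt 4 \<le> sqrt (2 * pi)" by (rule real_sqrt_le_mono)
    then have s: "2 \<le> sqrt (2 * pi)" by simp
    have "std_normal_density x = exp (- x\<^sup>2 / 2) / sqrt (2 * pi)" by (simp add: normal_density_def)
    also have "\<dots> \<le> 1 / 2" using s by (intro frac_le) auto
    finally show ?thesis .
  qed
  have "emeasure std_normal_distribution {- \<epsilon>..\<epsilon>} = (\<integral>\<^sup>+x. ennreal (std_normal_density x) * indicator {- \<epsilon>..\<epsilon>} x \<partial>lborel)"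
    by (subst emeasure_density) auto
  also have "\<dots> \<le> (\<integral>\<^sup>+x. ennreal (1 / 2) * indicator {- \<epsilon>..\<epsilon>} x \<partial>lborel)"
    by (intro nn_integral_mono mult_right_mono ennreal_leI d) auto
  also have "\<dots> = ennreal (1 / 2) * ennreal (2 * \<epsilon>)" using assms by (subst nn_integral_cmult_indicator) auto
  also have "\<dots> = ennreal \<epsilon>" using assms by (subst ennreal_mult[symmetric]) auto
  finally show ?thesis unfolding measure_def using assms by (simp add: enn2real_leI)
qed

section \<open>Centered Gaussian variables and sequences\<close>

context prob_space begin

lemma centered_gaussianE:
  assumes "centered_gaussian M Z"
  obtains \<sigma> where "0 \<le> \<sigma>" "distr M borel Z = distr std_normal_distribution borel (\<lambda>x. \<sigma> * x)"
    and "integrable M (\<lambda>\<omega>. (Z \<omega>)\<^sup>2)" "expectation (\<lambda>\<omega>. (Z \<omega>)\<^sup>2) = \<sigma>\<^sup>2" "integrable M Z" "expectation Z = 0"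
proof -
  have [measurable]: "Z \<in> borel_measurable M" using assms by (simp add: centered_gaussian_def)
  obtain \<sigma> where \<sigma>: "0 \<le> \<sigma>" and d: "distr M borel Z = distr std_normal_distribution borel (\<lambda>x. \<sigma> * x)"
    using assms normal_eq_distr_std_normal unfolding centered_gaussian_def by metis
  have tr: "integrable M (\<lambda>\<omega>. g (Z \<omega>)) \<longleftrightarrow> integrable std_normal_distribution (\<lambda>x. g (\<sigma> * x))"
    "expectation (\<lambda>\<omega>. g (Z \<omega>)) = (\<integral>x. g (\<sigma> * x) \<partial>std_normal_distribution)"
    if [measurable]: "g \<in> borel_measurable borel" for g :: "real \<Rightarrow> real"
    using integrable_distr_eq[of Z M borel g] integrable_distr_eq[of "\<lambda>x. \<sigma> * x" std_normal_distribution borel g]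
      integral_distr[of Z M borel g] integral_distr[of "\<lambda>x. \<sigma> * x" std_normal_distribution borel g] d by auto
  show thesis
  proof (rule that[OF \<sigma> d])
    show "integrable M (\<lambda>\<omega>. (Z \<omega>)\<^sup>2)" "expectation (\<lambda>\<omega>. (Z \<omega>)\<^sup>2) = \<sigma>\<^sup>2" "integrable M Z" "expectation Z = 0"
      by (simp_all add: tr[of "\<lambda>x. x\<^sup>2"] tr[of "\<lambda>x. x"] std_normal_second_moment power_mult_distrib)
  qed
qed

lemma centered_gaussian_facts:
  assumes "centered_gaussian M Z"
  shows "Z \<in> borel_measurable M" "integrable M (\<lambda>\<omega>. (Z \<omega>)\<^sup>2)" "integrable M Z" "expectation Z = 0"
  proof -
  show "Z \<in> borel_measurable M" using assms by (simp add: centered_gaussian_def)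
  show "integrable M (\<lambda>\<omega>. (Z \<omega>)\<^sup>2)" using assms by (rule centered_gaussianE)
  show "integrable M Z" using assms by (rule centered_gaussianE)
  show "expectation Z = 0" using assms by (rule centered_gaussianE)
qed

lemma centered_gaussian_iexp:
  assumes "centered_gaussian M Z"
  shows "(\<integral>\<omega>. iexp (Z \<omega>) \<partial>M) = complex_of_real (exp (- expectation (\<lambda>\<omega>. (Z \<omega>)\<^sup>2) / 2))"
proof -
  have Z [measurable]: "Z \<in> borel_measurable M" using assms by (simp add: centered_gaussian_def)
  obtain \<sigma> where \<sigma>: "distr M borel Z = distr std_normal_distribution borel (\<lambda>x. \<sigma> * x)" "expectation (\<lambda>\<omega>. (Z \<omega>)\<^sup>2) = \<sigma>\<^sup>2"
    using assms by (rule centered_gaussianE)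
  have "(\<integral>\<omega>. iexp (Z \<omega>) \<partial>M) = (\<integral>x. iexp x \<partial>distr M borel Z)" by (subst integral_distr) auto
  also have "\<dots> = (\<integral>x. iexp (\<sigma> * x) \<partial>std_normal_distribution)" unfolding \<sigma>(1) by (subst integral_distr) auto
  also have "\<dots> = char std_normal_distribution \<sigma>" by (simp add: char_def)
  finally show ?thesis unfolding \<sigma>(2) by (simp add: char_std_normal_distribution exp_of_real[symmetric])
qed

lemma centered_gaussian_abs_moment:
  assumes "centered_gaussian M Z"
  shows "(\<integral>\<^sup>+\<omega>. ennreal (\<bar>Z \<omega>\<bar> powr p) \<partial>M) = ennreal (sqrt (expectation (\<lambda>\<omega>. (Z \<omega>)\<^sup>2)) powr p) * abs_normal_moment p"
proof -
  have Z [measurable]: "Z \<in> borel_measurable M" using assms by (simp add: centered_gaussian_def)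
  obtain \<sigma> where \<sigma>: "0 \<le> \<sigma>" "distr M borel Z = distr std_normal_distribution borel (\<lambda>x. \<sigma> * x)" "expectation (\<lambda>\<omega>. (Z \<omega>)\<^sup>2) = \<sigma>\<^sup>2"
    using assms by (rule centered_gaussianE)
  have "(\<integral>\<^sup>+\<omega>. ennreal (\<bar>Z \<omega>\<bar> powr p) \<partial>M) = (\<integral>\<^sup>+x. ennreal (\<bar>x\<bar> powr p) \<partial>distr M borel Z)"
    by (subst nn_integral_distr) auto
  also have "\<dots> = (\<integral>\<^sup>+x. ennreal (\<bar>\<sigma> * x\<bar> powr p) \<partial>std_normal_distribution)"
    unfolding \<sigma>(2) by (subst nn_integral_distr) auto
  also have "\<dots> = (\<integral>\<^sup>+x. ennreal (\<sigma> powr p) * ennreal (\<bar>x\<bar> powr p) \<partial>std_normal_distribution)"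
    using \<sigma>(1) by (intro nn_integral_cong) (simp add: abs_mult powr_mult ennreal_mult)
  also have "\<dots> = ennreal (\<sigma> powr p) * abs_normal_moment p"
    unfolding abs_normal_moment_def by (rule nn_integral_cmult) simp
  finally show ?thesis using \<sigma> by simp
qed

lemma centered_gaussian_small_ball:
  assumes "centered_gaussian M Z" "expectation (\<lambda>\<omega>. (Z \<omega>)\<^sup>2) = 1" "0 \<le> \<epsilon>"
  shows "prob {\<omega> \<in> space M. \<bar>Z \<omega>\<bar> \<le> \<epsilon>} \<le> \<epsilon>"
proof -
  have Z [measurable]: "Z \<in> borel_measurable M" using assms by (simp add: centered_gaussian_def)
  obtain \<sigma> where \<sigma>: "0 \<le> \<sigma>" "distr M borel Z = distr std_normal_distribution borel (\<lambda>x. \<sigma> * x)" "expectation (\<lambda>\<omega>. (Z \<omega>)\<^sup>2) = \<sigma>\<^sup>2"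
    using assms(1) by (rule centered_gaussianE)
  have "\<sigma> = 1" using \<sigma>(1,3) assms(2) by (simp add: power2_eq_1_iff)
  then have d: "distr M borel Z = distr std_normal_distribution borel (\<lambda>x. x)" using \<sigma>(2) by simp
  have "prob {\<omega> \<in> space M. \<bar>Z \<omega>\<bar> \<le> \<epsilon>} = prob (Z -` {- \<epsilon>..\<epsilon>} \<inter> space M)"
    by (intro arg_cong[where f = prob]) auto
  also have "\<dots> = measure (distr M borel Z) {- \<epsilon>..\<epsilon>}" by (subst measure_distr) auto
  also have "\<dots> = measure std_normal_distribution {- \<epsilon>..\<epsilon>}" unfolding d by (subst measure_distr) auto
  also have "\<dots> \<le> \<epsilon>" by (rule std_normal_small_ball[OF assms(3)])
  finally show ?thesis .
qed

text \<open>The map \<open>i\<close> need not be injective: coefficients at coinciding indices are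
  collected. This allows evaluation points to be repeated in the finite-dimensional laws.\<close>

lemma centered_gaussian_process_sum:
  assumes P: "centered_gaussian_process M I Z" and fin: "finite \<Lambda>" and i: "i ` \<Lambda> \<subseteq> I"
  shows "centered_gaussian M (\<lambda>\<omega>. \<Sum>l\<in>\<Lambda>. c l * Z (i l) \<omega>)"
proof -
  have "(\<Sum>l\<in>\<Lambda>. c l * Z (i l) \<omega>) = (\<Sum>j\<in>i ` \<Lambda>. (\<Sum>l\<in>{l \<in> \<Lambda>. i l = j}. c l) * Z j \<omega>)" for \<omega>
    by (subst sum.image_gen[OF fin, where g = i]) (auto simp: sum_distrib_right intro!: sum.cong)
  then show ?thesis
    using P fin i unfolding centered_gaussian_process_def by (simp add: finite_imageI)
qed

lemma centered_gaussian_product_integrable: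
  assumes "centered_gaussian M U" "centered_gaussian M V"
  shows "integrable M (\<lambda>\<omega>. U \<omega> * V \<omega>)"
proof (rule Bochner_Integration.integrable_bound)
  show "(\<lambda>\<omega>. U \<omega> * V \<omega>) \<in> borel_measurable M"
    using assms by (intro borel_measurable_times centered_gaussian_facts(1))
  show "integrable M (\<lambda>\<omega>. (U \<omega>)\<^sup>2 + (V \<omega>)\<^sup>2)"
    by (intro Bochner_Integration.integrable_add centered_gaussian_facts(2) assms)
  have "\<bar>a * b\<bar> \<le> \<bar>a\<^sup>2 + b\<^sup>2\<bar>" for a b :: real
    using sum_squares_bound[of "\<bar>a\<bar>" "\<bar>b\<bar>"] abs_ge_zero[of "a * b"] unfolding abs_mult power2_abs by linarith
  then show "AE \<omega> in M. norm (U \<omega> * V \<omega>) \<le> norm ((U \<omega>)\<^sup>2 + (V \<omega>)\<^sup>2)" by simp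
qed

text \<open>A centered Gaussian sequence with fast decaying correlations satisfies a weak law of large
  numbers, which is incompatible with all its terms being nonnegative on a non-null event.\<close>

lemma decorrelated_gaussian_not_nonneg:
  fixes Z :: "nat \<Rightarrow> 'a \<Rightarrow> real"
  assumes G: "\<And>k. centered_gaussian M (Z k)" and var: "\<And>k. expectation (\<lambda>\<omega>. (Z k \<omega>)\<^sup>2) = 1"
    and corr: "\<And>j k. j < k \<Longrightarrow> expectation (\<lambda>\<omega>. Z j \<omega> * Z k \<omega>) \<le> (1 / 2) ^ (k - j)"
  shows "prob {\<omega> \<in> space M. \<forall>k. 0 \<le> Z k \<omega>} = 0"
proof (rule ccontr)
  define A where "A = {\<omega> \<in> space M. \<forall>k. 0 \<le> Z k \<omega>}"
  define p where "p = prob A"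
  assume "prob {\<omega> \<in> space M. \<forall>k. 0 \<le> Z k \<omega>} \<noteq> 0"
  then have p: "0 < p" unfolding p_def A_def[symmetric] by (simp add: zero_less_measure_iff)
  note Zm [measurable] = centered_gaussian_facts(1)[OF G]
  have A [measurable]: "A \<in> events" unfolding A_def by measurable
  have ip: "integrable M (\<lambda>\<omega>. Z j \<omega> * Z k \<omega>)" for j k
    by (intro centered_gaussian_product_integrable G)
  define S where "S m \<omega> = (\<Sum>k<m. Z k \<omega>)" for m \<omega>
  have [measurable]: "S m \<in> borel_measurable M" for m unfolding S_def by measurable
  \<comment> \<open>Each new term adds its variance 1 and twice its covariance with the previous
    sum, which the geometric series bounds by 1; hence linear growth with factor 3.\<close>
  have S2: "integrable M (\<lambda>\<omega>. (S m \<omega>)\<^sup>2) \<and> expectation (\<lambda>\<omega>. (S m \<omega>)\<^sup>2) \<le> 3 * real m" for m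
  proof (induction m)
    case 0 then show ?case by (simp add: S_def)
  next
    case (Suc m)
    have eq: "(S (Suc m) \<omega>)\<^sup>2 = ((S m \<omega>)\<^sup>2 + 2 * (\<Sum>k<m. Z k \<omega> * Z m \<omega>)) + (Z m \<omega>)\<^sup>2" for \<omega>
      unfolding S_def by (simp add: power2_sum sum_distrib_right)
    have i1: "integrable M (\<lambda>\<omega>. \<Sum>k<m. Z k \<omega> * Z m \<omega>)" by (intro Bochner_Integration.integrable_sum ip)
    have i2: "integrable M (\<lambda>\<omega>. (Z m \<omega>)\<^sup>2)" by (intro centered_gaussian_facts(2) G)
    have "expectation (\<lambda>\<omega>. \<Sum>k<m. Z k \<omega> * Z m \<omega>) = (\<Sum>k<m. expectation (\<lambda>\<omega>. Z k \<omega> * Z m \<omega>))"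
      by (intro Bochner_Integration.integral_sum ip)
    also have "\<dots> \<le> (\<Sum>k<m. (1 / 2) ^ (m - k))" by (intro sum_mono corr) auto
    also have "\<dots> = (\<Sum>k<m. (1 / 2) ^ Suc k)"
      by (rule sum.reindex_bij_witness[where i = "\<lambda>k. m - Suc k" and j = "\<lambda>k. m - Suc k"]) (auto simp: Suc_diff_Suc)
    also have "\<dots> \<le> 1"
    proof -
      have "(\<Sum>k<m. (1 / 2 :: real) ^ Suc k) = 1 - (1 / 2) ^ m" by (induction m) (auto simp: field_simps)
      then show ?thesis by simp
    qed
    finally have c: "expectation (\<lambda>\<omega>. \<Sum>k<m. Z k \<omega> * Z m \<omega>) \<le> 1" .
    have "expectation (\<lambda>\<omega>. (S (Suc m) \<omega>)\<^sup>2) = expectation (\<lambda>\<omega>. (S m \<omega>)\<^sup>2) + 2 * expectation (\<lambda>\<omega>. \<Sum>k<m. Z k \<omega> * Z m \<omega>) + 1"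
      unfolding eq using Suc.IH i1 i2 var by simp
    moreover have "integrable M (\<lambda>\<omega>. (S (Suc m) \<omega>)\<^sup>2)" unfolding eq using Suc.IH i1 i2 by simp
    ultimately show ?case using Suc.IH c by simp
  qed
  have iA: "integrable M (\<lambda>\<omega>. Z k \<omega> * indicator A \<omega>)" for k
    by (intro integrable_real_mult_indicator centered_gaussian_facts(3) G A)
  \<comment> \<open>On \<open>A\<close> the variable is nonnegative, and it exceeds
    \<open>p / 2\<close> except on a set of probability at most \<open>p / 2\<close>; what is left
    of \<open>A\<close> has probability at least \<open>p / 2\<close>.\<close>
  have EZA: "p\<^sup>2 / 4 \<le> expectation (\<lambda>\<omega>. Z k \<omega> * indicator A \<omega>)" for k
  proof -
    let ?D = "{\<omega> \<in> space M. \<bar>Z k \<omega>\<bar> \<le> p / 2}"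
    have "p\<^sup>2 / 4 = (p / 2) * (p - p / 2)" by (simp add: power2_eq_square)
    also have "\<dots> \<le> (p / 2) * (p - prob ?D)"
      using p centered_gaussian_small_ball[OF G[of k] var, of "p / 2"] by (intro mult_left_mono) auto
    also have "\<dots> = expectation (\<lambda>\<omega>. (p / 2) * indicator A \<omega> - (p / 2) * indicator ?D \<omega>)"
      by (subst Bochner_Integration.integral_diff) (auto simp: p_def less_top[symmetric] right_diff_distrib)
    also have "\<dots> \<le> expectation (\<lambda>\<omega>. Z k \<omega> * indicator A \<omega>)"
    proof (intro integral_mono iA)
      fix \<omega> assume "\<omega> \<in> space M"
      then show "(p / 2) * indicator A \<omega> - (p / 2) * indicator ?D \<omega> \<le> Z k \<omega> * indicator A \<omega>"
        using p by (auto simp: A_def indicator_def)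
    qed (auto simp: less_top[symmetric])
    finally show ?thesis .
  qed
  \<comment> \<open>The weight \<open>p\<^sup>2 / 24\<close> makes the quadratic part of Young's
    inequality cost \<open>m * p\<^sup>2 / 8\<close> by the bound \<open>3 * m\<close> on the second
    moment, half of the lower bound \<open>m * p\<^sup>2 / 4\<close>. A quantity linear in
    \<open>m\<close> thus stays bounded.\<close>
  have main: "real m * p\<^sup>2 / 8 \<le> 6 / p\<^sup>2" for m
  proof -
    have "real m * (p\<^sup>2 / 4) = (\<Sum>k<m. p\<^sup>2 / 4)" by simp
    also have "\<dots> \<le> (\<Sum>k<m. expectation (\<lambda>\<omega>. Z k \<omega> * indicator A \<omega>))" by (intro sum_mono EZA)
    also have "\<dots> = expectation (\<lambda>\<omega>. S m \<omega> * indicator A \<omega>)"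
      unfolding S_def sum_distrib_right by (intro Bochner_Integration.integral_sum[symmetric] iA)
    also have "\<dots> \<le> expectation (\<lambda>\<omega>. p\<^sup>2 / 24 * (S m \<omega>)\<^sup>2 + 6 / p\<^sup>2)"
    proof (intro integral_mono)
      show "integrable M (\<lambda>\<omega>. S m \<omega> * indicator A \<omega>)"
        unfolding S_def sum_distrib_right by (intro Bochner_Integration.integrable_sum iA)
      show "integrable M (\<lambda>\<omega>. p\<^sup>2 / 24 * (S m \<omega>)\<^sup>2 + 6 / p\<^sup>2)" using S2 by simp
      fix \<omega>
      have "x \<le> p\<^sup>2 / 24 * x\<^sup>2 + 6 / p\<^sup>2" for x
      proof -
        have "0 \<le> (p * x / 12 - 1 / p)\<^sup>2 * 6" by simp
        also have "(p * x / 12 - 1 / p)\<^sup>2 * 6 = p\<^sup>2 / 24 * x\<^sup>2 + 6 / p\<^sup>2 - x"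
          using p by (simp add: power2_eq_square field_simps)
        finally show ?thesis by simp
      qed
      moreover have "0 \<le> p\<^sup>2 / 24 * (S m \<omega>)\<^sup>2 + 6 / p\<^sup>2" by simp
      ultimately show "S m \<omega> * indicator A \<omega> \<le> p\<^sup>2 / 24 * (S m \<omega>)\<^sup>2 + 6 / p\<^sup>2" by (auto simp: indicator_def)
    qed
    also have "\<dots> = p\<^sup>2 / 24 * expectation (\<lambda>\<omega>. (S m \<omega>)\<^sup>2) + 6 / p\<^sup>2" using S2 by (simp add: prob_space)
    also have "\<dots> \<le> p\<^sup>2 / 24 * (3 * real m) + 6 / p\<^sup>2" using S2[of m] by (intro add_right_mono mult_left_mono) auto
    finally show ?thesis by simp
  qed
  obtain m :: nat where "48 / p\<^sup>2 / p\<^sup>2 < real m" using reals_Archimedean2 by blast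
  then have "6 / p\<^sup>2 < real m * p\<^sup>2 / 8" using p by (simp add: field_simps)
  then show False using main[of m] by simp
qed

end

text \<open>A process with continuous paths is a pointwise limit of processes that are piecewise
  constant in \<open>u\<close>, and these are jointly measurable since they take countably many
  pieces.\<close>

lemma measurable_continuous_paths:
  fixes Z :: "real \<Rightarrow> 'a \<Rightarrow> real"
  assumes m: "\<And>u. u \<in> {0<..<1} \<Longrightarrow> Z u \<in> borel_measurable M"
    and c: "\<And>\<omega>. \<omega> \<in> space M \<Longrightarrow> continuous_on {0<..<1} (\<lambda>u. Z u \<omega>)"
  shows "(\<lambda>(\<omega>, u). Z u \<omega>) \<in> borel_measurable (M \<Otimes>\<^sub>M unif01)"
proof -
  \<comment> \<open>The shifts by 1 and 2 keep the evaluation point of every \<open>u\<close>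
    strictly inside the open unit interval, for all \<open>k\<close> including 0.\<close>
  define r where "r k i = (real_of_int i + 1) / (real k + 2)" for k :: nat and i :: int
  define Z' where "Z' k i \<omega> = (if r k i \<in> {0<..<1} then Z (r k i) \<omega> else 0)" for k i \<omega>
  have Z'm [measurable]: "Z' k i \<in> borel_measurable M" for k i
    using m[of "r k i"] unfolding Z'_def by (cases "r k i \<in> {0<..<1}") auto
  have [measurable]: "(\<lambda>z. \<lfloor>real k * snd z\<rfloor>) \<in> measurable (M \<Otimes>\<^sub>M unif01) (count_space UNIV)" for k :: nat
  proof -
    have [measurable]: "(\<lambda>u. u) \<in> borel_measurable unif01" by (intro measurable_restrict_space1) simp
    show ?thesis by measurable
  qed
  show ?thesis
  proof (rule borel_measurable_LIMSEQ_real)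
    show "(\<lambda>z. Z' k \<lfloor>real k * snd z\<rfloor> (fst z)) \<in> borel_measurable (M \<Otimes>\<^sub>M unif01)" for k
      by (rule measurable_compose_countable[where f = "\<lambda>i z. Z' k i (fst z)"]) measurable
    fix z assume z: "z \<in> space (M \<Otimes>\<^sub>M unif01)"
    obtain \<omega> u where [simp]: "z = (\<omega>, u)" by (cases z)
    have \<omega>: "\<omega> \<in> space M" and u: "u \<in> {0<..<1}" using z by (auto simp: space_pair_measure space_restrict_space)
    have fl: "0 \<le> \<lfloor>real k * u\<rfloor>" "real_of_int \<lfloor>real k * u\<rfloor> \<le> real k" for k
    proof -
      have "0 \<le> real k * u" "real k * u \<le> real k" using u by (auto simp: mult_left_le)
      then show "0 \<le> \<lfloor>real k * u\<rfloor>" "real_of_int \<lfloor>real k * u\<rfloor> \<le> real k" by linarith+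
    qed
    have r01: "r k \<lfloor>real k * u\<rfloor> \<in> {0<..<1}" for k
    proof -
      have "0 < real_of_int \<lfloor>real k * u\<rfloor> + 1" "real_of_int \<lfloor>real k * u\<rfloor> + 1 < real k + 2"
        using fl[of k] by linarith+
      then show ?thesis by (simp add: r_def)
    qed
    have "(\<lambda>k. r k \<lfloor>real k * u\<rfloor> - u) \<longlonglongrightarrow> 0"
    proof (rule Lim_null_comparison[OF always_eventually])
      show "(\<lambda>k. 2 * inverse (real (Suc k))) \<longlonglongrightarrow> 0"
        by (intro tendsto_mult_right_zero LIMSEQ_inverse_real_of_nat)
      show "\<forall>k. norm (r k \<lfloor>real k * u\<rfloor> - u) \<le> 2 * inverse (real (Suc k))"
      proof
        fix k
        have "\<bar>(real_of_int \<lfloor>real k * u\<rfloor> - real k * u) + (1 - 2 * u)\<bar> \<le> 2" using u by (simp only: greaterThanLessThan_iff) linarith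
        moreover have "r k \<lfloor>real k * u\<rfloor> - u = ((real_of_int \<lfloor>real k * u\<rfloor> - real k * u) + (1 - 2 * u)) / (real k + 2)"
          by (simp add: r_def field_simps)
        ultimately have "norm (r k \<lfloor>real k * u\<rfloor> - u) \<le> 2 / (real k + 2)"
          by (simp add: abs_divide divide_right_mono)
        also have "\<dots> \<le> 2 / real (Suc k)" by (intro divide_left_mono) auto
        finally show "norm (r k \<lfloor>real k * u\<rfloor> - u) \<le> 2 * inverse (real (Suc k))" by (simp add: divide_inverse)
      qed
    qed
    then have "(\<lambda>k. r k \<lfloor>real k * u\<rfloor>) \<longlonglongrightarrow> u" by (rule Lim_null[THEN iffD2])
    then have "(\<lambda>k. Z (r k \<lfloor>real k * u\<rfloor>) \<omega>) \<longlonglongrightarrow> Z u \<omega>"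
      using continuous_on_tendsto_compose[OF c[OF \<omega>] _ u, of "\<lambda>k. r k \<lfloor>real k * u\<rfloor>" sequentially] r01 by simp
    then show "(\<lambda>k. Z' k \<lfloor>real k * snd z\<rfloor> (fst z)) \<longlonglongrightarrow> (case z of (\<omega>, u) \<Rightarrow> Z u \<omega>)"
      using r01 by (simp add: Z'_def)
  qed
qed


section \<open>The difference of the two Brownian bridges\<close>

locale bridge_limit = prob_space N for N :: "'b measure" +
  fixes BX BY :: "real \<Rightarrow> 'b \<Rightarrow> real" and H :: "real \<Rightarrow> real \<Rightarrow> real" and F :: "real \<Rightarrow> real"
  assumes limit: "limit_process N H F F BX BY"
begin

text \<open>For a joint distribution function \<open>H\<close> with marginals \<open>F\<close> this
  is the copula.\<close>

definition K :: "real \<Rightarrow> real \<Rightarrow> real" where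
  "K u v = H (quantile F u) (quantile F v)"

definition \<Delta> :: "real \<Rightarrow> 'b \<Rightarrow> real" where
  "\<Delta> u \<omega> = BX u \<omega> - BY u \<omega>"

lemma joint_gaussian: "centered_gaussian_process N ({0<..<1} <+> {0<..<1}) (case_sum BX BY)"
  using limit by (simp add: limit_process_def)

lemma bridge_gaussian:
  assumes "u \<in> {0<..<1}"
  shows "centered_gaussian N (BX u)" "centered_gaussian N (BY u)"
  using centered_gaussian_process_sum[OF joint_gaussian, of "{Inl u}" "\<lambda>x. x" "\<lambda>_. 1"]
    centered_gaussian_process_sum[OF joint_gaussian, of "{Inr u}" "\<lambda>x. x" "\<lambda>_. 1"] assms by (simp_all add: InlI InrI)

lemma cov_gaussian:
  assumes "centered_gaussian N U" "centered_gaussian N V"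
  shows "cov N U V = expectation (\<lambda>\<omega>. U \<omega> * V \<omega>)"
  using assms by (simp add: cov_def centered_gaussian_facts(4))

lemma bridge_covariances:
  assumes "u \<in> {0<..<1}" "v \<in> {0<..<1}"
  shows "expectation (\<lambda>\<omega>. BX u \<omega> * BX v \<omega>) = min u v - u * v"
    "expectation (\<lambda>\<omega>. BY u \<omega> * BY v \<omega>) = min u v - u * v"
    "expectation (\<lambda>\<omega>. BX u \<omega> * BY v \<omega>) = K u v - u * v"
  using limit assms bridge_gaussian
  by (auto simp: limit_process_def brownian_bridge_def cov_gaussian[symmetric] K_def)

lemma \<Delta>_covariance:
  assumes u: "u \<in> {0<..<1}" and v: "v \<in> {0<..<1}"
  shows "integrable N (\<lambda>\<omega>. \<Delta> u \<omega> * \<Delta> v \<omega>)"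
    "expectation (\<lambda>\<omega>. \<Delta> u \<omega> * \<Delta> v \<omega>) = 2 * min u v - K u v - K v u"
proof -
  note i = centered_gaussian_product_integrable[OF bridge_gaussian(1)[OF u] bridge_gaussian(1)[OF v]]
    centered_gaussian_product_integrable[OF bridge_gaussian(2)[OF u] bridge_gaussian(2)[OF v]]
    centered_gaussian_product_integrable[OF bridge_gaussian(1)[OF u] bridge_gaussian(2)[OF v]]
    centered_gaussian_product_integrable[OF bridge_gaussian(1)[OF v] bridge_gaussian(2)[OF u]]
  have eq: "\<Delta> u \<omega> * \<Delta> v \<omega> = (BX u \<omega> * BX v \<omega> + BY u \<omega> * BY v \<omega>) - (BX u \<omega> * BY v \<omega> + BX v \<omega> * BY u \<omega>)" for \<omega>
    by (simp add: \<Delta>_def algebra_simps)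
  show "integrable N (\<lambda>\<omega>. \<Delta> u \<omega> * \<Delta> v \<omega>)" unfolding eq using i by simp
  show "expectation (\<lambda>\<omega>. \<Delta> u \<omega> * \<Delta> v \<omega>) = 2 * min u v - K u v - K v u"
    unfolding eq using i bridge_covariances[OF u v] bridge_covariances(3)[OF v u] by (simp add: mult.commute)
qed

text \<open>Joint Gaussianity of the pair enters here: the combination is taken over the disjoint
  sum of the index sets, with coefficients \<open>c\<close> on \<open>BX\<close> and
  \<open>- c\<close> on \<open>BY\<close>.\<close>

lemma \<Delta>_sum_gaussian:
  fixes u :: "'i \<Rightarrow> real"
  assumes fin: "finite \<Lambda>" and u: "\<And>l. l \<in> \<Lambda> \<Longrightarrow> u l \<in> {0<..<1}"
  shows "centered_gaussian N (\<lambda>\<omega>. \<Sum>l\<in>\<Lambda>. c l * \<Delta> (u l) \<omega>)"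
proof -
  let ?L = "\<Lambda> <+> \<Lambda>"
  have "centered_gaussian N (\<lambda>\<omega>. \<Sum>l\<in>?L. case_sum c (\<lambda>l. - c l) l * case_sum BX BY (map_sum u u l) \<omega>)"
    using fin u by (intro centered_gaussian_process_sum[OF joint_gaussian]) auto
  moreover have "(\<Sum>l\<in>?L. case_sum c (\<lambda>l. - c l) l * case_sum BX BY (map_sum u u l) \<omega>) = (\<Sum>l\<in>\<Lambda>. c l * \<Delta> (u l) \<omega>)" for \<omega>
    using fin by (simp add: sum.Plus \<Delta>_def sum_subtractf sum_negf right_diff_distrib)
  ultimately show ?thesis by simp
qed

lemma \<Delta>_gaussian: "u \<in> {0<..<1} \<Longrightarrow> centered_gaussian N (\<lambda>\<omega>. c * \<Delta> u \<omega>)"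
  using \<Delta>_sum_gaussian[of "{()}" "\<lambda>_. u" "\<lambda>_. c"] by simp

lemma \<Delta>_sum_iexp:
  fixes u :: "nat \<Rightarrow> real" and k :: nat
  assumes u: "\<And>l. l < k \<Longrightarrow> u l \<in> {0<..<1}"
  shows "(\<integral>\<omega>. iexp (\<Sum>l<k. c l * \<Delta> (u l) \<omega>) \<partial>N) = complex_of_real (exp (- (\<Sum>l<k. \<Sum>m<k. c l * c m *
      (2 * min (u l) (u m) - K (u l) (u m) - K (u m) (u l))) / 2))"
proof -
  have "expectation (\<lambda>\<omega>. (\<Sum>l<k. c l * \<Delta> (u l) \<omega>)\<^sup>2) =
      expectation (\<lambda>\<omega>. \<Sum>l<k. \<Sum>m<k. (c l * c m) * (\<Delta> (u l) \<omega> * \<Delta> (u m) \<omega>))"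
    unfolding power2_eq_square sum_product by (simp add: mult_ac)
  also have "\<dots> = (\<Sum>l<k. \<Sum>m<k. (c l * c m) * expectation (\<lambda>\<omega>. \<Delta> (u l) \<omega> * \<Delta> (u m) \<omega>))"
    using u by (subst Bochner_Integration.integral_sum, intro Bochner_Integration.integrable_sum integrable_mult_right \<Delta>_covariance(1), simp, simp,
        intro sum.cong refl, subst Bochner_Integration.integral_sum, intro integrable_mult_right \<Delta>_covariance(1)) auto
  also have "\<dots> = (\<Sum>l<k. \<Sum>m<k. c l * c m * (2 * min (u l) (u m) - K (u l) (u m) - K (u m) (u l)))"
    using u by (intro sum.cong refl) (simp add: \<Delta>_covariance(2))
  finally show ?thesis using centered_gaussian_iexp[OF \<Delta>_sum_gaussian[of "{..<k}" u c]] u by simp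
qed

lemma \<Delta>_paths: "\<omega> \<in> space N \<Longrightarrow> continuous_on {0<..<1} (\<lambda>u. \<Delta> u \<omega>)"
  unfolding \<Delta>_def using limit by (intro continuous_on_diff) (auto simp: limit_process_def brownian_bridge_def)

lemma \<Delta>_measurable: "u \<in> {0<..<1} \<Longrightarrow> \<Delta> u \<in> borel_measurable N"
  using centered_gaussian_facts(1)[OF \<Delta>_gaussian[of u 1]] by simp

lemma \<Delta>_jointly_measurable: "(\<lambda>(\<omega>, u). \<Delta> u \<omega>) \<in> borel_measurable (N \<Otimes>\<^sub>M unif01)"
  by (intro measurable_continuous_paths \<Delta>_measurable \<Delta>_paths)

text \<open>From \<open>(a - b)\<^sup>2 \<le> 2 * a\<^sup>2 + 2 * b\<^sup>2\<close>, so the bound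
  holds whatever the dependence between the bridges.\<close>

lemma \<Delta>_variance_le:
  assumes u: "u \<in> {0<..<1}"
  shows "expectation (\<lambda>\<omega>. (\<Delta> u \<omega>)\<^sup>2) \<le> 4 * (u * (1 - u))"
proof -
  note i = centered_gaussian_product_integrable[OF bridge_gaussian(1)[OF u] bridge_gaussian(1)[OF u]]
    centered_gaussian_product_integrable[OF bridge_gaussian(2)[OF u] bridge_gaussian(2)[OF u]]
  have "expectation (\<lambda>\<omega>. (\<Delta> u \<omega>)\<^sup>2) \<le> expectation (\<lambda>\<omega>. 2 * (BX u \<omega> * BX u \<omega>) + 2 * (BY u \<omega> * BY u \<omega>))"
  proof (intro integral_mono)
    show "integrable N (\<lambda>\<omega>. (\<Delta> u \<omega>)\<^sup>2)" using \<Delta>_covariance(1)[OF u u] by (simp add: power2_eq_square)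
    show "integrable N (\<lambda>\<omega>. 2 * (BX u \<omega> * BX u \<omega>) + 2 * (BY u \<omega> * BY u \<omega>))" using i by simp
    show "(\<Delta> u \<omega>)\<^sup>2 \<le> 2 * (BX u \<omega> * BX u \<omega>) + 2 * (BY u \<omega> * BY u \<omega>)" for \<omega>
      using zero_le_power2[of "BX u \<omega> + BY u \<omega>"] by (simp add: \<Delta>_def power2_eq_square algebra_simps)
  qed
  also have "\<dots> = 2 * expectation (\<lambda>\<omega>. BX u \<omega> * BX u \<omega>) + 2 * expectation (\<lambda>\<omega>. BY u \<omega> * BY u \<omega>)"
    using i by simp
  also have "\<dots> = 4 * (u * (1 - u))" unfolding bridge_covariances[OF u u] by (simp add: algebra_simps)
  finally show ?thesis .
qed

text \<open>Tonelli and the scaling of Gaussian moments. The integral on the right is the one that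
  also bounds the sample quantiles, so one integrability assumption controls both processes.\<close>

lemma scaled_moment_le:
  assumes p: "0 < p" and h: "continuous_on {0<..<1} h" "\<And>u. u \<in> {0<..<1} \<Longrightarrow> 0 < h u"
  shows "(\<integral>\<^sup>+\<omega>. (\<integral>\<^sup>+u. ennreal (\<bar>\<Delta> u \<omega> / h u\<bar> powr p) \<partial>unif01) \<partial>N) \<le>
    ennreal (2 powr p) * abs_normal_moment p * (\<integral>\<^sup>+u. ennreal ((sqrt (u * (1 - u)) / h u) powr p) \<partial>unif01)"
proof -
  interpret U: prob_space unif01 by (rule prob_space_unif01)
  interpret pair_sigma_finite N unif01 ..
  have hm [measurable]: "h \<in> borel_measurable unif01"
  proof -
    have "h \<in> borel_measurable (restrict_space borel {0<..<1})" by (rule borel_measurable_continuous_on_restrict[OF h(1)])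
    then show ?thesis by (simp cong: measurable_cong_sets add: sets_restrict_space)
  qed
  have [measurable]: "(\<lambda>u. u) \<in> borel_measurable unif01" by (intro measurable_restrict_space1) simp
  have jm: "(\<lambda>(\<omega>, u). ennreal (\<bar>\<Delta> u \<omega> / h u\<bar> powr p)) \<in> borel_measurable (N \<Otimes>\<^sub>M unif01)"
    using \<Delta>_jointly_measurable unfolding split_beta' by measurable
  have "(\<integral>\<^sup>+\<omega>. (\<integral>\<^sup>+u. ennreal (\<bar>\<Delta> u \<omega> / h u\<bar> powr p) \<partial>unif01) \<partial>N) =
    (\<integral>\<^sup>+u. (\<integral>\<^sup>+\<omega>. ennreal (\<bar>\<Delta> u \<omega> / h u\<bar> powr p) \<partial>N) \<partial>unif01)"
    using Fubini'[of "\<lambda>\<omega> u. ennreal (\<bar>\<Delta> u \<omega> / h u\<bar> powr p)"] jm by simp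
  also have "\<dots> \<le> (\<integral>\<^sup>+u. (ennreal (2 powr p) * abs_normal_moment p) * ennreal ((sqrt (u * (1 - u)) / h u) powr p) \<partial>unif01)"
  proof (intro nn_integral_mono)
    fix u assume "u \<in> space unif01"
    then have u: "u \<in> {0<..<1}" by (simp add: space_restrict_space)
    have hu: "0 < h u" by (rule h(2)[OF u])
    have "(\<integral>\<^sup>+\<omega>. ennreal (\<bar>\<Delta> u \<omega> / h u\<bar> powr p) \<partial>N) = (\<integral>\<^sup>+\<omega>. ennreal (\<bar>(1 / h u) * \<Delta> u \<omega>\<bar> powr p) \<partial>N)" by simp
    also have "\<dots> = ennreal (sqrt (expectation (\<lambda>\<omega>. ((1 / h u) * \<Delta> u \<omega>)\<^sup>2)) powr p) * abs_normal_moment p"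
      by (rule centered_gaussian_abs_moment[OF \<Delta>_gaussian[OF u]])
    also have "\<dots> \<le> ennreal ((2 * (sqrt (u * (1 - u)) / h u)) powr p) * abs_normal_moment p"
    proof (intro mult_right_mono ennreal_leI powr_mono2)
      have "expectation (\<lambda>\<omega>. ((1 / h u) * \<Delta> u \<omega>)\<^sup>2) = (1 / h u)\<^sup>2 * expectation (\<lambda>\<omega>. (\<Delta> u \<omega>)\<^sup>2)"
        unfolding power_mult_distrib by (rule integral_mult_right_zero)
      also have "\<dots> \<le> (1 / h u)\<^sup>2 * (4 * (u * (1 - u)))" by (intro mult_left_mono \<Delta>_variance_le u) simp
      finally have "sqrt (expectation (\<lambda>\<omega>. ((1 / h u) * \<Delta> u \<omega>)\<^sup>2)) \<le> sqrt ((1 / h u)\<^sup>2 * (4 * (u * (1 - u))))"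
        by (rule real_sqrt_le_mono)
      also have "\<dots> = 2 * (sqrt (u * (1 - u)) / h u)"
        using hu by (simp add: real_sqrt_mult)
      finally show "sqrt (expectation (\<lambda>\<omega>. ((1 / h u) * \<Delta> u \<omega>)\<^sup>2)) \<le> 2 * (sqrt (u * (1 - u)) / h u)" .
    qed (use p in auto)
    also have "\<dots> = (ennreal (2 powr p) * abs_normal_moment p) * ennreal ((sqrt (u * (1 - u)) / h u) powr p)"
      using hu u by (subst powr_mult) (auto simp: ennreal_mult mult_ac)
    finally show "(\<integral>\<^sup>+\<omega>. ennreal (\<bar>\<Delta> u \<omega> / h u\<bar> powr p) \<partial>N) \<le>
      (ennreal (2 powr p) * abs_normal_moment p) * ennreal ((sqrt (u * (1 - u)) / h u) powr p)" .
  qed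
  also have "\<dots> = ennreal (2 powr p) * abs_normal_moment p * (\<integral>\<^sup>+u. ennreal ((sqrt (u * (1 - u)) / h u) powr p) \<partial>unif01)"
    by (rule nn_integral_cmult) measurable
  finally show ?thesis .
qed

text \<open>As the variance \<open>s\<close> of \<open>\<Delta>\<close> vanishes at \<open>0\<close>, there are points \<open>u\<^sub>k\<close> decreasing to the left end
  of its support with \<open>s u\<^sub>k\<close> decreasing geometrically; there \<open>\<Delta>\<close> is asymptotically decorrelated.\<close>

lemma \<Delta>_changes_sign:
  assumes Kmono: "\<And>u v u' v'. u \<in> {0<..<1} \<Longrightarrow> v \<in> {0<..<1} \<Longrightarrow> u' \<in> {0<..<1} \<Longrightarrow> v' \<in> {0<..<1} \<Longrightarrow>
      u \<le> u' \<Longrightarrow> v \<le> v' \<Longrightarrow> K u v \<le> K u' v'"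
    and Klip: "\<And>u v. u \<in> {0<..<1} \<Longrightarrow> v \<in> {0<..<1} \<Longrightarrow> u \<le> v \<Longrightarrow> K v v - K u u \<le> 2 * (v - u)"
    and K0: "\<And>u v. 0 \<le> K u v" and u0: "u0 \<in> {0<..<1}" "K u0 u0 < u0" and c: "c = 1 \<or> c = (- 1 :: real)"
  shows "AE \<omega> in N. \<exists>u\<in>{0<..<1}. c * \<Delta> u \<omega> < 0"
proof -
  define s where "s u = 2 * u - 2 * K u u" for u
  have s_eq: "expectation (\<lambda>\<omega>. (\<Delta> u \<omega>)\<^sup>2) = s u" if "u \<in> {0<..<1}" for u
    using \<Delta>_covariance(2)[OF that that] by (simp add: s_def power2_eq_square)
  have s_lip: "\<bar>s u - s v\<bar> \<le> 4 * \<bar>u - v\<bar>" if "u \<in> {0<..<1}" "v \<in> {0<..<1}" for u v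
  proof -
    have *: "\<bar>s u - s v\<bar> \<le> 4 * \<bar>u - v\<bar>" if uv: "u \<in> {0<..<1}" "v \<in> {0<..<1}" "u \<le> v" for u v
    proof -
      have "0 \<le> K v v - K u u" using Kmono[of u u v v] uv by simp
      then have "s v - s u \<le> 4 * (v - u)" using uv(3) by (simp add: s_def)
      moreover have "s u - s v \<le> 4 * (v - u)" using Klip[OF uv] uv(3) by (simp add: s_def)
      ultimately have "\<bar>s u - s v\<bar> \<le> 4 * (v - u)" by (intro abs_leI) simp_all
      then show ?thesis using uv(3) by simp
    qed
    show ?thesis using *[of u v] *[of v u] that by (cases "u \<le> v") (auto simp: abs_minus_commute)
  qed
  have s_cont: "continuous_on {0<..<1} s"
    unfolding continuous_on_iff
  proof (intro ballI allI impI)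
    fix x e :: real assume x: "x \<in> {0<..<1}" "0 < e"
    show "\<exists>d>0. \<forall>x'\<in>{0<..<1}. dist x' x < d \<longrightarrow> dist (s x') (s x) < e"
    proof (intro exI[of _ "e / 4"] conjI ballI impI)
      fix x' assume x': "x' \<in> {0<..<1}" "dist x' x < e / 4"
      have "4 * \<bar>x' - x\<bar> < e" using x'(2) by (simp add: dist_real_def)
      then show "dist (s x') (s x) < e" unfolding dist_real_def by (rule le_less_trans[OF s_lip[OF x'(1) x(1)]])
    qed (use x in simp)
  qed
  have step: "\<exists>w. w \<in> {0<..<1} \<and> 0 < s w \<and> w < u \<and> s w = s u / 4" if u: "u \<in> {0<..<1}" "0 < s u" for u
  proof -
    \<comment> \<open>As \<open>s w \<le> 2 * w\<close>, this \<open>w\<close> has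
      \<open>s w \<le> s u / 4\<close>, and the intermediate value theorem finds a point between
      \<open>w\<close> and \<open>u\<close> with equality.\<close>
    define w where "w = s u / 8"
    have su: "s u \<le> 2 * u" using K0[of u u] by (simp add: s_def)
    have w: "w \<in> {0<..<1}" "w \<le> u" using u su by (auto simp: w_def)
    have "s w \<le> 2 * w" using K0[of w w] by (simp add: s_def)
    then have "s w \<le> s u / 4" by (simp add: w_def)
    moreover have "s u / 4 \<le> s u" using u by simp
    moreover have "continuous_on {w..u} s" by (rule continuous_on_subset[OF s_cont]) (use w u in auto)
    ultimately obtain x where x: "w \<le> x" "x \<le> u" "s x = s u / 4" using IVT'[of s w "s u / 4" u] w by auto
    then have "x \<noteq> u" using u by auto
    then show ?thesis using x w u by (intro exI[of _ x]) auto
  qed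
  define next_pt where "next_pt u = (SOME w. w \<in> {0<..<1} \<and> 0 < s w \<and> w < u \<and> s w = s u / 4)" for u
  have next_pt: "next_pt u \<in> {0<..<1}" "0 < s (next_pt u)" "next_pt u < u" "s (next_pt u) = s u / 4"
    if "u \<in> {0<..<1}" "0 < s u" for u
    using someI_ex[OF step[OF that]] unfolding next_pt_def by auto
  define U where "U k = (next_pt ^^ k) u0" for k
  have U0: "U k \<in> {0<..<1} \<and> 0 < s (U k)" for k
  proof (induction k)
    case 0 show ?case using u0 by (simp add: U_def s_def)
  next
    case (Suc k) then show ?case using next_pt[of "U k"] by (simp add: U_def)
  qed
  have U: "U k \<in> {0<..<1}" "0 < s (U k)" for k using U0 by auto
  have US: "U (Suc k) < U k" "s (U (Suc k)) = s (U k) / 4" for k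
    using next_pt[OF U[of k]] by (auto simp: U_def)
  have Us: "s (U (j + i)) = s (U j) * (1 / 4) ^ i \<and> U (j + i) \<le> U j" for i j
  proof (induction i)
    case (Suc i) then show ?case using US[of "j + i"] by auto
  qed simp
  \<comment> \<open>Normalization to unit variance; the sign \<open>c\<close> drops out of products
    since its square is 1, so both directions are treated at once.\<close>
  define Z where "Z k \<omega> = (c / sqrt (s (U k))) * \<Delta> (U k) \<omega>" for k \<omega>
  have c2: "c * c = 1" using c by auto
  have EZ: "expectation (\<lambda>\<omega>. Z j \<omega> * Z k \<omega>) = expectation (\<lambda>\<omega>. \<Delta> (U j) \<omega> * \<Delta> (U k) \<omega>) / (sqrt (s (U j)) * sqrt (s (U k)))" for j k
  proof -
    have "Z j \<omega> * Z k \<omega> = (c * c / (sqrt (s (U j)) * sqrt (s (U k)))) * (\<Delta> (U j) \<omega> * \<Delta> (U k) \<omega>)" for \<omega>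
      by (simp add: Z_def)
    then show ?thesis using c2 by simp
  qed
  have "prob {\<omega> \<in> space N. \<forall>k. 0 \<le> Z k \<omega>} = 0"
  proof (rule decorrelated_gaussian_not_nonneg)
    show "centered_gaussian N (Z k)" for k unfolding Z_def by (rule \<Delta>_gaussian[OF U(1)])
    show "expectation (\<lambda>\<omega>. (Z k \<omega>)\<^sup>2) = 1" for k
      using EZ[of k k] s_eq[OF U(1), of k] U(2)[of k] by (simp add: power2_eq_square)
    fix j k :: nat assume jk: "j < k"
    define i where "i = k - j"
    have k: "k = j + i" using jk by (simp add: i_def)
    have le: "U k \<le> U j" and sk: "s (U k) = s (U j) * (1 / 4) ^ i" using Us[of j i] k by auto
    \<comment> \<open>Replacing \<open>U j\<close> by the smaller \<open>U k\<close> decreases both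
      copula terms, so the covariance is at most the variance at \<open>U k\<close>. After
      normalization this is the ratio of standard deviations, \<open>1 / 2\<close> per step.\<close>
    have "expectation (\<lambda>\<omega>. \<Delta> (U j) \<omega> * \<Delta> (U k) \<omega>) = 2 * U k - K (U j) (U k) - K (U k) (U j)"
      using \<Delta>_covariance(2)[OF U(1) U(1), of j k] le by (simp add: min_def)
    also have "\<dots> \<le> s (U k)"
      using Kmono[OF U(1)[of k] U(1)[of k] U(1)[of j] U(1)[of k] le] Kmono[OF U(1)[of k] U(1)[of k] U(1)[of k] U(1)[of j] _ le]
      by (simp add: s_def)
    finally have "expectation (\<lambda>\<omega>. Z j \<omega> * Z k \<omega>) \<le> s (U k) / (sqrt (s (U j)) * sqrt (s (U k)))"
      unfolding EZ using U(2) by (intro divide_right_mono) (auto simp: less_imp_le)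
    also have "\<dots> = sqrt (s (U k)) / sqrt (s (U j))"
      using U(2)[of k] U(2)[of j] by (simp add: field_simps)
    also have "\<dots> = (1 / 2) ^ i"
    proof -
      have "sqrt ((1 / 4) ^ i) = (1 / 2 :: real) ^ i"
        by (rule real_sqrt_unique) (auto simp: power2_eq_square power_mult_distrib[symmetric])
      then show ?thesis unfolding sk real_sqrt_mult using U(2)[of j] by simp
    qed
    finally show "expectation (\<lambda>\<omega>. Z j \<omega> * Z k \<omega>) \<le> (1 / 2) ^ (k - j)" by (simp add: i_def)
  qed
  moreover have "{\<omega> \<in> space N. \<forall>k. 0 \<le> Z k \<omega>} \<in> events"
  proof -
    have [measurable]: "\<Delta> (U k) \<in> borel_measurable N" for k by (rule \<Delta>_measurable[OF U(1)])
    show ?thesis unfolding Z_def by measurable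
  qed
  ultimately have "AE \<omega> in N. \<not> (\<forall>k. 0 \<le> Z k \<omega>)"
    by (subst AE_iff_measurable[OF _ refl]) (auto simp: emeasure_eq_measure)
  then show ?thesis
  proof eventually_elim
    case (elim \<omega>)
    then obtain k where "Z k \<omega> < 0" by (auto simp: not_le)
    then have "c * \<Delta> (U k) \<omega> < 0" using U(2)[of k] by (simp add: Z_def divide_less_0_iff)
    then show ?case using U(1) by blast
  qed
qed

end

section \<open>The limit theorem\<close>

context iid_pairs begin

lemma H_mono: "x \<le> x' \<Longrightarrow> y \<le> y' \<Longrightarrow> H x y \<le> H x' y'"
proof -
  assume le: "x \<le> x'" "y \<le> y'"
  have [measurable]: "X 1 \<in> borel_measurable M" "Y 1 \<in> borel_measurable M"
    using X.X_measurable[of 1] Y.X_measurable[of 1] by auto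
  show ?thesis unfolding H using le by (intro finite_measure_mono) auto
qed

lemma H_nonneg: "0 \<le> H x y"
  unfolding H by simp

text \<open>The square grows from \<open>x\<close> to \<open>y\<close> by a subset of a vertical and
  a horizontal strip, each of probability \<open>F y - F x\<close>. This makes the variance of the
  difference of the bridges continuous.\<close>

lemma H_diag_lipschitz:
  assumes "x \<le> y"
  shows "H y y - H x x \<le> 2 * (F y - F x)"
proof -
  have [measurable]: "X 1 \<in> borel_measurable M" "Y 1 \<in> borel_measurable M"
    using X.X_measurable[of 1] Y.X_measurable[of 1] by auto
  have d: "prob {\<omega> \<in> space M. x < Z \<omega> \<and> Z \<omega> \<le> y} = prob {\<omega> \<in> space M. Z \<omega> \<le> y} - prob {\<omega> \<in> space M. Z \<omega> \<le> x}"
    if [measurable]: "Z \<in> borel_measurable M" for Z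
  proof -
    have "{\<omega> \<in> space M. x < Z \<omega> \<and> Z \<omega> \<le> y} = {\<omega> \<in> space M. Z \<omega> \<le> y} - {\<omega> \<in> space M. Z \<omega> \<le> x}" by auto
    then have "prob {\<omega> \<in> space M. x < Z \<omega> \<and> Z \<omega> \<le> y} = prob ({\<omega> \<in> space M. Z \<omega> \<le> y} - {\<omega> \<in> space M. Z \<omega> \<le> x})"
      by (rule arg_cong)
    also have "\<dots> = prob {\<omega> \<in> space M. Z \<omega> \<le> y} - prob {\<omega> \<in> space M. Z \<omega> \<le> x}"
      by (rule finite_measure_Diff) (use assms in auto)
    finally show ?thesis .
  qed
  have "H y y \<le> prob ({\<omega> \<in> space M. X 1 \<omega> \<le> x \<and> Y 1 \<omega> \<le> x} \<union>
      ({\<omega> \<in> space M. x < X 1 \<omega> \<and> X 1 \<omega> \<le> y} \<union> {\<omega> \<in> space M. x < Y 1 \<omega> \<and> Y 1 \<omega> \<le> y}))"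
    unfolding H by (intro finite_measure_mono) auto
  also have "\<dots> \<le> H x x + prob ({\<omega> \<in> space M. x < X 1 \<omega> \<and> X 1 \<omega> \<le> y} \<union> {\<omega> \<in> space M. x < Y 1 \<omega> \<and> Y 1 \<omega> \<le> y})"
    unfolding H by (rule measure_Un_le) measurable
  also have "prob ({\<omega> \<in> space M. x < X 1 \<omega> \<and> X 1 \<omega> \<le> y} \<union> {\<omega> \<in> space M. x < Y 1 \<omega> \<and> Y 1 \<omega> \<le> y}) \<le>
    prob {\<omega> \<in> space M. x < X 1 \<omega> \<and> X 1 \<omega> \<le> y} + prob {\<omega> \<in> space M. x < Y 1 \<omega> \<and> Y 1 \<omega> \<le> y}"
    by (rule measure_Un_le) measurable
  also have "\<dots> = 2 * (F y - F x)"
    using d[of "X 1"] d[of "Y 1"] X.prob_X_le[of 1] Y.prob_X_le[of 1] by simp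
  finally show ?thesis by simp
qed

end

section \<open>Regularity of the marginal quantile function\<close>

locale regular_pairs = iid_pairs M X Y F H for M :: "'a measure" and X Y F H +
  fixes f h :: "real \<Rightarrow> real"
  assumes density: "\<And>x. x \<in> {0<..<1} \<Longrightarrow> (F has_real_derivative f x) (at x)"
    "\<And>x. x \<in> {0<..<1} \<Longrightarrow> 0 < f x" "\<And>x. x \<in> {0<..<1} \<Longrightarrow> f differentiable (at x)"
    and quantile_range: "quantile F ` {0<..<1} \<subseteq> {0<..<1}"
    and h: "\<And>u. h u = f (quantile F u)"
begin

abbreviation Q :: "real \<Rightarrow> real" where "Q \<equiv> quantile F"

lemma Q_range: "u \<in> {0<..<1} \<Longrightarrow> Q u \<in> {0<..<1}"
  using quantile_range by blast

lemma Q_le_iff: "u \<in> {0<..<1} \<Longrightarrow> Q u \<le> x \<longleftrightarrow> u \<le> F x"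
  using X.quantile_F_le_iff by simp

lemma F_strict_mono:
  assumes "x \<in> {0<..<1}" "y \<in> {0<..<1}" "x < y"
  shows "F x < F y"
proof (rule DERIV_pos_imp_increasing[OF assms(3)])
  fix z assume "x \<le> z" "z \<le> y"
  then have "z \<in> {0<..<1}" using assms by auto
  then show "\<exists>d. (F has_real_derivative d) (at z) \<and> 0 < d" using density(1,2) by blast
qed

text \<open>One inequality is the Galois connection. For the other, \<open>F\<close> is continuous
  at \<open>Q u\<close>, so a strict excess would persist slightly to the left and contradict the
  choice of \<open>Q u\<close>.\<close>

lemma F_Q: assumes u: "u \<in> {0<..<1}" shows "F (Q u) = u"
proof (rule antisym)
  show "u \<le> F (Q u)" using Q_le_iff[OF u, of "Q u"] by simp
  show "F (Q u) \<le> u"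
  proof (rule ccontr)
    assume "\<not> F (Q u) \<le> u"
    have "isCont F (Q u)" using density(1)[OF Q_range[OF u]] by (rule DERIV_isCont)
    then have "(F \<longlongrightarrow> F (Q u)) (at_left (Q u))" unfolding isCont_def by (rule tendsto_within_subset) simp
    then have "eventually (\<lambda>x. u < F x) (at_left (Q u))" by (rule order_tendstoD) (use \<open>\<not> F (Q u) \<le> u\<close> in simp)
    moreover have "eventually (\<lambda>x. x < Q u) (at_left (Q u))" by (simp add: eventually_at_left_field) (meson lt_ex)
    ultimately have "eventually (\<lambda>x. u < F x \<and> x < Q u) (at_left (Q u))" by eventually_elim simp
    then obtain x where "u < F x" "x < Q u" using eventually_happens'[OF trivial_limit_at_left_real] by blast
    then show False using Q_le_iff[OF u, of x] by simp
  qed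
qed

lemma F_0: "F 0 = 0"
proof (rule ccontr)
  assume "F 0 \<noteq> 0"
  then have "0 < F 0" using X.F_bounds(1)[of 0] by simp
  then have "min (F 0) (1 / 2) \<in> {0<..<1}" by auto
  then show False using Q_le_iff[of "min (F 0) (1 / 2)" 0] Q_range[of "min (F 0) (1 / 2)"] by simp
qed

lemma F_range: assumes x: "x \<in> {0<..<1}" shows "F x \<in> {0<..<1}"
proof -
  have "F (x / 2) < F x" "F x < F ((1 + x) / 2)" using x by (auto intro!: F_strict_mono)
  then show ?thesis using X.F_bounds(1)[of "x / 2"] X.F_bounds(2)[of "(1 + x) / 2"] by simp
qed

lemma Q_F: assumes x: "x \<in> {0<..<1}" shows "Q (F x) = x"
proof (rule ccontr)
  assume "Q (F x) \<noteq> x"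
  moreover have "Q (F x) \<le> x" using Q_le_iff[OF F_range[OF x]] by simp
  ultimately have "Q (F x) < x" by simp
  then have "F (Q (F x)) < F x" by (intro F_strict_mono Q_range F_range x)
  then show False using F_Q[OF F_range[OF x]] by simp
qed

lemma Q_mono: assumes "u \<in> {0<..<1}" "v \<in> {0<..<1}" "u \<le> v" shows "Q u \<le> Q v"
  using Q_le_iff[OF assms(1), of "Q v"] F_Q[OF assms(2)] assms(3) by simp

lemma isCont_Q: assumes u: "u \<in> {0<..<1}" shows "isCont Q u"
  unfolding isCont_def
proof (rule order_tendstoI)
  have u': "eventually (\<lambda>v. v \<in> {0<..<1}) (at u)" using u by (intro eventually_at_in_open') auto
  have cF: "eventually (\<lambda>v. v < b) (at u)" if "u < b" for b using that by (intro order_tendstoD(2)[OF tendsto_ident_at])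
  have cF': "eventually (\<lambda>v. a < v) (at u)" if "a < u" for a using that by (intro order_tendstoD(1)[OF tendsto_ident_at])
  fix y
  show "eventually (\<lambda>v. y < Q v) (at u)" if y: "y < Q u"
  proof -
    \<comment> \<open>The comparison point is moved into \<open>(0,1)\<close>, where
      \<open>F\<close> is strictly increasing.\<close>
    define y' where "y' = max y (Q u / 2)"
    have y': "y' \<in> {0<..<1}" "y' < Q u" "y \<le> y'" using y Q_range[OF u] by (auto simp: y'_def)
    have "F y' < u" using F_strict_mono[OF y'(1) Q_range[OF u] y'(2)] F_Q[OF u] by simp
    from cF'[OF this] u' show ?thesis
    proof eventually_elim
      case (elim v)
      then show ?case using Q_le_iff[OF elim(2), of y'] y' by simp
    qed
  qed
  show "eventually (\<lambda>v. Q v < y) (at u)" if y: "Q u < y"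
  proof -
    define y' where "y' = min ((Q u + y) / 2) ((1 + Q u) / 2)"
    have y': "y' \<in> {0<..<1}" "Q u < y'" "y' < y" using y Q_range[OF u] by (auto simp: y'_def min_def)
    have "u < F y'" using F_strict_mono[OF Q_range[OF u] y'(1,2)] F_Q[OF u] by simp
    from cF[OF this] u' show ?thesis
    proof eventually_elim
      case (elim v)
      then show ?case using Q_le_iff[OF elim(2), of y'] y' by simp
    qed
  qed
qed

lemma h_pos: "u \<in> {0<..<1} \<Longrightarrow> 0 < h u"
  unfolding h using density(2) Q_range by blast

lemma continuous_on_h: "continuous_on {0<..<1} h"
proof (intro continuous_at_imp_continuous_on ballI)
  fix u :: real assume u: "u \<in> {0<..<1}"
  have "isCont f (Q u)" using density(3)[OF Q_range[OF u]] by (rule differentiable_imp_continuous_within)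
  then have "isCont (\<lambda>u. f (Q u)) u" by (rule isCont_o2[OF isCont_Q[OF u]])
  then show "isCont h u" by (simp add: h[abs_def])
qed

text \<open>The inverse function rule. It identifies the derivative in the Hardy inequality with
  \<open>1 / h\<close>, so its right-hand side becomes the integral in the hypothesis on
  \<open>b'\<close>.\<close>

lemma Q_deriv: assumes u: "u \<in> {0<..<1}" shows "(Q has_real_derivative inverse (h u)) (at u)"
  unfolding h
proof (rule DERIV_inverse_function[where f = F and a = 0 and b = 1])
  show "(F has_real_derivative f (Q u)) (at (Q u))" by (rule density(1)[OF Q_range[OF u]])
  show "f (Q u) \<noteq> 0" using density(2)[OF Q_range[OF u]] by simp
qed (use u F_Q isCont_Q in auto)

lemma AE_in_unit: "AE \<omega> in M. \<forall>i\<ge>1. X i \<omega> \<in> {0<..<1} \<and> Y i \<omega> \<in> {0<..<1}"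
proof -
  have one: "AE \<omega> in M. Z \<omega> \<in> {0<..<1}"
    if [measurable]: "Z \<in> borel_measurable M" and Z: "\<And>x. prob {\<omega> \<in> space M. Z \<omega> \<le> x} = F x" for Z
  proof -
    have le0: "AE \<omega> in M. \<not> Z \<omega> \<le> 0"
      using Z[of 0] F_0 by (subst AE_iff_measurable[OF _ refl]) (auto simp: emeasure_eq_measure)
    have "1 \<le> prob {\<omega> \<in> space M. Z \<omega> < 1}"
    \<comment> \<open>Every \<open>u < 1\<close> is the probability of lying below
      \<open>Q u\<close>, and \<open>Q u < 1\<close>.\<close>
    proof (rule dense_le_bounded[of 0])
      fix u :: real assume "0 < u" "u < 1"
      then have u: "u \<in> {0<..<1}" by simp
      have "u = prob {\<omega> \<in> space M. Z \<omega> \<le> Q u}" using Z[of "Q u"] F_Q[OF u] by simp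
      also have "\<dots> \<le> prob {\<omega> \<in> space M. Z \<omega> < 1}" using Q_range[OF u] by (intro finite_measure_mono) auto
      finally show "u \<le> prob {\<omega> \<in> space M. Z \<omega> < 1}" .
    qed simp
    then have "prob {\<omega> \<in> space M. Z \<omega> < 1} = 1" using prob_le_1 by (intro antisym) auto
    then have "AE \<omega> in M. Z \<omega> < 1" by (subst (asm) prob_Collect_eq_1) auto
    with le0 show ?thesis by eventually_elim auto
  qed
  have "AE \<omega> in M. i \<ge> 1 \<longrightarrow> X i \<omega> \<in> {0<..<1} \<and> Y i \<omega> \<in> {0<..<1}" for i
  proof (cases "i \<ge> 1")
    case True
    from one[OF X.X_measurable[OF True] X.prob_X_le[OF True]] one[OF Y.X_measurable[OF True] Y.prob_X_le[OF True]]
    show ?thesis by eventually_elim simp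
  qed simp
  then show ?thesis by (simp add: AE_all_countable)
qed

lemma sample_quantile_in_unit:
  assumes n: "1 \<le> n" and u: "u \<in> {0<..<1}" and Z: "\<And>i. i \<ge> 1 \<Longrightarrow> Z i \<omega> \<in> {0<..<1}"
  shows "0 \<le> quantile (ecdf Z n \<omega>) u" "quantile (ecdf Z n \<omega>) u \<le> 1"
proof -
  have u': "0 < u" "u < 1" using u by auto
  have "{i \<in> {1..n}. Z i \<omega> \<le> 1} = {1..n}" using Z by (auto simp: less_imp_le)
  then have "ecdf Z n \<omega> 1 = 1" using n by (simp add: ecdf_def)
  then show "quantile (ecdf Z n \<omega>) u \<le> 1" using u' by (subst sample_quantile_le_iff[OF n u']) simp
  show "0 \<le> quantile (ecdf Z n \<omega>) u"
  proof (rule ccontr)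
    let ?x = "quantile (ecdf Z n \<omega>) u"
    assume "\<not> 0 \<le> ?x"
    then have "{i \<in> {1..n}. Z i \<omega> \<le> ?x} = {}" using Z by force
    then have "ecdf Z n \<omega> ?x = 0" unfolding ecdf_def by (simp only: card.empty of_nat_0 div_0)
    then show False using sample_quantile_le_iff[OF n u', of Z \<omega> ?x] u' by simp
  qed
qed

text \<open>This is the range on which the Potter bound for the scaled cost is available.\<close>

lemma quantile_diff_bounded: "AE \<omega> in M. \<forall>u\<in>{0<..<1}. \<bar>quantile_diff n u \<omega>\<bar> \<le> sqrt (real n)"
proof (cases "1 \<le> n")
  case True
  show ?thesis using AE_in_unit
  proof eventually_elim
    case (elim \<omega>)
    show ?case
    proof
      fix u :: real assume u: "u \<in> {0<..<1}"
      have "\<bar>quantile (ecdf X n \<omega>) u - quantile (ecdf Y n \<omega>) u\<bar> \<le> 1"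
        using sample_quantile_in_unit[OF True u, of X \<omega>] sample_quantile_in_unit[OF True u, of Y \<omega>] elim by auto
      then show "\<bar>quantile_diff n u \<omega>\<bar> \<le> sqrt (real n)"
        by (simp add: quantile_diff_def abs_mult mult_left_le)
    qed
  qed
next
  case False
  then have "n = 0" by simp
  then show ?thesis by (simp add: quantile_diff_def)
qed

text \<open>Both sample quantiles are centred at the same \<open>m u\<close> and bounded separately.
  The factor \<open>sqrt n\<close> is compensated by \<open>1 / sqrt (n + 1)\<close> in
  \<open>hardy_const\<close>, so the bound does not depend on \<open>n\<close>. For
  \<open>n = 0\<close> the difference is zero through its factor \<open>sqrt 0\<close>.\<close>

lemma quantile_diff_moment:
  assumes p: "1 < p"
  shows "(\<integral>\<^sup>+\<omega>. (\<integral>\<^sup>+u. ennreal (\<bar>quantile_diff n u \<omega>\<bar> powr p) \<partial>unif01) \<partial>M) \<le>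
    ennreal (2 powr p * (8 * p * (2 * p) powr (p - 1) * 3 powr p)) *
      (\<integral>\<^sup>+u. ennreal ((sqrt (u * (1 - u)) / h u) powr p) \<partial>unif01)"
proof (cases "1 \<le> n")
  case False
  then have "n = 0" by simp
  then show ?thesis using p by (simp add: quantile_diff_def)
next
  case True
  note n = True
  interpret U: prob_space unif01 by (rule prob_space_unif01)
  interpret PS: pair_sigma_finite M unif01 ..
  let ?J = "\<integral>\<^sup>+u. ennreal ((sqrt (u * (1 - u)) / h u) powr p) \<partial>unif01"
  define m where "m u = Q (real (nat \<lceil>real n * u\<rceil>) / real (Suc n))" for u
  have sq: "(\<integral>\<^sup>+u. (\<integral>\<^sup>+\<omega>. ennreal (\<bar>quantile (ecdf Z n \<omega>) u - m u\<bar> powr p) \<partial>M) \<partial>unif01) \<le> 2 * ennreal (hardy_const n p) * ?J"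
    if Z: "iid_sample M Z F" for Z
  proof -
    interpret Z: iid_sample M Z F by fact
    have "(\<integral>\<^sup>+u\<in>{0<..<1}. (\<integral>\<^sup>+\<omega>. ennreal (\<bar>quantile (ecdf Z n \<omega>) u - m u\<bar> powr p) \<partial>M) \<partial>lborel)
      \<le> 2 * ennreal (hardy_const n p) * (\<integral>\<^sup>+s\<in>{0<..<1}. ennreal ((sqrt (s * (1 - s)) * inverse (h s)) powr p) \<partial>lborel)"
      unfolding m_def using h_pos
      by (intro Z.sample_quantile_moment n p Q_deriv continuous_on_inverse continuous_on_h) (auto simp: less_imp_neq[symmetric] dest: less_imp_neq)
    then show ?thesis by (simp add: nn_integral_unif01 divide_inverse)
  qed
  have pw: "\<bar>quantile_diff n u \<omega>\<bar> powr p \<le>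
     (2 * sqrt (real n)) powr p * (\<bar>quantile (ecdf X n \<omega>) u - m u\<bar> powr p + \<bar>quantile (ecdf Y n \<omega>) u - m u\<bar> powr p)" for u \<omega>
  proof -
    let ?a = "\<bar>quantile (ecdf X n \<omega>) u - m u\<bar>" and ?b = "\<bar>quantile (ecdf Y n \<omega>) u - m u\<bar>"
    have "\<bar>quantile_diff n u \<omega>\<bar> \<le> (2 * sqrt (real n)) * max ?a ?b"
    proof -
      have "\<bar>quantile (ecdf X n \<omega>) u - quantile (ecdf Y n \<omega>) u\<bar> \<le> ?a + ?b"
        using abs_triangle_ineq4[of "quantile (ecdf X n \<omega>) u - m u" "quantile (ecdf Y n \<omega>) u - m u"] by simp
      also have "\<dots> \<le> 2 * max ?a ?b" by (simp add: max_def)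
      finally have "\<bar>quantile (ecdf X n \<omega>) u - quantile (ecdf Y n \<omega>) u\<bar> \<le> 2 * max ?a ?b" .
      then have "sqrt (real n) * \<bar>quantile (ecdf X n \<omega>) u - quantile (ecdf Y n \<omega>) u\<bar> \<le> sqrt (real n) * (2 * max ?a ?b)"
        by (intro mult_left_mono) auto
      then show ?thesis by (simp add: quantile_diff_def abs_mult)
    qed
    then have "\<bar>quantile_diff n u \<omega>\<bar> powr p \<le> ((2 * sqrt (real n)) * max ?a ?b) powr p"
      using p by (intro powr_mono2) auto
    also have "\<dots> = (2 * sqrt (real n)) powr p * max ?a ?b powr p" by (subst powr_mult) auto
    also have "max ?a ?b powr p \<le> ?a powr p + ?b powr p" by (auto simp: max_def)
    finally show ?thesis by (simp add: mult_left_mono)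
  qed
  have qm: "(\<lambda>(\<omega>, u). quantile (ecdf Z n \<omega>) u) \<in> borel_measurable (M \<Otimes>\<^sub>M unif01)"
    if Z: "iid_sample M Z F" for Z
    using iid_sample.X_measurable[OF Z] by (intro sample_quantile_measurable n) auto
  have mm: "m \<in> borel_measurable unif01"
  proof -
    have [measurable]: "(\<lambda>u. u) \<in> borel_measurable unif01" by (intro measurable_restrict_space1) simp
    have "(\<lambda>u. nat \<lceil>real n * u\<rceil>) \<in> measurable unif01 (count_space UNIV)" by measurable
    then show ?thesis unfolding m_def by (rule measurable_compose) simp
  qed
  have sm: "(\<lambda>u. \<integral>\<^sup>+\<omega>. ennreal (\<bar>quantile (ecdf Z n \<omega>) u - m u\<bar> powr p) \<partial>M) \<in> borel_measurable unif01"
    and sm2: "\<And>u. u \<in> {0<..<1} \<Longrightarrow> (\<lambda>\<omega>. ennreal (\<bar>quantile (ecdf Z n \<omega>) u - m u\<bar> powr p)) \<in> borel_measurable M"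
    if Z: "iid_sample M Z F" for Z
  proof -
    have "(\<lambda>z. quantile (ecdf Z n (snd z)) (fst z)) \<in> borel_measurable (unif01 \<Otimes>\<^sub>M M)"
      using measurable_pair_swap[OF qm[OF Z]] by (simp add: split_beta')
    then have "(\<lambda>(u, \<omega>). ennreal (\<bar>quantile (ecdf Z n \<omega>) u - m u\<bar> powr p)) \<in> borel_measurable (unif01 \<Otimes>\<^sub>M M)"
      using measurable_compose[OF measurable_fst mm, of M] unfolding split_beta' by measurable
    then show "(\<lambda>u. \<integral>\<^sup>+\<omega>. ennreal (\<bar>quantile (ecdf Z n \<omega>) u - m u\<bar> powr p) \<partial>M) \<in> borel_measurable unif01"
      by (rule borel_measurable_nn_integral)
    show "(\<lambda>\<omega>. ennreal (\<bar>quantile (ecdf Z n \<omega>) u - m u\<bar> powr p)) \<in> borel_measurable M" if "u \<in> {0<..<1}" for u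
      using iid_sample.sample_quantile_measurable1[OF Z n that] by measurable
  qed
  let ?I = "\<lambda>Z u. \<integral>\<^sup>+\<omega>. ennreal (\<bar>quantile (ecdf Z n \<omega>) u - m u\<bar> powr p) \<partial>M"
  have jm: "(\<lambda>(\<omega>, u). ennreal (\<bar>quantile_diff n u \<omega>\<bar> powr p)) \<in> borel_measurable (M \<Otimes>\<^sub>M unif01)"
    using quantile_diff_measurable[of n] unfolding split_beta' by measurable
  have "(\<integral>\<^sup>+\<omega>. (\<integral>\<^sup>+u. ennreal (\<bar>quantile_diff n u \<omega>\<bar> powr p) \<partial>unif01) \<partial>M) =
    (\<integral>\<^sup>+u. (\<integral>\<^sup>+\<omega>. ennreal (\<bar>quantile_diff n u \<omega>\<bar> powr p) \<partial>M) \<partial>unif01)"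
    using PS.Fubini'[of "\<lambda>\<omega> u. ennreal (\<bar>quantile_diff n u \<omega>\<bar> powr p)"] jm by simp
  also have "\<dots> \<le> (\<integral>\<^sup>+u. ennreal ((2 * sqrt (real n)) powr p) * (?I X u + ?I Y u) \<partial>unif01)"
  proof (intro nn_integral_mono)
    fix u assume "u \<in> space unif01"
    then have u: "u \<in> {0<..<1}" by (simp add: space_restrict_space)
    note m1 = sm2[OF X.iid_sample_axioms u] sm2[OF Y.iid_sample_axioms u]
    have "(\<integral>\<^sup>+\<omega>. ennreal (\<bar>quantile_diff n u \<omega>\<bar> powr p) \<partial>M) \<le> (\<integral>\<^sup>+\<omega>. ennreal ((2 * sqrt (real n)) powr p) *
      (ennreal (\<bar>quantile (ecdf X n \<omega>) u - m u\<bar> powr p) + ennreal (\<bar>quantile (ecdf Y n \<omega>) u - m u\<bar> powr p)) \<partial>M)"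
      using pw by (intro nn_integral_mono) (simp add: ennreal_mult[symmetric] ennreal_plus[symmetric] del: ennreal_plus)
    also have "\<dots> = ennreal ((2 * sqrt (real n)) powr p) * (?I X u + ?I Y u)"
      using m1 by (simp add: nn_integral_cmult nn_integral_add)
    finally show "(\<integral>\<^sup>+\<omega>. ennreal (\<bar>quantile_diff n u \<omega>\<bar> powr p) \<partial>M) \<le> ennreal ((2 * sqrt (real n)) powr p) * (?I X u + ?I Y u)" .
  qed
  also have "\<dots> = ennreal ((2 * sqrt (real n)) powr p) * ((\<integral>\<^sup>+u. ?I X u \<partial>unif01) + (\<integral>\<^sup>+u. ?I Y u \<partial>unif01))"
    using sm[OF X.iid_sample_axioms] sm[OF Y.iid_sample_axioms] by (simp add: nn_integral_cmult nn_integral_add)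
  also have "\<dots> \<le> ennreal ((2 * sqrt (real n)) powr p) * (2 * ennreal (hardy_const n p) * ?J + 2 * ennreal (hardy_const n p) * ?J)"
    by (intro mult_left_mono add_mono sq X.iid_sample_axioms Y.iid_sample_axioms) simp
  also have "\<dots> = ennreal ((2 * sqrt (real n)) powr p * (4 * hardy_const n p)) * ?J"
  proof -
    have "2 * ennreal (hardy_const n p) * ?J + 2 * ennreal (hardy_const n p) * ?J = ennreal (4 * hardy_const n p) * ?J"
      using hardy_const_nonneg[OF p, of n] by (simp add: ennreal_mult ring_distribs[symmetric] mult_2[symmetric] mult.assoc[symmetric])
    then show ?thesis using hardy_const_nonneg[OF p, of n] by (simp add: ennreal_mult mult.assoc)
  qed
  also have "\<dots> \<le> ennreal (2 powr p * (8 * p * (2 * p) powr (p - 1) * 3 powr p)) * ?J"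
  proof (intro mult_right_mono ennreal_leI)
    have s: "(sqrt (real n)) powr p * (3 / sqrt (real (Suc n))) powr p \<le> 3 powr p"
    proof -
      have "sqrt (real n) * (3 / sqrt (real (Suc n))) \<le> 3" by (simp add: divide_le_eq)
      then have "(sqrt (real n) * (3 / sqrt (real (Suc n)))) powr p \<le> 3 powr p" using p by (intro powr_mono2) auto
      then show ?thesis by (subst (asm) powr_mult) auto
    qed
    have "(2 * sqrt (real n)) powr p * (4 * hardy_const n p) =
      (2 powr p * (8 * p * (2 * p) powr (p - 1))) * ((sqrt (real n)) powr p * (3 / sqrt (real (Suc n))) powr p)"
      unfolding hardy_const_def by (subst powr_mult) auto
    also have "\<dots> \<le> (2 powr p * (8 * p * (2 * p) powr (p - 1))) * 3 powr p"
      using p s by (intro mult_left_mono) auto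
    finally show "(2 * sqrt (real n)) powr p * (4 * hardy_const n p) \<le> 2 powr p * (8 * p * (2 * p) powr (p - 1) * 3 powr p)"
      by (simp add: mult.assoc)
  qed simp
  finally show ?thesis .
qed

text \<open>Otherwise \<open>H r r = F r\<close> for all \<open>r\<close> in \<open>(0,1)\<close>,
  so almost surely no such \<open>r\<close> separates \<open>X 1\<close> from \<open>Y 1\<close>.
  Letting \<open>r\<close> run through the rationals forces the two to coincide almost
  surely.\<close>

lemma exists_non_diagonal:
  assumes "prob {\<omega> \<in> space M. X 1 \<omega> = Y 1 \<omega>} < 1"
  shows "\<exists>u\<in>{0<..<1}. H (Q u) (Q u) < u"
proof (rule ccontr)
  assume "\<not> ?thesis"
  then have le: "u \<le> H (Q u) (Q u)" if "u \<in> {0<..<1}" for u using that by (auto simp: not_less)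
  have [measurable]: "X 1 \<in> borel_measurable M" "Y 1 \<in> borel_measurable M"
    using X.X_measurable[of 1] Y.X_measurable[of 1] by auto
  have sep: "AE \<omega> in M. \<not> (Z \<omega> \<le> r \<and> r < W \<omega>)"
    if r: "r \<in> {0<..<1}" and ZW [measurable]: "Z \<in> borel_measurable M" "W \<in> borel_measurable M"
      and Z: "prob {\<omega> \<in> space M. Z \<omega> \<le> r} = F r" and H: "prob {\<omega> \<in> space M. Z \<omega> \<le> r \<and> W \<omega> \<le> r} = H r r" for r Z W
  proof -
    have "F r \<le> H r r" using le[OF F_range[OF r]] Q_F[OF r] by simp
    have "{\<omega> \<in> space M. Z \<omega> \<le> r \<and> r < W \<omega>} = {\<omega> \<in> space M. Z \<omega> \<le> r} - {\<omega> \<in> space M. Z \<omega> \<le> r \<and> W \<omega> \<le> r}" by auto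
    then have "prob {\<omega> \<in> space M. Z \<omega> \<le> r \<and> r < W \<omega>} = F r - H r r"
      unfolding Z[symmetric] H[symmetric] by (simp only:) (rule finite_measure_Diff, auto)
    then have "prob {\<omega> \<in> space M. Z \<omega> \<le> r \<and> r < W \<omega>} = 0" using \<open>F r \<le> H r r\<close> measure_nonneg[of M "{\<omega> \<in> space M. Z \<omega> \<le> r \<and> r < W \<omega>}"] by linarith
    then show ?thesis by (subst AE_iff_measurable[OF _ refl]) (auto simp: emeasure_eq_measure)
  qed
  have "AE \<omega> in M. \<not> (X 1 \<omega> \<le> r \<and> r < Y 1 \<omega>) \<and> \<not> (Y 1 \<omega> \<le> r \<and> r < X 1 \<omega>)" if r: "r \<in> {0<..<1}" for r
  proof -
    have "{\<omega> \<in> space M. Y 1 \<omega> \<le> r \<and> X 1 \<omega> \<le> r} = {\<omega> \<in> space M. X 1 \<omega> \<le> r \<and> Y 1 \<omega> \<le> r}" by auto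
    then have "prob {\<omega> \<in> space M. Y 1 \<omega> \<le> r \<and> X 1 \<omega> \<le> r} = H r r" unfolding H by (rule arg_cong)
    from sep[OF r X.X_measurable Y.X_measurable X.prob_X_le H[symmetric]]
      sep[OF r Y.X_measurable X.X_measurable Y.prob_X_le this]
    have "AE \<omega> in M. \<not> (X 1 \<omega> \<le> r \<and> r < Y 1 \<omega>)" "AE \<omega> in M. \<not> (Y 1 \<omega> \<le> r \<and> r < X 1 \<omega>)"
      by (simp_all only: order_refl)
    then show ?thesis by eventually_elim simp
  qed
  then have "AE \<omega> in M. \<forall>r\<in>{0<..<1} \<inter> \<rat>. \<not> (X 1 \<omega> \<le> r \<and> r < Y 1 \<omega>) \<and> \<not> (Y 1 \<omega> \<le> r \<and> r < X 1 \<omega>)"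
    by (subst AE_ball_countable) (auto intro: countable_subset[OF _ countable_rat])
  with AE_in_unit have "AE \<omega> in M. X 1 \<omega> = Y 1 \<omega>"
  proof eventually_elim
    case (elim \<omega>)
    then have in01: "X 1 \<omega> \<in> {0<..<1}" "Y 1 \<omega> \<in> {0<..<1}" by auto
    have no: "\<not> a < b" if ab: "a \<in> {0<..<1}" "b \<in> {0<..<1}" and *: "\<And>r. r \<in> {0<..<1} \<inter> \<rat> \<Longrightarrow> \<not> (a \<le> r \<and> r < b)" for a b :: real
    proof
      assume "a < b"
      then obtain r where "r \<in> \<rat>" "a < r" "r < b" using Rats_dense_in_real by blast
      then show False using *[of r] ab by auto
    qed
    have "\<not> X 1 \<omega> < Y 1 \<omega>" "\<not> Y 1 \<omega> < X 1 \<omega>" using no[OF in01] no[OF in01(2,1)] elim(2) by blast+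
    then show ?case by simp
  qed
  then have "prob {\<omega> \<in> space M. X 1 \<omega> = Y 1 \<omega>} = 1" by (subst prob_Collect_eq_1) auto
  then show False using assms by simp
qed

end


section \<open>The limit functional and the final assembly\<close>

lemma (in admissible_cost) scaled_cost_measurable: "scaled_cost n \<in> borel_measurable borel"
proof -
  have "continuous_on UNIV \<rho>c" by (rule convex_on_continuous[OF open_UNIV convex])
  then have [measurable]: "\<rho>c \<in> borel_measurable borel" by (rule borel_measurable_continuous_onI)
  show ?thesis unfolding scaled_cost_def[abs_def] by measurable
qed

lemma (in admissible_cost) limit_cost_measurable: "limit_cost bneg bpos \<pi>neg \<pi>pos \<in> borel_measurable borel"
  using b_ge_1 by (intro borel_measurable_continuous_onI continuous_on_limit_cost) auto

lemma (in admissible_cost) limit_functional_eq: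
  assumes b: "b \<in> borel_measurable unif01"
  shows "limit_functional bneg bpos \<pi>neg \<pi>pos b = (\<integral>\<^sup>+u. ennreal (limit_cost bneg bpos \<pi>neg \<pi>pos (b u)) \<partial>unif01)"
proof -
  note [measurable] = b
  have neg: "(\<integral>\<^sup>+u\<in>{0<..<1}. indicator {u. b u < 0} u * ennreal (\<bar>b u\<bar> powr bneg) \<partial>lborel) = (\<integral>\<^sup>+u. ennreal (max 0 (- b u) powr bneg) \<partial>unif01)"
    unfolding nn_integral_unif01 by (intro nn_integral_cong) (auto split: split_indicator simp: max_def)
  have pos: "(\<integral>\<^sup>+u\<in>{0<..<1}. indicator {u. b u > 0} u * ennreal (\<bar>b u\<bar> powr bpos) \<partial>lborel) = (\<integral>\<^sup>+u. ennreal (max 0 (b u) powr bpos) \<partial>unif01)"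
    unfolding nn_integral_unif01 by (intro nn_integral_cong) (auto split: split_indicator simp: max_def)
  have "limit_functional bneg bpos \<pi>neg \<pi>pos b =
     (\<integral>\<^sup>+u. ennreal \<pi>neg * ennreal (max 0 (- b u) powr bneg) + ennreal \<pi>pos * ennreal (max 0 (b u) powr bpos) \<partial>unif01)"
    unfolding limit_functional_def neg pos by (subst nn_integral_add) (auto simp: nn_integral_cmult)
  also have "\<dots> = (\<integral>\<^sup>+u. ennreal (limit_cost bneg bpos \<pi>neg \<pi>pos (b u)) \<partial>unif01)"
    unfolding limit_cost_def using \<pi>neg \<pi>pos by (intro nn_integral_cong) (simp add: ennreal_mult)
  finally show ?thesis .
qed

text \<open>It is not known which of the weights equals 1, hence both signs are required. By
  continuity the path has the relevant sign on a nonempty open set, which has positive Lebesgue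
  measure.\<close>

lemma (in admissible_cost) limit_functional_pos:
  assumes b: "b \<in> borel_measurable unif01" "continuous_on {0<..<1} b"
    and neg: "\<exists>u\<in>{0<..<1}. b u < 0" and pos: "\<exists>u\<in>{0<..<1}. 0 < b u"
  shows "0 < limit_functional bneg bpos \<pi>neg \<pi>pos b"
proof (rule ccontr)
  assume "\<not> ?thesis"
  then have "(\<integral>\<^sup>+u. ennreal (limit_cost bneg bpos \<pi>neg \<pi>pos (b u)) \<partial>unif01) = 0"
    by (simp add: limit_functional_eq[OF b(1)])
  then have "AE u in unif01. ennreal (limit_cost bneg bpos \<pi>neg \<pi>pos (b u)) = 0"
    using measurable_compose[OF b(1) limit_cost_measurable] by (subst (asm) nn_integral_0_iff_AE) auto
  then have ae: "AE u in lborel. u \<in> {0<..<1} \<longrightarrow> limit_cost bneg bpos \<pi>neg \<pi>pos (b u) = 0"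
    using limit_cost_bound(1)[of "max bneg bpos"]
    by (subst (asm) AE_restrict_space_iff) (auto simp: ennreal_eq_0_iff intro: antisym)
  have no: "\<not> (\<exists>u\<in>{0<..<1}. b u \<in> S)" if S: "open S" "\<And>x. x \<in> S \<Longrightarrow> limit_cost bneg bpos \<pi>neg \<pi>pos x \<noteq> 0" for S
  proof
    assume "\<exists>u\<in>{0<..<1}. b u \<in> S"
    then have ne: "{0<..<1} \<inter> b -` S \<noteq> {}" by auto
    have op: "open ({0<..<1} \<inter> b -` S)" using b(2) S(1) by (intro continuous_open_preimage) auto
    have "AE u in lborel. u \<notin> {0<..<1} \<inter> b -` S" using ae by eventually_elim (use S(2) in auto)
    then have z: "emeasure lborel ({0<..<1} \<inter> b -` S) = 0" using op
      by (subst (asm) AE_iff_measurable[where N = "{0<..<1} \<inter> b -` S"]) (auto simp: set_eq_iff)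
    from ne obtain x where "x \<in> {0<..<1} \<inter> b -` S" by blast
    with op obtain e where "0 < e" "ball x e \<subseteq> {0<..<1} \<inter> b -` S" by (rule openE)
    then have "emeasure lborel (ball x e) \<le> emeasure lborel ({0<..<1} \<inter> b -` S)" using op by (intro emeasure_mono) auto
    moreover have "ball x e = {x - e<..<x + e}" by (rule ball_eq_greaterThanLessThan)
    ultimately show False using \<open>0 < e\<close> z by simp
  qed
  from max_\<pi> show False
  proof
    assume "\<pi>neg = 1"
    then have "\<not> (\<exists>u\<in>{0<..<1}. b u \<in> {..<0})" by (intro no) (auto simp: limit_cost_def)
    then show False using neg by auto
  next
    assume "\<pi>pos = 1"
    then have "\<not> (\<exists>u\<in>{0<..<1}. b u \<in> {0<..})" by (intro no) (auto simp: limit_cost_def)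
    then show False using pos by auto
  qed
qed

theorem corollary20:
  fixes M :: "'a measure" and X Y :: "nat \<Rightarrow> 'a \<Rightarrow> real"
    and H :: "real \<Rightarrow> real \<Rightarrow> real" and F G f hX hY :: "real \<Rightarrow> real"
    and \<rho>c :: "real \<Rightarrow> real" and bneg bpos \<pi>neg \<pi>pos b' :: real
    and c :: "real \<Rightarrow> real \<Rightarrow> real" and v :: "nat \<Rightarrow> real"
    and N :: "'b measure" and BX BY \<BB> :: "real \<Rightarrow> 'b \<Rightarrow> real" and L :: "'b \<Rightarrow> ennreal"
  assumes "prob_space M"
    and indep: "prob_space.indep_vars M (\<lambda>_. borel) (\<lambda>i \<omega>. (X i \<omega>, Y i \<omega>)) {1..}"
    and ident: "\<And>i. i \<ge> 1 \<Longrightarrow>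
          distr M borel (\<lambda>\<omega>. (X i \<omega>, Y i \<omega>)) = distr M borel (\<lambda>\<omega>. (X 1 \<omega>, Y 1 \<omega>))"
    and H: "\<And>x y. H x y = measure M {\<omega> \<in> space M. X 1 \<omega> \<le> x \<and> Y 1 \<omega> \<le> y}"
    and F: "F = cdf (distr M borel (X 1))"
    and G: "G = cdf (distr M borel (Y 1))"
    and FG: "F = G"
    and support: "law_support (distr M borel (X 1)) = {0..1}"
    and density: "\<And>x. x \<in> {0<..<1} \<Longrightarrow>
          (F has_real_derivative f x) (at x) \<and> 0 < f x \<and> f differentiable (at x)"
    \<comment> \<open>\<open>f \<circ> F\<^sup>-\<^sup>1\<close> is defined on the whole of \<open>(0,1)\<close>\<close>
    and hX_defined: "quantile F ` {0<..<1} \<subseteq> {0<..<1}"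
    and hX: "hX = f \<circ> quantile F"
    and hY: "hY = deriv G \<circ> quantile G"
    and hX1: "bdd_above ((\<lambda>u. min u (1 - u) * \<bar>deriv (\<lambda>s. ln (hX s)) u\<bar>) ` {0<..<1})"
    and hX2: "bdd_above ((\<lambda>u. min u (1 - u) / ((\<bar>quantile F u\<bar> + 1) * hX u)) ` {0<..<1})"
    and cost: "locally_admissible \<rho>c bneg bpos \<pi>neg \<pi>pos"
    and c: "\<And>x y. c x y = \<rho>c (x - y)"
    and b': "b' > 1" "bneg < b'" "bpos < b'"
    and integ: "set_integrable lborel {0<..<1} (\<lambda>u. (sqrt (u * (1 - u)) / hX u) powr b')"
    and v: "\<And>n. v n = 1 / branch_max \<rho>c (1 / sqrt (real n))"
    and "prob_space N"
    and limit: "limit_process N H F G BX BY"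
    and \<BB>: "\<And>u \<omega>. \<BB> u \<omega> = BX u \<omega> / hX u - BY u \<omega> / hY u"
    and L: "\<And>\<omega>. L \<omega> = limit_functional bneg bpos \<pi>neg \<pi>pos (\<lambda>u. \<BB> u \<omega>)"
  shows "L \<in> borel_measurable N
    \<and> weak_conv_m (\<lambda>n. distr M borel (\<lambda>\<omega>. v n * Wc c (ecdf X n \<omega>) (ecdf Y n \<omega>)))
                (distr N borel (\<lambda>\<omega>. enn2real (L \<omega>)))
    \<and> (AE \<omega> in N. L \<omega> < \<infinity>)
    \<and> (measure M {\<omega> \<in> space M. X 1 \<omega> = Y 1 \<omega>} < 1 \<longrightarrow> (AE \<omega> in N. 0 < L \<omega>))"
proof -
  interpret M: prob_space M by fact
  interpret N: prob_space N by fact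
  interpret regular_pairs M X Y F H f hX
  proof unfold_locales
    show "F = cdf (distr M borel (X 1))" by (rule F)
    show "F = cdf (distr M borel (Y 1))" using FG G by simp
    show "hX u = f (quantile F u)" for u by (simp add: hX)
    show "M.indep_vars (\<lambda>_. borel) (\<lambda>i \<omega>. (X i \<omega>, Y i \<omega>)) {1..}" by (rule indep)
    show "distr M borel (\<lambda>\<omega>. (X i \<omega>, Y i \<omega>)) = distr M borel (\<lambda>\<omega>. (X 1 \<omega>, Y 1 \<omega>))" if "1 \<le> i" for i
      by (rule ident[OF that])
    show "H x y = M.prob {\<omega> \<in> space M. X 1 \<omega> \<le> x \<and> Y 1 \<omega> \<le> y}" for x y by (rule H)
    show "quantile F ` {0<..<1} \<subseteq> {0<..<1}" by (rule hX_defined)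
    fix x :: real assume "x \<in> {0<..<1}"
    from density[OF this] show "(F has_real_derivative f x) (at x)" "0 < f x" "f differentiable (at x)" by auto
  qed
  interpret BL: bridge_limit N BX BY H F
    by unfold_locales (use limit FG in simp)
  interpret admissible_cost \<rho>c bneg bpos \<pi>neg \<pi>pos
    by unfold_locales (rule cost)
  let ?lc = "limit_cost bneg bpos \<pi>neg \<pi>pos"
  define B where "B u \<omega> = BL.\<Delta> u \<omega> / hX u" for u \<omega>
  have \<BB>_eq: "\<BB> u \<omega> = B u \<omega>" if u: "u \<in> {0<..<1}" for u \<omega>
  proof -
    \<comment> \<open>At interior points the derivative of the common distribution function is
      \<open>f\<close>, so the two scale functions agree on \<open>(0,1)\<close>.\<close>
    have "hY u = hX u"
      using DERIV_imp_deriv[OF density(1)[OF Q_range[OF u]]] FG by (simp add: hY hX)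
    then show ?thesis by (simp add: \<BB> B_def BL.\<Delta>_def diff_divide_distrib)
  qed
  have hm: "hX \<in> borel_measurable unif01"
  proof -
    have "hX \<in> borel_measurable (restrict_space borel {0<..<1})"
      by (rule borel_measurable_continuous_on_restrict[OF continuous_on_h])
    then show ?thesis by (simp cong: measurable_cong_sets add: sets_restrict_space)
  qed
  have Bm: "(\<lambda>(\<omega>, u). B u \<omega>) \<in> borel_measurable (N \<Otimes>\<^sub>M unif01)"
    unfolding B_def split_beta'
    by (intro borel_measurable_divide BL.\<Delta>_jointly_measurable[unfolded split_beta'] measurable_compose[OF measurable_snd hm])
  interpret FC: fidi_conv M N quantile_diff B
  proof unfold_locales
    show "(\<lambda>(\<omega>, u). quantile_diff n u \<omega>) \<in> borel_measurable (M \<Otimes>\<^sub>M unif01)" for n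
      by (rule quantile_diff_measurable)
    show "(\<lambda>(\<omega>, u). B u \<omega>) \<in> borel_measurable (N \<Otimes>\<^sub>M unif01)" by (rule Bm)
    fix k :: nat and t u :: "nat \<Rightarrow> real"
    assume u: "\<And>l. l < k \<Longrightarrow> u l \<in> {0<..<1}"
    have "(\<integral>\<omega>. iexp (\<Sum>l<k. t l * B (u l) \<omega>) \<partial>N) = (\<integral>\<omega>. iexp (\<Sum>l<k. (t l / hX (u l)) * BL.\<Delta> (u l) \<omega>) \<partial>N)"
      by (simp add: B_def)
    also have "\<dots> = complex_of_real (exp (- (\<Sum>l<k. \<Sum>m<k. (t l / hX (u l)) * (t m / hX (u m)) *
      (2 * min (u l) (u m) - BL.K (u l) (u m) - BL.K (u m) (u l))) / 2))"
      by (rule BL.\<Delta>_sum_iexp[OF u])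
    \<comment> \<open>The two Gaussian exponents are matched through
      \<open>F (min (Q u) (Q v)) = min u v\<close>.\<close>
    also have "(\<Sum>l<k. \<Sum>m<k. (t l / hX (u l)) * (t m / hX (u m)) * (2 * min (u l) (u m) - BL.K (u l) (u m) - BL.K (u m) (u l))) =
      (\<Sum>l<k. \<Sum>m<k. (t l / hX (u l)) * (t m / hX (u m)) *
        (2 * F (min (Q (u l)) (Q (u m))) - H (Q (u l)) (Q (u m)) - H (Q (u m)) (Q (u l))))"
    proof (intro sum.cong refl)
      fix l m assume "l \<in> {..<k}" "m \<in> {..<k}"
      then have "F (min (Q (u l)) (Q (u m))) = min (u l) (u m)"
        using u F_Q Q_mono[of "u l" "u m"] Q_mono[of "u m" "u l"] by (cases "u l \<le> u m") (auto simp: min_absorb1 min_absorb2)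
      then show "(t l / hX (u l)) * (t m / hX (u m)) * (2 * min (u l) (u m) - BL.K (u l) (u m) - BL.K (u m) (u l)) =
        (t l / hX (u l)) * (t m / hX (u m)) * (2 * F (min (Q (u l)) (Q (u m))) - H (Q (u l)) (Q (u m)) - H (Q (u m)) (Q (u l)))"
        by (simp add: BL.K_def)
    qed
    finally have eq: "(\<integral>\<omega>. iexp (\<Sum>l<k. t l * B (u l) \<omega>) \<partial>N) = complex_of_real (exp (- (\<Sum>l<k. \<Sum>m<k. (t l / hX (u l)) * (t m / hX (u m)) *
        (2 * F (min (Q (u l)) (Q (u m))) - H (Q (u l)) (Q (u m)) - H (Q (u m)) (Q (u l)))) / 2))" .
    show "(\<lambda>n. \<integral>\<omega>. iexp (\<Sum>l<k. t l * quantile_diff n (u l) \<omega>) \<partial>M) \<longlonglongrightarrow> (\<integral>\<omega>. iexp (\<Sum>l<k. t l * B (u l) \<omega>) \<partial>N)"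
      unfolding eq
    proof (rule quantile_diff_iexp_tendsto)
      fix l assume l: "l < k"
      show "u l \<in> {0<..<1}" "F (Q (u l)) = u l" "0 < hX (u l)" using u[OF l] F_Q h_pos by auto
      show "(F has_real_derivative hX (u l)) (at (Q (u l)))"
        using density(1)[OF Q_range[OF u[OF l]]] by (simp add: hX)
    qed
  qed
  define J where "J = (\<integral>\<^sup>+u. ennreal ((sqrt (u * (1 - u)) / hX u) powr b') \<partial>unif01)"
  have J: "J < \<infinity>"
  proof -
    have "integrable unif01 (\<lambda>u. (sqrt (u * (1 - u)) / hX u) powr b')"
      using integ by (simp add: set_integrable_def integrable_restrict_space)
    then show ?thesis unfolding J_def by (subst nn_integral_eq_integral) auto
  qed
  define c1 where "c1 = 2 powr b' * (8 * b' * (2 * b') powr (b' - 1) * 3 powr b')"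
  \<comment> \<open>A sum, so that one finite constant dominates the moments of the sample process
    and of the limit process.\<close>
  define C where "C = enn2real (ennreal c1 * J + ennreal (2 powr b') * abs_normal_moment b' * J)"
  have Cfin: "ennreal c1 * J + ennreal (2 powr b') * abs_normal_moment b' * J < \<infinity>"
    using J abs_normal_moment_finite[of b'] b' by (simp add: ennreal_mult_less_top less_top)
  then have C: "ennreal C = ennreal c1 * J + ennreal (2 powr b') * abs_normal_moment b' * J" "0 \<le> C"
    unfolding C_def by (auto simp: less_top)
  have momD: "(\<integral>\<^sup>+\<omega>. (\<integral>\<^sup>+u. ennreal (\<bar>quantile_diff n u \<omega>\<bar> powr b') \<partial>unif01) \<partial>M) \<le> ennreal C" for n
    using quantile_diff_moment[OF b'(1), of n] unfolding C J_def c1_def by (rule order_trans) simp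
  have momB: "(\<integral>\<^sup>+\<omega>. (\<integral>\<^sup>+u. ennreal (\<bar>B u \<omega>\<bar> powr b') \<partial>unif01) \<partial>N) \<le> ennreal C"
    unfolding B_def C J_def
    by (rule order_trans[OF BL.scaled_moment_le[OF _ continuous_on_h h_pos]]) (use b' in auto)
  have "weak_conv_m (\<lambda>n. distr M borel (\<lambda>\<omega>. \<integral>u. scaled_cost n (quantile_diff n u \<omega>) \<partial>unif01))
     (distr N borel (\<lambda>\<omega>. \<integral>u. ?lc (B u \<omega>) \<partial>unif01))"
    by (rule FC.integral_functional_weak_conv[where p = b' and C = C and r = "\<lambda>n. sqrt (real n)"])
      (use scaled_cost_measurable limit_cost_measurable C momD momB quantile_diff_bounded scaled_cost_approx[OF b'(2,3)] in auto)
  moreover have "(\<integral>u. scaled_cost n (quantile_diff n u \<omega>) \<partial>unif01) = v n * Wc c (ecdf X n \<omega>) (ecdf Y n \<omega>)" for n \<omega>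
  proof (cases "1 \<le> n")
    case True
    then have "scaled_cost n (quantile_diff n u \<omega>) = v n * c (quantile (ecdf X n \<omega>) u) (quantile (ecdf Y n \<omega>) u)" for u
      by (simp add: scaled_cost_def quantile_diff_def v c)
    then show ?thesis unfolding Wc_def set_lebesgue_integral_def
      by (simp add: integral_restrict_space)
  next
    case False
    then have "n = 0" by simp
    then have "scaled_cost n x = 0" "v n = 0" for x
      by (simp_all add: scaled_cost_def v branch_max_def branch_pos_def branch_neg_def zero)
    then show ?thesis by simp
  qed
  moreover have Bsec: "(\<lambda>u. B u \<omega>) \<in> borel_measurable unif01" if "\<omega> \<in> space N" for \<omega>
    using measurable_compose[OF measurable_Pair1'[OF that] Bm] by simp
  have L_eq: "L \<omega> = (\<integral>\<^sup>+u. ennreal (?lc (B u \<omega>)) \<partial>unif01)" if \<omega>: "\<omega> \<in> space N" for \<omega>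
  proof -
    have "(\<lambda>u. \<BB> u \<omega>) \<in> borel_measurable unif01"
      using Bsec[OF \<omega>] by (rule measurable_cong[THEN iffD1, rotated]) (simp add: \<BB>_eq space_restrict_space)
    then show ?thesis unfolding L
      by (subst limit_functional_eq) (auto intro!: nn_integral_cong simp: \<BB>_eq space_restrict_space)
  qed
  have lc_nonneg: "0 \<le> ?lc x" for x using limit_cost_bound(1)[of "max bneg bpos"] by simp
  have jm: "(\<lambda>(\<omega>, u). ennreal (?lc (B u \<omega>))) \<in> borel_measurable (N \<Otimes>\<^sub>M unif01)"
    using measurable_compose[OF measurable_compose[OF Bm limit_cost_measurable] measurable_ennreal] by (simp add: split_beta')
  have Lm: "L \<in> borel_measurable N"
    using FC.U.borel_measurable_nn_integral[OF jm] by (rule measurable_cong[THEN iffD1, rotated]) (simp add: L_eq)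
  moreover have "distr N borel (\<lambda>\<omega>. \<integral>u. ?lc (B u \<omega>) \<partial>unif01) = distr N borel (\<lambda>\<omega>. enn2real (L \<omega>))"
  proof (rule distr_cong)
    fix \<omega> assume \<omega>: "\<omega> \<in> space N"
    show "(\<integral>u. ?lc (B u \<omega>) \<partial>unif01) = enn2real (L \<omega>)"
      unfolding L_eq[OF \<omega>] using measurable_compose[OF Bsec[OF \<omega>] limit_cost_measurable] lc_nonneg
      by (intro integral_eq_nn_integral) auto
  qed auto
  moreover have "AE \<omega> in N. L \<omega> < \<infinity>"
  proof -
    \<comment> \<open>Finiteness holds already in mean, since the limit cost is at most
      \<open>1 + \<bar>x\<bar> powr b'\<close>.\<close>
    have "(\<integral>\<^sup>+\<omega>. L \<omega> \<partial>N) \<le> (\<integral>\<^sup>+\<omega>. 1 + (\<integral>\<^sup>+u. ennreal (\<bar>B u \<omega>\<bar> powr b') \<partial>unif01) \<partial>N)"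
    proof (intro nn_integral_mono)
      fix \<omega> assume \<omega>: "\<omega> \<in> space N"
      note [measurable] = Bsec[OF \<omega>]
      have "L \<omega> \<le> (\<integral>\<^sup>+u. 1 + ennreal (\<bar>B u \<omega>\<bar> powr b') \<partial>unif01)"
        unfolding L_eq[OF \<omega>]
      proof (intro nn_integral_mono)
        fix u
        have "ennreal (?lc (B u \<omega>)) \<le> ennreal (1 + \<bar>B u \<omega>\<bar> powr b')"
          using b' by (intro ennreal_leI limit_cost_bound(2)) auto
        then show "ennreal (?lc (B u \<omega>)) \<le> 1 + ennreal (\<bar>B u \<omega>\<bar> powr b')" by simp
      qed
      also have "\<dots> = 1 + (\<integral>\<^sup>+u. ennreal (\<bar>B u \<omega>\<bar> powr b') \<partial>unif01)"
        using FC.U.emeasure_space_1 by (subst nn_integral_add) (simp_all add: space_restrict_space)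
      finally show "L \<omega> \<le> 1 + (\<integral>\<^sup>+u. ennreal (\<bar>B u \<omega>\<bar> powr b') \<partial>unif01)" .
    qed
    also have "\<dots> = 1 + (\<integral>\<^sup>+\<omega>. (\<integral>\<^sup>+u. ennreal (\<bar>B u \<omega>\<bar> powr b') \<partial>unif01) \<partial>N)"
    proof -
      have "(\<lambda>(\<omega>, u). ennreal (\<bar>B u \<omega>\<bar> powr b')) \<in> borel_measurable (N \<Otimes>\<^sub>M unif01)"
        using Bm unfolding split_beta' by measurable
      then show ?thesis using FC.U.borel_measurable_nn_integral
        by (subst nn_integral_add) (auto simp: N.emeasure_space_1)
    qed
    also have "\<dots> \<le> 1 + ennreal C" by (intro add_left_mono momB)
    finally have "(\<integral>\<^sup>+\<omega>. L \<omega> \<partial>N) \<noteq> \<infinity>" by (auto simp: top_unique)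
    from nn_integral_PInf_AE[OF Lm this] show ?thesis by eventually_elim (simp add: less_top)
  qed
  moreover have "AE \<omega> in N. 0 < L \<omega>" if ne: "measure M {\<omega> \<in> space M. X 1 \<omega> = Y 1 \<omega>} < 1"
  proof -
    obtain u0 where u0: "u0 \<in> {0<..<1}" "BL.K u0 u0 < u0" using exists_non_diagonal[OF ne] by (auto simp: BL.K_def)
    have sign: "AE \<omega> in N. \<exists>u\<in>{0<..<1}. s * BL.\<Delta> u \<omega> < 0" if "s = 1 \<or> s = -1" for s :: real
    proof (rule BL.\<Delta>_changes_sign[OF _ _ _ u0 that])
      show "BL.K u w \<le> BL.K u' w'" if "u \<in> {0<..<1}" "w \<in> {0<..<1}" "u' \<in> {0<..<1}" "w' \<in> {0<..<1}" "u \<le> u'" "w \<le> w'" for u w u' w'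
        unfolding BL.K_def using that by (intro H_mono Q_mono)
      show "BL.K w w - BL.K u u \<le> 2 * (w - u)" if "u \<in> {0<..<1}" "w \<in> {0<..<1}" "u \<le> w" for u w
        using H_diag_lipschitz[OF Q_mono[OF that]] F_Q that by (simp add: BL.K_def)
      show "0 \<le> BL.K u w" for u w unfolding BL.K_def by (rule H_nonneg)
    qed
    from sign[of 1] sign[of "-1"] have "AE \<omega> in N. (\<exists>u\<in>{0<..<1}. BL.\<Delta> u \<omega> < 0) \<and> (\<exists>u\<in>{0<..<1}. 0 < BL.\<Delta> u \<omega>)"
      by simp
    with AE_space[of N] show ?thesis
    proof eventually_elim
      case (elim \<omega>)
      note \<omega> = elim(1)
      have "0 < limit_functional bneg bpos \<pi>neg \<pi>pos (\<lambda>u. B u \<omega>)"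
      proof (rule limit_functional_pos[OF Bsec[OF \<omega>]])
        have "hX u \<noteq> 0" if "u \<in> {0<..<1}" for u using h_pos[OF that] by simp
        then show "continuous_on {0<..<1} (\<lambda>u. B u \<omega>)"
          unfolding B_def by (intro continuous_on_divide BL.\<Delta>_paths[OF \<omega>] continuous_on_h) auto
        show "\<exists>u\<in>{0<..<1}. B u \<omega> < 0" "\<exists>u\<in>{0<..<1}. 0 < B u \<omega>"
          using elim(2) h_pos unfolding B_def by (meson divide_neg_pos divide_pos_pos)+
      qed
      then show ?case by (simp add: L_eq[OF \<omega>] limit_functional_eq[OF Bsec[OF \<omega>]])
    qed
  qed
  ultimately show ?thesis by simp
qed

end
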